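(* Let $\mathcal K$ be a flag simplicial complex on the vertex set $[m]$. Then for $i=2,3$ we have $$\dim_{\mathbb Z_2}L_i(\mathrm{RC}_{\mathcal K})=n_2(\mathcal K)+\dots+n_i(\mathcal K).$$
   Context: $[m]=\{1,\dots,m\}$; simplicial complexes on $[m]$ contain $\varnothing$ and all singletons; $\mathcal K$ is flag if every set of pairwise adjacent vertices is a simplex. $\mathbb Z_2$ is the field with two elements. For $J\subset[m]$, $\mathcal K_J=\{I\in\mathcal K: I\subset J\}$. $\mathrm{RC}_{\mathcal K}=\langle g_1,\dots,g_m\mid g_i^2=1,\ g_ig_j=g_jg_i \text{ for }\{i,j\}\in\mathcal K\rangle$. For a group $G$: $\gamma_1(G)=G$, $\gamma_{k+1}(G)=(\gamma_k(G),G)$, $L_k(G)=\gamma_k(G)/\gamma_{k+1}(G)$; the groups $L_k(\mathrm{RC}_{\mathcal K})$ are vector spaces over $\mathbb Z_2$. $L_{\mathcal K}=\mathrm{FL}_{\mathbb Z_2}(\mu_1,\dots,\mu_m)/([\mu_i,\mu_j]=0\text{ for }\{i,j\}\in\mathcal K)$, where $\mathrm{FL}_{\mathbb Z_2}$ is the free Lie algebra over $\mathbb Z_2$, graded by $\deg\mu_i=1$. For $I=\{t_1<\dots<t_s\}\subset[m]$ put $c_\mu(I,x)=[\mu_{t_1},[\mu_{t_2},\dots[\mu_{t_s},x]\dots]]$. For $J\subset[m]$ let $\Theta_{\mathcal K}(J)\subset J$ be the set of all $j\in J$ such that $j$ is the smallest vertex of its connected component of $\mathcal K_J$, and $j$ and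 $\max(J)$ lie in different connected components of $\mathcal K_J$. $N_{\mathcal K}\subset L_{\mathcal K}$ is the Lie subalgebra generated by $\{c_\mu(J\setminus\{j\},\mu_j): J\subset[m],\ j\in\Theta_{\mathcal K}(J)\}$, and $n_i(\mathcal K):=\dim_{\mathbb Z_2}(N_{\mathcal K})_i$ is the dimension of its degree-$i$ component. *)

theory Defs
  imports
    "HOL-Algebra.Generated_Groups"
    "HOL-Algebra.AbelCoset"
    "HOL-Library.Z2"
    "Jordan_Normal_Form.VS_Connect"
begin

section \<open>Flag complexes and the sets \<open>\<Theta>\<^sub>K(J)\<close>\<close>

definition simplicial_complex :: "nat \<Rightarrow> nat set set \<Rightarrow> bool" where
  "simplicial_complex m K \<longleftrightarrow>
     K \<subseteq> Pow {1..m} \<and> {} \<in> K \<and> (\<forall>i\<in>{1..m}. {i} \<in> K) \<and>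
     (\<forall>I\<in>K. \<forall>I'. I' \<subseteq> I \<longrightarrow> I' \<in> K)"

definition flag_complex :: "nat \<Rightarrow> nat set set \<Rightarrow> bool" where
  "flag_complex m K \<longleftrightarrow> simplicial_complex m K \<and>
     (\<forall>I \<subseteq> {1..m}. (\<forall>i\<in>I. \<forall>j\<in>I. i \<noteq> j \<longrightarrow> {i, j} \<in> K) \<longrightarrow> I \<in> K)"

definition full_subcomplex :: "nat set set \<Rightarrow> nat set \<Rightarrow> nat set set" where
  "full_subcomplex K J = {I \<in> K. I \<subseteq> J}"

text \<open>The vertex set of the connected component of the vertex \<open>j\<close>; components of a complex
  are those of its 1-skeleton.\<close>

definition component :: "nat set set \<Rightarrow> nat \<Rightarrow> nat set" where
  "component K j = {(u, v). {u, v} \<in> K}\<^sup>* `` {j}"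

definition Theta :: "nat set set \<Rightarrow> nat set \<Rightarrow> nat set" where
  "Theta K J = {j \<in> J. (\<forall>i \<in> component (full_subcomplex K J) j. j \<le> i) \<and>
                  component (full_subcomplex K J) j \<noteq> component (full_subcomplex K J) (Max J)}"

section \<open>Right-angled Coxeter groups and the lower central series\<close>

text \<open>The letters \<open>(x, True)\<close> and \<open>(x, False)\<close> stand for \<open>x\<close> and its formal inverse; a pair
  \<open>(u, v)\<close> of words in \<open>E\<close> stands for the relation \<open>u = v\<close>.\<close>

type_synonym 'x word = "('x \<times> bool) list"

inductive_set word_cong :: "'x set \<Rightarrow> ('x word \<times> 'x word) set \<Rightarrow> ('x word \<times> 'x word) set"
  for X :: "'x set" and E :: "('x word \<times> 'x word) set"
where
  refl: "u \<in> lists (X \<times> UNIV) \<Longrightarrow> (u, u) \<in> word_cong X E"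
| sym: "(u, v) \<in> word_cong X E \<Longrightarrow> (v, u) \<in> word_cong X E"
| trans: "\<lbrakk>(u, v) \<in> word_cong X E; (v, w) \<in> word_cong X E\<rbrakk> \<Longrightarrow> (u, w) \<in> word_cong X E"
| append: "\<lbrakk>(u, u') \<in> word_cong X E; (v, v') \<in> word_cong X E\<rbrakk>
    \<Longrightarrow> (u @ v, u' @ v') \<in> word_cong X E"
| cancel: "x \<in> X \<Longrightarrow> ([(x, b), (x, \<not> b)], []) \<in> word_cong X E"
| relation: "\<lbrakk>(u, v) \<in> E; u \<in> lists (X \<times> UNIV); v \<in> lists (X \<times> UNIV)\<rbrakk>
    \<Longrightarrow> (u, v) \<in> word_cong X E"

definition presented_group :: "'x set \<Rightarrow> ('x word \<times> 'x word) set \<Rightarrow> 'x word set monoid" where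
  "presented_group X E =
     \<lparr>carrier = lists (X \<times> UNIV) // word_cong X E,
      mult = (\<lambda>A B. \<Union>u\<in>A. \<Union>v\<in>B. word_cong X E `` {u @ v}),
      one = word_cong X E `` {[]}\<rparr>"

definition RC :: "nat \<Rightarrow> nat set set \<Rightarrow> nat word set monoid" where
  "RC m K = (let g = (\<lambda>i. (i, True)) in
     presented_group {1..m}
       ({([g i, g i], []) | i. i \<in> {1..m}} \<union>
        {([g i, g j], [g j, g i]) | i j. i \<in> {1..m} \<and> j \<in> {1..m} \<and> {i, j} \<in> K}))"

text \<open>For subgroups \<open>A\<close> and \<open>B\<close> the commutator convention \<open>a\<^sup>-\<^sup>1b\<^sup>-\<^sup>1ab\<close> gives the same set of
  generators.\<close>

definition commutator_subgroup :: "('a, 'b) monoid_scheme \<Rightarrow> 'a set \<Rightarrow> 'a set \<Rightarrow> 'a set" where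
  "commutator_subgroup G A B =
     generate G (\<Union>a\<in>A. \<Union>b\<in>B. {a \<otimes>\<^bsub>G\<^esub> b \<otimes>\<^bsub>G\<^esub> inv\<^bsub>G\<^esub> a \<otimes>\<^bsub>G\<^esub> inv\<^bsub>G\<^esub> b})"

text \<open>Indexed from 1; the value at 0 is a dummy.\<close>

fun lower_central :: "('a, 'b) monoid_scheme \<Rightarrow> nat \<Rightarrow> 'a set" where
  "lower_central G 0 = carrier G"
| "lower_central G (Suc 0) = carrier G"
| "lower_central G (Suc (Suc k)) = commutator_subgroup G (lower_central G (Suc k)) (carrier G)"

definition lower_central_quotient :: "('a, 'b) monoid_scheme \<Rightarrow> nat \<Rightarrow> 'a set monoid" where
  "lower_central_quotient G k =
     (G\<lparr>carrier := lower_central G k\<rparr>) Mod lower_central G (Suc k)"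

abbreviation Z2 :: "bit ring" where
  "Z2 \<equiv> class_ring"

text \<open>An elementary abelian 2-group as a vector space over the field with two elements; the
  scalar multiplication is the only possible one. The fields \<open>mult\<close> and \<open>one\<close> of the record
  type of modules carry no meaning for modules.\<close>

definition Z2_space :: "('a, 'b) monoid_scheme \<Rightarrow> (bit, 'a) module" where
  "Z2_space G =
     \<lparr>carrier = carrier G, mult = undefined, one = undefined,
      zero = \<one>\<^bsub>G\<^esub>, add = (\<lambda>x y. x \<otimes>\<^bsub>G\<^esub> y),
      smult = (\<lambda>a x. if a = 0 then \<one>\<^bsub>G\<^esub> else x)\<rparr>"

section \<open>Lie algebras\<close>

record ('r, 'a) lie_algebra = "('r, 'a) module" +
  bracket :: "'a \<Rightarrow> 'a \<Rightarrow> 'a"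

inductive_set lie_ideal :: "('r, 'c) ring_scheme \<Rightarrow> ('r, 'a, 'd) lie_algebra_scheme \<Rightarrow> 'a set \<Rightarrow> 'a set"
  for R (structure) and L (structure) and S
where
  incl: "x \<in> S \<Longrightarrow> x \<in> lie_ideal R L S"
| zero: "\<zero>\<^bsub>L\<^esub> \<in> lie_ideal R L S"
| add: "\<lbrakk>x \<in> lie_ideal R L S; y \<in> lie_ideal R L S\<rbrakk> \<Longrightarrow> x \<oplus>\<^bsub>L\<^esub> y \<in> lie_ideal R L S"
| smult: "\<lbrakk>a \<in> carrier R; x \<in> lie_ideal R L S\<rbrakk> \<Longrightarrow> a \<odot>\<^bsub>L\<^esub> x \<in> lie_ideal R L S"
| bracket: "\<lbrakk>x \<in> carrier L; y \<in> lie_ideal R L S\<rbrakk> \<Longrightarrow> bracket L x y \<in> lie_ideal R L S"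

inductive_set lie_subalgebra :: "('r, 'c) ring_scheme \<Rightarrow> ('r, 'a, 'd) lie_algebra_scheme \<Rightarrow> 'a set \<Rightarrow> 'a set"
  for R (structure) and L (structure) and S
where
  incl: "x \<in> S \<Longrightarrow> x \<in> lie_subalgebra R L S"
| zero: "\<zero>\<^bsub>L\<^esub> \<in> lie_subalgebra R L S"
| add: "\<lbrakk>x \<in> lie_subalgebra R L S; y \<in> lie_subalgebra R L S\<rbrakk>
    \<Longrightarrow> x \<oplus>\<^bsub>L\<^esub> y \<in> lie_subalgebra R L S"
| smult: "\<lbrakk>a \<in> carrier R; x \<in> lie_subalgebra R L S\<rbrakk> \<Longrightarrow> a \<odot>\<^bsub>L\<^esub> x \<in> lie_subalgebra R L S"
| bracket: "\<lbrakk>x \<in> lie_subalgebra R L S; y \<in> lie_subalgebra R L S\<rbrakk>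
    \<Longrightarrow> bracket L x y \<in> lie_subalgebra R L S"

text \<open>The homogeneous elements of degree \<open>d\<close> when the elements of \<open>S\<close> have degree 1, i.e. the
  span of all brackets of \<open>d\<close> elements of \<open>S\<close>.\<close>

inductive homogeneous ::
  "('r, 'c) ring_scheme \<Rightarrow> ('r, 'a, 'd) lie_algebra_scheme \<Rightarrow> 'a set \<Rightarrow> nat \<Rightarrow> 'a \<Rightarrow> bool"
  for R (structure) and L (structure) and S
where
  gen: "x \<in> S \<Longrightarrow> homogeneous R L S 1 x"
| zero: "homogeneous R L S d \<zero>\<^bsub>L\<^esub>"
| add: "\<lbrakk>homogeneous R L S d x; homogeneous R L S d y\<rbrakk> \<Longrightarrow> homogeneous R L S d (x \<oplus>\<^bsub>L\<^esub> y)"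
| smult: "\<lbrakk>a \<in> carrier R; homogeneous R L S d x\<rbrakk> \<Longrightarrow> homogeneous R L S d (a \<odot>\<^bsub>L\<^esub> x)"
| bracket: "\<lbrakk>homogeneous R L S d x; homogeneous R L S e y\<rbrakk>
    \<Longrightarrow> homogeneous R L S (d + e) (bracket L x y)"

definition lie_quotient :: "('r, 'a) lie_algebra \<Rightarrow> 'a set \<Rightarrow> ('r, 'a set) lie_algebra" where
  "lie_quotient L I =
     \<lparr>carrier = a_rcosets\<^bsub>L\<^esub> I, mult = undefined, one = undefined,
      zero = I, add = set_add L,
      smult = (\<lambda>a A. \<Union>x\<in>A. I +>\<^bsub>L\<^esub> (a \<odot>\<^bsub>L\<^esub> x)),
      bracket = (\<lambda>A B. \<Union>x\<in>A. \<Union>y\<in>B. I +>\<^bsub>L\<^esub> bracket L x y)\<rparr>"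

subsection \<open>The free Lie algebra over a ring \<open>R\<close> on a set \<open>X\<close>\<close>

text \<open>Formal Lie expressions modulo the least congruence that enforces the laws of an
  \<open>R\<close>-module, bilinearity, \<open>[x,x] = 0\<close> and the Jacobi identity.\<close>

datatype ('r, 'x) lie_term =
    Gen 'x
  | Zero
  | Add "('r, 'x) lie_term" "('r, 'x) lie_term"
  | Scale 'r "('r, 'x) lie_term"
  | Br "('r, 'x) lie_term" "('r, 'x) lie_term"

inductive_set lie_terms :: "('r, 'c) ring_scheme \<Rightarrow> 'x set \<Rightarrow> ('r, 'x) lie_term set"
  for R (structure) and X
where
  Gen: "x \<in> X \<Longrightarrow> Gen x \<in> lie_terms R X"
| Zero: "Zero \<in> lie_terms R X"
| Add: "\<lbrakk>s \<in> lie_terms R X; t \<in> lie_terms R X\<rbrakk> \<Longrightarrow> Add s t \<in> lie_terms R X"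
| Scale: "\<lbrakk>a \<in> carrier R; t \<in> lie_terms R X\<rbrakk> \<Longrightarrow> Scale a t \<in> lie_terms R X"
| Br: "\<lbrakk>s \<in> lie_terms R X; t \<in> lie_terms R X\<rbrakk> \<Longrightarrow> Br s t \<in> lie_terms R X"

inductive_set lie_cong ::
  "('r, 'c) ring_scheme \<Rightarrow> 'x set \<Rightarrow> (('r, 'x) lie_term \<times> ('r, 'x) lie_term) set"
  for R (structure) and X
where
  refl: "t \<in> lie_terms R X \<Longrightarrow> (t, t) \<in> lie_cong R X"
| sym: "(s, t) \<in> lie_cong R X \<Longrightarrow> (t, s) \<in> lie_cong R X"
| trans: "\<lbrakk>(s, t) \<in> lie_cong R X; (t, u) \<in> lie_cong R X\<rbrakk> \<Longrightarrow> (s, u) \<in> lie_cong R X"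
| cong_Add: "\<lbrakk>(s, s') \<in> lie_cong R X; (t, t') \<in> lie_cong R X\<rbrakk>
    \<Longrightarrow> (Add s t, Add s' t') \<in> lie_cong R X"
| cong_Scale: "\<lbrakk>a \<in> carrier R; (t, t') \<in> lie_cong R X\<rbrakk>
    \<Longrightarrow> (Scale a t, Scale a t') \<in> lie_cong R X"
| cong_Br: "\<lbrakk>(s, s') \<in> lie_cong R X; (t, t') \<in> lie_cong R X\<rbrakk>
    \<Longrightarrow> (Br s t, Br s' t') \<in> lie_cong R X"
| add_assoc: "\<lbrakk>s \<in> lie_terms R X; t \<in> lie_terms R X; u \<in> lie_terms R X\<rbrakk>
    \<Longrightarrow> (Add (Add s t) u, Add s (Add t u)) \<in> lie_cong R X"
| add_comm: "\<lbrakk>s \<in> lie_terms R X; t \<in> lie_terms R X\<rbrakk>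
    \<Longrightarrow> (Add s t, Add t s) \<in> lie_cong R X"
| add_zero: "t \<in> lie_terms R X \<Longrightarrow> (Add Zero t, t) \<in> lie_cong R X"
| scale_zero: "t \<in> lie_terms R X \<Longrightarrow> (Scale \<zero> t, Zero) \<in> lie_cong R X"
| scale_one: "t \<in> lie_terms R X \<Longrightarrow> (Scale \<one> t, t) \<in> lie_cong R X"
| scale_scale: "\<lbrakk>a \<in> carrier R; b \<in> carrier R; t \<in> lie_terms R X\<rbrakk>
    \<Longrightarrow> (Scale (a \<otimes> b) t, Scale a (Scale b t)) \<in> lie_cong R X"
| scale_add_left: "\<lbrakk>a \<in> carrier R; b \<in> carrier R; t \<in> lie_terms R X\<rbrakk>
    \<Longrightarrow> (Scale (a \<oplus> b) t, Add (Scale a t) (Scale b t)) \<in> lie_cong R X"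
| scale_add_right: "\<lbrakk>a \<in> carrier R; s \<in> lie_terms R X; t \<in> lie_terms R X\<rbrakk>
    \<Longrightarrow> (Scale a (Add s t), Add (Scale a s) (Scale a t)) \<in> lie_cong R X"
| br_add_left: "\<lbrakk>s \<in> lie_terms R X; t \<in> lie_terms R X; u \<in> lie_terms R X\<rbrakk>
    \<Longrightarrow> (Br (Add s t) u, Add (Br s u) (Br t u)) \<in> lie_cong R X"
| br_add_right: "\<lbrakk>s \<in> lie_terms R X; t \<in> lie_terms R X; u \<in> lie_terms R X\<rbrakk>
    \<Longrightarrow> (Br s (Add t u), Add (Br s t) (Br s u)) \<in> lie_cong R X"
| br_scale_left: "\<lbrakk>a \<in> carrier R; s \<in> lie_terms R X; t \<in> lie_terms R X\<rbrakk>
    \<Longrightarrow> (Br (Scale a s) t, Scale a (Br s t)) \<in> lie_cong R X"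
| br_scale_right: "\<lbrakk>a \<in> carrier R; s \<in> lie_terms R X; t \<in> lie_terms R X\<rbrakk>
    \<Longrightarrow> (Br s (Scale a t), Scale a (Br s t)) \<in> lie_cong R X"
| br_self: "t \<in> lie_terms R X \<Longrightarrow> (Br t t, Zero) \<in> lie_cong R X"
| jacobi: "\<lbrakk>s \<in> lie_terms R X; t \<in> lie_terms R X; u \<in> lie_terms R X\<rbrakk>
    \<Longrightarrow> (Add (Br s (Br t u)) (Add (Br t (Br u s)) (Br u (Br s t))), Zero) \<in> lie_cong R X"

definition free_lie :: "('r, 'c) ring_scheme \<Rightarrow> 'x set \<Rightarrow> ('r, ('r, 'x) lie_term set) lie_algebra" where
  "free_lie R X =
     \<lparr>carrier = lie_terms R X // lie_cong R X, mult = undefined, one = undefined,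
      zero = lie_cong R X `` {Zero},
      add = (\<lambda>A B. \<Union>s\<in>A. \<Union>t\<in>B. lie_cong R X `` {Add s t}),
      smult = (\<lambda>a A. \<Union>t\<in>A. lie_cong R X `` {Scale a t}),
      bracket = (\<lambda>A B. \<Union>s\<in>A. \<Union>t\<in>B. lie_cong R X `` {Br s t})\<rparr>"

definition free_gen :: "('r, 'c) ring_scheme \<Rightarrow> 'x set \<Rightarrow> 'x \<Rightarrow> ('r, 'x) lie_term set" where
  "free_gen R X x = lie_cong R X `` {Gen x}"

section \<open>The Lie algebra \<open>L\<^sub>K\<close> and its subalgebra \<open>N\<^sub>K\<close>\<close>

definition graph_ideal :: "nat \<Rightarrow> nat set set \<Rightarrow> (bit, nat) lie_term set set" where
  "graph_ideal m K = lie_ideal Z2 (free_lie Z2 {1..m})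
     {bracket (free_lie Z2 {1..m}) (free_gen Z2 {1..m} i) (free_gen Z2 {1..m} j) | i j.
        i \<in> {1..m} \<and> j \<in> {1..m} \<and> {i, j} \<in> K}"

definition graph_lie :: "nat \<Rightarrow> nat set set \<Rightarrow> (bit, (bit, nat) lie_term set set) lie_algebra" where
  "graph_lie m K = lie_quotient (free_lie Z2 {1..m}) (graph_ideal m K)"

definition mu :: "nat \<Rightarrow> nat set set \<Rightarrow> nat \<Rightarrow> (bit, nat) lie_term set set" where
  "mu m K i = graph_ideal m K +>\<^bsub>free_lie Z2 {1..m}\<^esub> free_gen Z2 {1..m} i"

definition c_mu :: "nat \<Rightarrow> nat set set \<Rightarrow> nat set \<Rightarrow>
    (bit, nat) lie_term set set \<Rightarrow> (bit, nat) lie_term set set" where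
  "c_mu m K I x = foldr (\<lambda>t y. bracket (graph_lie m K) (mu m K t) y) (sorted_list_of_set I) x"

definition N_carrier :: "nat \<Rightarrow> nat set set \<Rightarrow> (bit, nat) lie_term set set set" where
  "N_carrier m K = lie_subalgebra Z2 (graph_lie m K)
     {c_mu m K (J - {j}) (mu m K j) | J j. J \<subseteq> {1..m} \<and> j \<in> Theta K J}"

definition N_component :: "nat \<Rightarrow> nat set set \<Rightarrow> nat \<Rightarrow> (bit, (bit, nat) lie_term set set) lie_algebra" where
  "N_component m K i = (graph_lie m K)
     \<lparr>carrier := {x \<in> N_carrier m K. homogeneous Z2 (graph_lie m K) (mu m K ` {1..m}) i x}\<rparr>"

definition n_dim :: "nat \<Rightarrow> nat set set \<Rightarrow> nat \<Rightarrow> nat" where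
  "n_dim m K i = vectorspace.dim Z2 (N_component m K i)"

end

theory Submission
  imports Defs
begin

text \<open>
  \<open>L\<^sub>2(RC\<^sub>K)\<close> is spanned by the commutators of non-adjacent generators. Modulo \<open>\<gamma>\<^sub>4\<close>, the Hall--Witt
  identity and \<open>(g\<^sub>i, g\<^sub>j, g\<^sub>i) = (g\<^sub>i, g\<^sub>j, g\<^sub>j) = (g\<^sub>i, g\<^sub>j)\<^sup>2\<close> reduce all triple commutators to one
  for every non-edge and one for every pair \<open>(J, j)\<close> with \<open>|J| = 3\<close> and \<open>j \<in> \<Theta>\<^sub>K(J)\<close>. These are
  independent: a homomorphism to the infinite dihedral group detects a non-edge, and a homomorphism
  to the unitriangular \<open>4 \<times> 4\<close> matrices over the field with two elements, which sends three
  generators to the elementary matrices along a path of two non-edges, detects a pair \<open>(J, j)\<close>.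

  The generators of \<open>N\<^sub>K\<close> have degree at least 2, so the components of degree 2 and 3 are spanned by
  the generators of that degree, and the Lie algebra of strictly upper triangular matrices shows their
  independence in the same way.
\<close>

text \<open>The summand n_2 in degree 3 comes from squaring: the square of the commutator of two
  involutions is again a triple commutator, so each non-edge contributes a second time. N_K has no
  counterpart, since every generator belongs to a set J and repeats no index; the formula makes up
  for this by adding the lower degree.

  Each dimension is found from a generating family and additive maps to the two-element field dual
  to it. Universal properties supply the homomorphisms behind these maps, so no normal form in RC_K
  or L_K is established.

  Degree 3 of the group uses two kinds of detecting group, each blind to the elements of the other:
  a dihedral image retains only two generators, while the matrix corner counts a word with three
  distinct letters. The choice of that word is the delicate point: the homomorphism exists only
  along non-edges, and both smaller vertices of one J may lie in \<open>Theta K J\<close>, so the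
  word must tell them apart.

  In L_K degrees are given by an inductive predicate on a quotient, so a homomorphism that marks
  degrees has to recover the homogeneous parts.\<close>

section \<open>Vector spaces over the field with two elements\<close>

text \<open>These rules would turn ring arithmetic on bits into bit operations.\<close>

declare add_bit_eq_xor [simp del] mult_bit_eq_and [simp del]

text \<open>Dual functionals force independence. With only the scalars 0 and 1 an additive map is
  linear and an additively closed set containing zero is a subspace, so \<open>f_add\<close> and
  \<open>gen\<close> speak of addition alone.\<close>

lemma dim_eq_card_of_dual_family:
  fixes V :: "(bit, 'v, 'z) module_scheme" and f :: "'p \<Rightarrow> 'v \<Rightarrow> bit"
  assumes V: "vectorspace Z2 V" and fin: "finite P"
    and b: "\<And>p. p \<in> P \<Longrightarrow> b p \<in> carrier V"
    and f_add: "\<And>p x y. \<lbrakk>p \<in> P; x \<in> carrier V; y \<in> carrier V\<rbrakk> \<Longrightarrow> f p (x \<oplus>\<^bsub>V\<^esub> y) = f p x + f p y"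
    and dual: "\<And>p q. \<lbrakk>p \<in> P; q \<in> P\<rbrakk> \<Longrightarrow> f p (b q) = (if p = q then 1 else 0)"
    and gen: "\<And>S. \<lbrakk>\<zero>\<^bsub>V\<^esub> \<in> S; \<And>x y. \<lbrakk>x \<in> S; y \<in> S\<rbrakk> \<Longrightarrow> x \<oplus>\<^bsub>V\<^esub> y \<in> S; b ` P \<subseteq> S\<rbrakk> \<Longrightarrow> carrier V \<subseteq> S"
  shows "vectorspace.dim Z2 V = card P"
proof -
  interpret V: vectorspace Z2 V by (rule V)
  have inj: "inj_on b P"
    by (rule inj_onI) (metis dual one_neq_zero)
  have bP: "b ` P \<subseteq> carrier V" using b by auto
  have f_zero: "f p \<zero>\<^bsub>V\<^esub> = 0" if "p \<in> P" for p
    using f_add[OF that, of "\<zero>\<^bsub>V\<^esub>" "\<zero>\<^bsub>V\<^esub>"] by simp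
  have f_smult: "f p (a \<odot>\<^bsub>V\<^esub> x) = a * f p x" if "p \<in> P" "x \<in> carrier V" for p a x
  proof (cases a)
    case zero
    then show ?thesis using V.lmult_0[OF that(2)] f_zero that by simp
  next
    case one
    then show ?thesis using V.smult_one[OF that(2)] by simp
  qed
  have f_finsum: "f p (finsum V (\<lambda>v. a v \<odot>\<^bsub>V\<^esub> v) A) = (\<Sum>v\<in>A. a v * f p v)"
    if "p \<in> P" "finite A" "A \<subseteq> carrier V" for p A and a :: "'v \<Rightarrow> bit"
    using that(2,3)
  proof (induction A)
    case empty
    then show ?case using f_zero[OF that(1)] by simp
  next
    case (insert v A)
    then have "(\<lambda>v. a v \<odot>\<^bsub>V\<^esub> v) \<in> A \<rightarrow> carrier V" "a v \<odot>\<^bsub>V\<^esub> v \<in> carrier V"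
      by (auto intro!: V.smult_closed)
    then have "f p (finsum V (\<lambda>v. a v \<odot>\<^bsub>V\<^esub> v) (insert v A)) =
        a v * f p v + f p (finsum V (\<lambda>v. a v \<odot>\<^bsub>V\<^esub> v) A)"
      using insert.hyps insert.prems that(1)
      by (subst V.finsum_insert) (auto simp: f_add f_smult)
    then show ?case
      using insert by simp
  qed
  have "V.lin_indpt (b ` P)"
  proof (rule V.finite_lin_indpt2)
    fix a assume a: "V.lincomb a (b ` P) = \<zero>\<^bsub>V\<^esub>"
    show "\<forall>v\<in>b ` P. a v = \<zero>\<^bsub>Z2\<^esub>"
    proof
      fix v assume "v \<in> b ` P"
      then obtain p where p: "p \<in> P" "v = b p" by auto
      have "0 = (\<Sum>v\<in>b ` P. a v * f p v)"
        using f_finsum[OF p(1), of "b ` P" a] a f_zero[OF p(1)] fin bP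
        unfolding V.lincomb_def by simp
      also have "\<dots> = (\<Sum>q\<in>P. a (b q) * f p (b q))"
        using inj by (simp add: sum.reindex)
      also have "\<dots> = (\<Sum>q\<in>P. if q = p then a (b q) else 0)"
        by (rule sum.cong) (auto simp: dual p)
      also have "\<dots> = a v" using fin p by (simp add: sum.delta)
      finally show "a v = \<zero>\<^bsub>Z2\<^esub>" by simp
    qed
  qed (use fin bP in auto)
  moreover have "V.span (b ` P) = carrier V"
  proof
    show "V.span (b ` P) \<subseteq> carrier V" by (rule V.span_is_subset2[OF bP])
    have sub: "submodule Z2 (V.span (b ` P)) V" by (rule V.span_is_submodule[OF bP])
    show "carrier V \<subseteq> V.span (b ` P)"
      by (rule gen)
        (use submodule.zero_closed[OF sub] submodule.m_closed[OF sub] V.in_own_span[OF bP] in auto)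
  qed
  ultimately have "V.basis (b ` P)" using bP by (simp add: V.basis_def)
  then show ?thesis
    using V.dim_basis[of "b ` P"] fin card_image[OF inj] by simp
qed

lemma vectorspace_Z2_space:
  assumes "comm_group G" and sq: "\<And>x. x \<in> carrier G \<Longrightarrow> x \<otimes>\<^bsub>G\<^esub> x = \<one>\<^bsub>G\<^esub>"
  shows "vectorspace Z2 (Z2_space G)"
proof -
  interpret G: comm_group G by fact
  have cg: "abelian_group (Z2_space G)"
    by (rule abelian_groupI) (auto simp: Z2_space_def G.m_ac intro: G.l_inv_ex)
  have "module Z2 (Z2_space G)"
  proof (rule Module.module.intro[OF class_cring.is_cring cg], unfold_locales, goal_cases)
    \<comment> \<open>Distributivity over the sum of two scalars: for \<open>a = b = 1\<close> the
      sum is 0, and the law becomes \<open>sq\<close>.\<close>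
    case (2 a b x)
    then show ?case by (cases a; cases b) (auto simp: Z2_space_def sq)
  qed (auto simp: Z2_space_def)
  then show ?thesis by (rule vectorspace.intro) (rule class_field)
qed

section \<open>Presented groups\<close>

lemma word_cong_lists:
  assumes "(u, v) \<in> word_cong X E"
  shows "u \<in> lists (X \<times> UNIV)" and "v \<in> lists (X \<times> UNIV)"
  using assms by (induction rule: word_cong.induct) auto

lemma equiv_word_cong: "equiv (lists (X \<times> UNIV)) (word_cong X E)"
  by (rule equivI)
    (auto simp: refl_on_def sym_def trans_def dest: word_cong_lists
      intro: word_cong.refl word_cong.sym word_cong.trans)

lemma word_class_eq_iff:
  assumes "u \<in> lists (X \<times> UNIV)" "v \<in> lists (X \<times> UNIV)"
  shows "word_cong X E `` {u} = word_cong X E `` {v} \<longleftrightarrow> (u, v) \<in> word_cong X E"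
  using eq_equiv_class_iff[OF equiv_word_cong] assms by blast

lemma carrier_presented_group:
  "carrier (presented_group X E) = (\<lambda>u. word_cong X E `` {u}) ` lists (X \<times> UNIV)"
  by (auto simp: presented_group_def quotient_def)

lemma presented_groupE:
  assumes "A \<in> carrier (presented_group X E)"
  obtains u where "u \<in> lists (X \<times> UNIV)" "A = word_cong X E `` {u}"
  using assms unfolding carrier_presented_group by auto

lemma mult_presented_group:
  assumes "u \<in> lists (X \<times> UNIV)" "v \<in> lists (X \<times> UNIV)"
  shows "word_cong X E `` {u} \<otimes>\<^bsub>presented_group X E\<^esub> word_cong X E `` {v} = word_cong X E `` {u @ v}"
proof -
  have "word_cong X E `` {u' @ v'} = word_cong X E `` {u @ v}"
    if "(u, u') \<in> word_cong X E" "(v, v') \<in> word_cong X E" for u' v'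
    using word_cong.append[OF that] equiv_class_eq[OF equiv_word_cong] by blast
  then have "(\<Union>u'\<in>word_cong X E `` {u}. \<Union>v'\<in>word_cong X E `` {v}. word_cong X E `` {u' @ v'}) =
      (\<Union>u'\<in>word_cong X E `` {u}. \<Union>v'\<in>word_cong X E `` {v}. word_cong X E `` {u @ v})"
    by (intro SUP_cong) auto
  moreover have "u \<in> word_cong X E `` {u}" "v \<in> word_cong X E `` {v}"
    using assms by (simp_all only: Image_singleton_iff word_cong.refl)
  ultimately show ?thesis
    unfolding presented_group_def by (simp only: monoid.simps SUP_constant) auto
qed

definition inverse_word :: "'x word \<Rightarrow> 'x word" where
  "inverse_word w = rev (map (\<lambda>(x, b). (x, \<not> b)) w)"

lemma inverse_word_lists: "w \<in> lists (X \<times> UNIV) \<Longrightarrow> inverse_word w \<in> lists (X \<times> UNIV)"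
  by (induction w) (auto simp: inverse_word_def)

lemma inverse_word_cong:
  "w \<in> lists (X \<times> UNIV) \<Longrightarrow> (inverse_word w @ w, []) \<in> word_cong X E"
proof (induction w)
  case Nil
  then show ?case by (simp add: inverse_word_def word_cong.refl)
next
  case (Cons l w)
  obtain x b where l: "l = (x, b)" by (cases l)
  have w: "w \<in> lists (X \<times> UNIV)" and x: "x \<in> X" using Cons.prems l by auto
  have "([(x, \<not> b), (x, b)] @ w, [] @ w) \<in> word_cong X E"
    using word_cong.cancel[OF x, of "\<not> b" E]
    by (intro word_cong.append[OF _ word_cong.refl[OF w]]) simp
  then have "(inverse_word w @ ([(x, \<not> b), (x, b)] @ w), inverse_word w @ ([] @ w)) \<in> word_cong X E"
    by (rule word_cong.append[OF word_cong.refl[OF inverse_word_lists[OF w]]])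
  from word_cong.trans[OF this, of "[]"] show ?case
    using Cons.IH[OF w] by (simp add: inverse_word_def l)
qed

lemma group_presented_group: "group (presented_group X E)"
proof (rule groupI)
  let ?G = "presented_group X E"
  have one: "\<one>\<^bsub>?G\<^esub> = word_cong X E `` {[]}" by (simp add: presented_group_def)
  show "\<one>\<^bsub>?G\<^esub> \<in> carrier ?G"
    unfolding one carrier_presented_group by (rule imageI) simp
  fix A assume "A \<in> carrier ?G"
  then obtain u where u: "u \<in> lists (X \<times> UNIV)" "A = word_cong X E `` {u}"
    by (rule presented_groupE)
  show "\<one>\<^bsub>?G\<^esub> \<otimes>\<^bsub>?G\<^esub> A = A"
    using mult_presented_group[of "[]" X u E] u by (simp add: one)
  show "\<exists>B\<in>carrier ?G. B \<otimes>\<^bsub>?G\<^esub> A = \<one>\<^bsub>?G\<^esub>"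
  proof
    have "inverse_word u @ u \<in> lists (X \<times> UNIV)" "[] \<in> lists (X \<times> UNIV)"
      using u(1) inverse_word_lists[OF u(1)] by simp_all
    then show "word_cong X E `` {inverse_word u} \<otimes>\<^bsub>?G\<^esub> A = \<one>\<^bsub>?G\<^esub>"
      unfolding u(2) one mult_presented_group[OF inverse_word_lists[OF u(1)] u(1)]
      using word_class_eq_iff[of _ X "[]" E] inverse_word_cong[OF u(1)] by blast
    show "word_cong X E `` {inverse_word u} \<in> carrier ?G"
      unfolding carrier_presented_group by (rule imageI) (rule inverse_word_lists[OF u(1)])
  qed
  fix B assume "B \<in> carrier ?G"
  then obtain v where v: "v \<in> lists (X \<times> UNIV)" "B = word_cong X E `` {v}"
    by (rule presented_groupE)
  have uv: "u @ v \<in> lists (X \<times> UNIV)" using u(1) v(1) by simp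
  show "A \<otimes>\<^bsub>?G\<^esub> B \<in> carrier ?G"
    unfolding u(2) v(2) mult_presented_group[OF u(1) v(1)] carrier_presented_group
    by (rule imageI) (rule uv)
  fix C assume "C \<in> carrier ?G"
  then obtain w where w: "w \<in> lists (X \<times> UNIV)" "C = word_cong X E `` {w}"
    by (rule presented_groupE)
  have vw: "v @ w \<in> lists (X \<times> UNIV)" using v(1) w(1) by simp
  show "A \<otimes>\<^bsub>?G\<^esub> B \<otimes>\<^bsub>?G\<^esub> C = A \<otimes>\<^bsub>?G\<^esub> (B \<otimes>\<^bsub>?G\<^esub> C)"
    unfolding u(2) v(2) w(2) mult_presented_group[OF u(1) v(1)] mult_presented_group[OF v(1) w(1)]
      mult_presented_group[OF uv w(1)] mult_presented_group[OF u(1) vw]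
    by simp
qed

abbreviation presented_gen :: "'x set \<Rightarrow> ('x word \<times> 'x word) set \<Rightarrow> 'x \<Rightarrow> 'x word set" where
  "presented_gen X E x \<equiv> word_cong X E `` {[(x, True)]}"

lemma presented_gen_closed: "x \<in> X \<Longrightarrow> presented_gen X E x \<in> carrier (presented_group X E)"
  unfolding carrier_presented_group by (rule imageI) simp

lemma presented_group_generate:
  "carrier (presented_group X E) = generate (presented_group X E) (presented_gen X E ` X)"
proof -
  let ?G = "presented_group X E" and ?S = "presented_gen X E ` X"
  interpret group ?G by (rule group_presented_group)
  have S: "?S \<subseteq> carrier ?G" using presented_gen_closed by auto
  have one: "\<one>\<^bsub>?G\<^esub> = word_cong X E `` {[]}" by (simp add: presented_group_def)
  have letter: "word_cong X E `` {[(x, b)]} \<in> generate ?G ?S" if x: "x \<in> X" for x b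
  proof (cases b)
    case True
    then show ?thesis using x by (auto intro: generate.incl)
  next
    case False
    have l: "[(x, False)] \<in> lists (X \<times> UNIV)" "[(x, True)] \<in> lists (X \<times> UNIV)"
        "[(x, False)] @ [(x, True)] \<in> lists (X \<times> UNIV)" "[] \<in> lists (X \<times> UNIV)"
      using x by simp_all
    have "word_cong X E `` {[(x, False)]} \<otimes>\<^bsub>?G\<^esub> presented_gen X E x = \<one>\<^bsub>?G\<^esub>"
      unfolding mult_presented_group[OF l(1,2)] one word_class_eq_iff[OF l(3,4)]
      using word_cong.cancel[OF x, of False E] by simp
    moreover have "word_cong X E `` {[(x, False)]} \<in> carrier ?G"
      unfolding carrier_presented_group by (rule imageI) (rule l(1))
    ultimately have "inv\<^bsub>?G\<^esub> presented_gen X E x = word_cong X E `` {[(x, False)]}"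
      using presented_gen_closed[OF x] by (intro inv_equality) auto
    then show ?thesis using x False generate.inv[of "presented_gen X E x" ?S ?G] by simp
  qed
  have "word_cong X E `` {u} \<in> generate ?G ?S" if "u \<in> lists (X \<times> UNIV)" for u
    using that
  proof (induction u rule: lists.induct)
    case Nil
    then show ?case unfolding one[symmetric] by (rule generate.one)
  next
    case (Cons l u)
    then have "word_cong X E `` {[l]} \<otimes>\<^bsub>?G\<^esub> word_cong X E `` {u} \<in> generate ?G ?S"
      using letter[of "fst l" "snd l"] by (intro generate.eng) auto
    moreover have "[l] \<in> lists (X \<times> UNIV)" using Cons by simp
    ultimately show ?case using Cons.hyps mult_presented_group[of "[l]" X u E] by simp
  qed
  then have "carrier ?G \<subseteq> generate ?G ?S" by (auto elim!: presented_groupE)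
  with generate_incl[OF S] show ?thesis by auto
qed

primrec word_eval :: "('a, 'b) monoid_scheme \<Rightarrow> ('x \<Rightarrow> 'a) \<Rightarrow> 'x word \<Rightarrow> 'a" where
  "word_eval G f [] = \<one>\<^bsub>G\<^esub>"
| "word_eval G f (l # w) =
    (if snd l then f (fst l) else inv\<^bsub>G\<^esub> f (fst l)) \<otimes>\<^bsub>G\<^esub> word_eval G f w"

context group
begin

lemma word_eval_closed:
  "\<lbrakk>f \<in> X \<rightarrow> carrier G; w \<in> lists (X \<times> UNIV)\<rbrakk> \<Longrightarrow> word_eval G f w \<in> carrier G"
  by (induction w) (auto simp: Pi_iff)

lemma word_eval_append:
  assumes f: "f \<in> X \<rightarrow> carrier G" and "u \<in> lists (X \<times> UNIV)" and v: "v \<in> lists (X \<times> UNIV)"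
  shows "word_eval G f (u @ v) = word_eval G f u \<otimes> word_eval G f v"
  using assms(2)
proof (induction u)
  case Nil
  then show ?case using word_eval_closed[OF f v] by simp
next
  case (Cons l u)
  then show ?case
    using word_eval_closed[OF f v] word_eval_closed[OF f, of u] f by (auto simp: m_assoc Pi_iff)
qed

lemma word_eval_cong:
  assumes f: "f \<in> X \<rightarrow> carrier G" and E: "\<And>u v. (u, v) \<in> E \<Longrightarrow> word_eval G f u = word_eval G f v"
    and "(u, v) \<in> word_cong X E"
  shows "word_eval G f u = word_eval G f v"
  using assms(3)
proof (induction rule: word_cong.induct)
  case (append u u' v v')
  then show ?case by (metis word_eval_append[OF f] word_cong_lists)
next
  case (cancel x b)
  then show ?case using f by (auto simp: Pi_iff)
qed (auto simp: E)

text \<open>Von Dyck's theorem: evaluation respects \<open>word_cong\<close> once it respects the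
  relations, so any representative of a class may be evaluated. Every homomorphism out of RC_K below
  arises this way.\<close>

lemma presented_group_hom:
  assumes f: "f \<in> X \<rightarrow> carrier G" and E: "\<And>u v. (u, v) \<in> E \<Longrightarrow> word_eval G f u = word_eval G f v"
  obtains h where "h \<in> hom (presented_group X E) G" "\<And>x. x \<in> X \<Longrightarrow> h (presented_gen X E x) = f x"
proof
  let ?h = "\<lambda>A. word_eval G f (SOME u. u \<in> A)"
  have h: "?h (word_cong X E `` {u}) = word_eval G f u" if "u \<in> lists (X \<times> UNIV)" for u
  proof -
    have "(u, u) \<in> word_cong X E" using that by (rule word_cong.refl)
    then have "(SOME v. v \<in> word_cong X E `` {u}) \<in> word_cong X E `` {u}"
      by (intro someI[of "\<lambda>v. v \<in> word_cong X E `` {u}"]) auto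
    then show ?thesis using word_eval_cong[OF f E] by (metis Image_singleton_iff)
  qed
  show "?h \<in> hom (presented_group X E) G"
  proof (rule homI)
    fix A assume "A \<in> carrier (presented_group X E)"
    then obtain u where u: "u \<in> lists (X \<times> UNIV)" "A = word_cong X E `` {u}"
      by (rule presented_groupE)
    show "?h A \<in> carrier G"
      unfolding u(2) h[OF u(1)] by (rule word_eval_closed[OF f u(1)])
    fix B assume "B \<in> carrier (presented_group X E)"
    then obtain v where v: "v \<in> lists (X \<times> UNIV)" "B = word_cong X E `` {v}"
      by (rule presented_groupE)
    have "u @ v \<in> lists (X \<times> UNIV)" using u v by simp
    then show "?h (A \<otimes>\<^bsub>presented_group X E\<^esub> B) = ?h A \<otimes> ?h B"
      unfolding u(2) v(2) mult_presented_group[OF u(1) v(1)] h[OF u(1)] h[OF v(1)]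
      by (simp only: h word_eval_append[OF f u(1) v(1)])
  qed
  show "?h (presented_gen X E x) = f x" if "x \<in> X" for x
    using h[of "[(x, True)]"] that f by (auto simp: Pi_iff)
qed

end

section \<open>The lower central series\<close>

context group
begin

abbreviation commutator :: "'a \<Rightarrow> 'a \<Rightarrow> 'a" where
  "commutator a b \<equiv> a \<otimes> b \<otimes> inv a \<otimes> inv b"

lemma inv_mult_cancel [simp]:
  assumes "a \<in> carrier G" "b \<in> carrier G"
  shows "inv a \<otimes> (a \<otimes> b) = b" and "a \<otimes> (inv a \<otimes> b) = b"
  using assms by (simp_all add: m_assoc[symmetric])

lemmas group_word_simps = m_assoc inv_mult_group

lemma normal_commutator_closed:
  assumes "N \<lhd> G" "x \<in> N" "y \<in> carrier G"
  shows "commutator x y \<in> N" and "commutator y x \<in> N"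
proof -
  interpret N: normal N G by fact
  have x: "x \<in> carrier G" using assms N.subset by auto
  have "x \<otimes> (y \<otimes> inv x \<otimes> inv y) \<in> N" "(y \<otimes> x \<otimes> inv y) \<otimes> inv x \<in> N"
    using assms N.inv_op_closed2 by auto
  then show "commutator x y \<in> N" "commutator y x \<in> N"
    using x assms(3) by (simp_all add: m_assoc)
qed

lemma commutator_swap_mem:
  assumes "subgroup N G" "x \<in> carrier G" "y \<in> carrier G" "commutator x y \<in> N"
  shows "commutator y x \<in> N"
proof -
  have "commutator y x = inv (commutator x y)"
    using assms(2,3) by (simp add: group_word_simps)
  then show ?thesis using subgroup.m_inv_closed[OF assms(1,4)] by simp
qed

text \<open>The preimage of the centralizer of the coset of x in G/N, kept inside G. Closure rests
  on (x, yz) = (x, y) y(x, z)y^-1 and on (x, y^-1) being a conjugate of (x, y)^-1.\<close>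

lemma subgroup_centralizer_mod:
  assumes "N \<lhd> G" "x \<in> carrier G"
  shows "subgroup {y \<in> carrier G. commutator x y \<in> N} G"
proof -
  interpret N: normal N G by fact
  show ?thesis
  proof (rule subgroupI)
    show "{y \<in> carrier G. commutator x y \<in> N} \<noteq> {}"
      using assms(2) N.one_closed by (auto intro!: exI[of _ \<one>])
  next
    fix y assume "y \<in> {y \<in> carrier G. commutator x y \<in> N}"
    then have y: "y \<in> carrier G" "commutator x y \<in> N" by auto
    have "inv y \<otimes> inv (commutator x y) \<otimes> y = commutator x (inv y)"
      using y assms(2) by (simp add: group_word_simps)
    moreover have "inv y \<otimes> inv (commutator x y) \<otimes> y \<in> N"
      using y N.inv_op_closed1[of y "inv (commutator x y)"] by simp
    ultimately show "inv y \<in> {y \<in> carrier G. commutator x y \<in> N}" using y by simp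
  next
    fix y z assume "y \<in> {y \<in> carrier G. commutator x y \<in> N}" "z \<in> {y \<in> carrier G. commutator x y \<in> N}"
    then have yz: "y \<in> carrier G" "commutator x y \<in> N" "z \<in> carrier G" "commutator x z \<in> N" by auto
    have "commutator x y \<otimes> (y \<otimes> commutator x z \<otimes> inv y) = commutator x (y \<otimes> z)"
      using yz assms(2) by (simp add: group_word_simps)
    moreover have "commutator x y \<otimes> (y \<otimes> commutator x z \<otimes> inv y) \<in> N"
      using yz N.inv_op_closed2[of y "commutator x z"] by simp
    ultimately show "y \<otimes> z \<in> {y \<in> carrier G. commutator x y \<in> N}" using yz by simp
  qed auto
qed

lemma centralizer_mod_generators:
  assumes "N \<lhd> G" "x \<in> carrier G" "carrier G = generate G S"
    and "\<And>s. s \<in> S \<Longrightarrow> commutator x s \<in> N" and y: "y \<in> carrier G"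
  shows "commutator x y \<in> N"
proof -
  have "S \<subseteq> carrier G" using assms(3) generate.incl[of _ S G] by auto
  then have "generate G S \<subseteq> {y \<in> carrier G. commutator x y \<in> N}"
    using assms(4) by (intro generate_subgroup_incl subgroup_centralizer_mod assms(1,2)) auto
  then show ?thesis using y assms(3) by auto
qed

lemma commutators_mod_generators:
  assumes N: "N \<lhd> G" and S: "carrier G = generate G S"
    and comm: "\<And>s t. \<lbrakk>s \<in> S; t \<in> S\<rbrakk> \<Longrightarrow> commutator s t \<in> N"
    and x: "x \<in> carrier G" and y: "y \<in> carrier G"
  shows "commutator x y \<in> N"
proof (rule centralizer_mod_generators[OF N x S _ y])
  fix s assume s: "s \<in> S"
  then have sc: "s \<in> carrier G" using S generate.incl[of s S G] by auto
  then have "commutator s x \<in> N"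
    by (rule centralizer_mod_generators[OF N _ S comm[OF s] x])
  then show "commutator x s \<in> N"
    by (rule commutator_swap_mem[OF normal_imp_subgroup[OF N] sc x])
qed

text \<open>The preimage of the center of G/N. Its normality allows it to play the role of N itself,
  which gives the step from double to triple commutators.\<close>

lemma normal_center_mod:
  assumes "N \<lhd> G"
  shows "{z \<in> carrier G. \<forall>y \<in> carrier G. commutator z y \<in> N} \<lhd> G"
proof -
  interpret N: normal N G by fact
  let ?Z = "{z \<in> carrier G. \<forall>y \<in> carrier G. commutator z y \<in> N}"
  have "subgroup ?Z G"
  proof (rule subgroupI)
    show "?Z \<noteq> {}" using N.one_closed by (auto intro!: exI[of _ \<one>])
  next
    fix z assume "z \<in> ?Z"
    then have z: "z \<in> carrier G" "\<And>y. y \<in> carrier G \<Longrightarrow> commutator z y \<in> N" by auto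
    have "commutator (inv z) y \<in> N" if y: "y \<in> carrier G" for y
    proof -
      have "inv z \<otimes> inv (commutator z y) \<otimes> z = commutator (inv z) y"
        using y z(1) by (simp add: group_word_simps)
      then show ?thesis
        using z y N.inv_op_closed1[of z "inv (commutator z y)"] by simp
    qed
    then show "inv z \<in> ?Z" using z by auto
  next
    fix z w assume "z \<in> ?Z" "w \<in> ?Z"
    then have zw: "z \<in> carrier G" "\<And>y. y \<in> carrier G \<Longrightarrow> commutator z y \<in> N"
      "w \<in> carrier G" "\<And>y. y \<in> carrier G \<Longrightarrow> commutator w y \<in> N" by auto
    have "commutator (z \<otimes> w) y \<in> N" if y: "y \<in> carrier G" for y
    proof -
      have "(z \<otimes> commutator w y \<otimes> inv z) \<otimes> commutator z y = commutator (z \<otimes> w) y"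
        using y zw(1,3) by (simp add: group_word_simps)
      then show ?thesis
        using zw y N.inv_op_closed2[of z "commutator w y"] N.m_closed by metis
    qed
    then show "z \<otimes> w \<in> ?Z" using zw by auto
  qed auto
  then show ?thesis
  proof (rule normal_invI)
    fix g z assume g: "g \<in> carrier G" and "z \<in> ?Z"
    then have z: "z \<in> carrier G" "\<And>y. y \<in> carrier G \<Longrightarrow> commutator z y \<in> N" by auto
    have "commutator (g \<otimes> z \<otimes> inv g) y \<in> N" if y: "y \<in> carrier G" for y
    proof -
      have "g \<otimes> commutator z (inv g \<otimes> y \<otimes> g) \<otimes> inv g = commutator (g \<otimes> z \<otimes> inv g) y"
        using y z(1) g by (simp add: group_word_simps)
      then show ?thesis
        using g y z(2)[of "inv g \<otimes> y \<otimes> g"] N.inv_op_closed2[of g] by (metis inv_closed m_closed)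
    qed
    then show "g \<otimes> z \<otimes> inv g \<in> ?Z" using z g by auto
  qed
qed


lemma normal_carrier: "carrier G \<lhd> G"
  by (rule normal_invI[OF subgroup_self]) auto

lemma commutator_subgroup_normal:
  assumes "A \<lhd> G" "B \<lhd> G"
  shows "commutator_subgroup G A B \<lhd> G"
proof -
  interpret A: normal A G by fact
  interpret B: normal B G by fact
  let ?X = "\<Union>a\<in>A. \<Union>b\<in>B. {commutator a b}"
  have "generate G ?X \<lhd> G"
  proof (rule normal_generateI)
    show "?X \<subseteq> carrier G" using A.subset B.subset by auto
    fix h g assume "h \<in> ?X" and g: "g \<in> carrier G"
    then obtain a b where ab: "a \<in> A" "b \<in> B" "h = commutator a b" by auto
    have "g \<otimes> h \<otimes> inv g = commutator (g \<otimes> a \<otimes> inv g) (g \<otimes> b \<otimes> inv g)"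
      using ab g A.mem_carrier[OF ab(1)] B.mem_carrier[OF ab(2)] by (simp add: group_word_simps)
    then show "g \<otimes> h \<otimes> inv g \<in> ?X"
      using A.inv_op_closed2[OF g ab(1)] B.inv_op_closed2[OF g ab(2)] by blast
  qed
  then show ?thesis by (simp only: commutator_subgroup_def)
qed

lemma lower_central_Suc_normal: "lower_central G (Suc k) \<lhd> G"
  by (induction k) (simp_all add: normal_carrier commutator_subgroup_normal)

lemma lower_central_carrier: "x \<in> lower_central G (Suc k) \<Longrightarrow> x \<in> carrier G"
  using subgroup.subset[OF normal_imp_subgroup[OF lower_central_Suc_normal]] by blast

lemma commutator_in_lower_central:
  assumes "x \<in> lower_central G (Suc k)" "y \<in> carrier G"
  shows "commutator x y \<in> lower_central G (Suc (Suc k))"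
  using assms by (auto simp: commutator_subgroup_def intro!: generate.incl)

lemma lower_central_Suc_least:
  assumes "subgroup W G"
    and "\<And>x y. \<lbrakk>x \<in> lower_central G (Suc k); y \<in> carrier G\<rbrakk> \<Longrightarrow> commutator x y \<in> W"
  shows "lower_central G (Suc (Suc k)) \<subseteq> W"
  unfolding lower_central.simps commutator_subgroup_def
  by (rule generate_subgroup_incl[OF _ assms(1)]) (use assms(2) in auto)

lemma lower_central_Suc_subset: "lower_central G (Suc (Suc k)) \<subseteq> lower_central G (Suc k)"
  by (rule lower_central_Suc_least[OF normal_imp_subgroup[OF lower_central_Suc_normal]])
    (rule normal_commutator_closed[OF lower_central_Suc_normal])

text \<open>Each term is central modulo the next: g w g^-1 = (g, w) w, and (g, w) already lies in
  W.\<close>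

lemma normal_between_lower_central:
  assumes W: "subgroup W G" and "lower_central G (Suc (Suc k)) \<subseteq> W" "W \<subseteq> lower_central G (Suc k)"
  shows "W \<lhd> G"
proof (rule normal_invI[OF W])
  fix g w assume g: "g \<in> carrier G" and w: "w \<in> W"
  have wc: "w \<in> carrier G" using subgroup.mem_carrier[OF W w] .
  have "commutator w g \<in> W" using assms w g commutator_in_lower_central by blast
  then have "commutator g w \<in> W" by (rule commutator_swap_mem[OF W wc g])
  then have "commutator g w \<otimes> w \<in> W" using subgroup.m_closed[OF W _ w] by blast
  then show "g \<otimes> w \<otimes> inv g \<in> W" using g wc by (simp add: group_word_simps)
qed

text \<open>Any central filtration S of H bounds the image of the lower central series. The
  detecting groups can thus be treated through explicit chains instead of a computation of their own
  series.\<close>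

lemma hom_lower_central:
  assumes "group H" and h: "h \<in> hom G H" and S1: "carrier H \<subseteq> S (Suc 0)"
    and sub: "\<And>k. subgroup (S (Suc k)) H"
    and step: "\<And>k x y. \<lbrakk>x \<in> S (Suc k); y \<in> carrier H\<rbrakk> \<Longrightarrow>
      x \<otimes>\<^bsub>H\<^esub> y \<otimes>\<^bsub>H\<^esub> inv\<^bsub>H\<^esub> x \<otimes>\<^bsub>H\<^esub> inv\<^bsub>H\<^esub> y \<in> S (Suc (Suc k))"
  shows "x \<in> lower_central G (Suc k) \<Longrightarrow> h x \<in> S (Suc k)"
proof (induction k arbitrary: x)
  case 0
  then show ?case using h S1 by (auto simp: hom_def Pi_iff)
next
  case (Suc k)
  interpret gh: group_hom G H h
    using h assms(1) by (simp add: group_hom_def group_hom_axioms_def is_group)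
  have "lower_central G (Suc (Suc k)) \<subseteq> {x \<in> carrier G. h x \<in> S (Suc (Suc k))}"
  proof (rule lower_central_Suc_least)
    show "subgroup {x \<in> carrier G. h x \<in> S (Suc (Suc k))} G"
      using subgroup.m_closed[OF sub] subgroup.m_inv_closed[OF sub] subgroup.one_closed[OF sub]
      by (intro subgroupI) (auto intro!: exI[of _ \<one>])
    fix x y assume xy: "x \<in> lower_central G (Suc k)" "y \<in> carrier G"
    then have "x \<in> carrier G" by (rule_tac lower_central_carrier)
    then show "commutator x y \<in> {x \<in> carrier G. h x \<in> S (Suc (Suc k))}"
      using step[OF Suc.IH[OF xy(1)], of "h y"] xy(2) by simp
  qed
  then show ?case using Suc.prems by blast
qed

lemma lower_central_2_least:
  assumes W: "W \<lhd> G" and S: "carrier G = generate G S"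
    and comm: "\<And>s t. \<lbrakk>s \<in> S; t \<in> S\<rbrakk> \<Longrightarrow> commutator s t \<in> W"
  shows "lower_central G 2 \<subseteq> W"
proof -
  have "lower_central G (Suc (Suc 0)) \<subseteq> W"
    by (rule lower_central_Suc_least[OF normal_imp_subgroup[OF W]])
      (simp add: commutators_mod_generators[OF W S comm])
  then show ?thesis by (simp add: numeral_2_eq_2)
qed

text \<open>The hypothesis puts all (s, t) into the preimage of the center of G/W. By the degree 2
  case this preimage contains \<gamma>_2, which says exactly that \<gamma>_3 lies in W.\<close>

lemma lower_central_3_least:
  assumes W: "W \<lhd> G" and S: "carrier G = generate G S"
    and comm: "\<And>s t u. \<lbrakk>s \<in> S; t \<in> S; u \<in> S\<rbrakk> \<Longrightarrow> commutator (commutator s t) u \<in> W"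
  shows "lower_central G 3 \<subseteq> W"
proof -
  let ?Z = "{z \<in> carrier G. \<forall>y \<in> carrier G. commutator z y \<in> W}"
  have Sc: "s \<in> carrier G" if "s \<in> S" for s using S generate.incl[OF that, of G] by simp
  have "commutator s t \<in> ?Z" if st: "s \<in> S" "t \<in> S" for s t
    using centralizer_mod_generators[OF W _ S comm[OF st]] Sc st by simp
  then have "lower_central G 2 \<subseteq> ?Z"
    by (rule lower_central_2_least[OF normal_center_mod[OF W] S])
  then have "lower_central G (Suc (Suc (Suc 0))) \<subseteq> W"
    by (intro lower_central_Suc_least normal_imp_subgroup[OF W]) (auto simp: numeral_2_eq_2)
  then show ?thesis by (simp add: numeral_3_eq_3)
qed

text \<open>For an involution g one has ((c, g), g) = (c, g)^2, so the square drops one step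
  further. Taking c to be a generator or a commutator of generators makes the squares of the basis
  elements vanish in degrees 2 and 3.\<close>

lemma square_commutator_involution:
  assumes "c \<in> lower_central G (Suc k)" "g \<in> carrier G" "g \<otimes> g = \<one>"
  shows "commutator c g \<otimes> commutator c g \<in> lower_central G (Suc (Suc (Suc k)))"
proof -
  have c: "c \<in> carrier G" by (rule lower_central_carrier[OF assms(1)])
  have g: "inv g = g" using assms(2,3) by (intro inv_equality)
  have "g \<otimes> (g \<otimes> w) = w" if "w \<in> carrier G" for w
    using inv_mult_cancel(1)[OF assms(2) that] by (simp only: g)
  then have "commutator (commutator c g) g = commutator c g \<otimes> commutator c g"
    using c assms(2) g by (simp add: group_word_simps)
  then show ?thesis
    using commutator_in_lower_central[OF commutator_in_lower_central[OF assms(1,2)] assms(2)] by simp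
qed

text \<open>The Hall-Witt identity, free of inner inverses because x, y, z are involutions. It holds
  exactly in G: the third triple commutator is a product of conjugates of the inverses of the other
  two, hence lies in every normal subgroup containing those.\<close>

lemma hall_witt_involutions:
  assumes W: "W \<lhd> G" and x: "x \<in> carrier G" "x \<otimes> x = \<one>" and y: "y \<in> carrier G" "y \<otimes> y = \<one>"
    and z: "z \<in> carrier G" "z \<otimes> z = \<one>"
    and xyz: "commutator (commutator x y) z \<in> W" and yzx: "commutator (commutator y z) x \<in> W"
  shows "commutator (commutator z x) y \<in> W"
proof -
  interpret W: normal W G by fact
  have i: "inv x = x" "inv y = y" "inv z = z" using x y z by (auto intro: inv_equality)
  have cancel: "x \<otimes> (x \<otimes> w) = w" "y \<otimes> (y \<otimes> w) = w" "z \<otimes> (z \<otimes> w) = w" if "w \<in> carrier G" for w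
    using that x y z by (simp_all add: m_assoc[symmetric])
  let ?A = "x \<otimes> inv (commutator (commutator x y) z) \<otimes> inv x"
  let ?B = "y \<otimes> inv (commutator (commutator y z) x) \<otimes> inv y"
  have "z \<otimes> (?A \<otimes> ?B) \<otimes> inv z \<in> W"
    by (rule W.inv_op_closed2[OF z(1) W.m_closed[OF
          W.inv_op_closed2[OF x(1) W.m_inv_closed[OF xyz]]
          W.inv_op_closed2[OF y(1) W.m_inv_closed[OF yzx]]]])
  moreover have "z \<otimes> (?A \<otimes> ?B) \<otimes> inv z = commutator (commutator z x) y"
    using x y z i cancel by (simp add: group_word_simps)
  ultimately show ?thesis by simp
qed

lemma lower_central_restrict:
  shows "group (G\<lparr>carrier := lower_central G (Suc k)\<rparr>)"
    and "lower_central G (Suc (Suc k)) \<lhd> G\<lparr>carrier := lower_central G (Suc k)\<rparr>"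
proof -
  have sub: "subgroup (lower_central G (Suc k)) G"
    by (rule normal_imp_subgroup[OF lower_central_Suc_normal])
  then show "group (G\<lparr>carrier := lower_central G (Suc k)\<rparr>)" by (rule subgroup_imp_group)
  show "lower_central G (Suc (Suc k)) \<lhd> G\<lparr>carrier := lower_central G (Suc k)\<rparr>"
    by (rule normal_restrict_supergroup[OF sub lower_central_Suc_normal lower_central_Suc_subset])
qed

lemma carrier_lower_central_quotient:
  "carrier (lower_central_quotient G (Suc k)) =
     (\<lambda>x. lower_central G (Suc (Suc k)) #> x) ` lower_central G (Suc k)"
  by (auto simp: lower_central_quotient_def FactGroup_def RCOSETS_def r_coset_def simp del: lower_central.simps)

lemma mult_lower_central_quotient:
  assumes "x \<in> lower_central G (Suc k)" "y \<in> lower_central G (Suc k)"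
  shows "(lower_central G (Suc (Suc k)) #> x) \<otimes>\<^bsub>lower_central_quotient G (Suc k)\<^esub>
      (lower_central G (Suc (Suc k)) #> y) = lower_central G (Suc (Suc k)) #> (x \<otimes> y)"
  using normal.rcos_sum[OF lower_central_Suc_normal, of x y "Suc k"] lower_central_carrier assms
  by (auto simp: lower_central_quotient_def FactGroup_def set_mult_def simp del: lower_central.simps)

lemma one_lower_central_quotient:
  "\<one>\<^bsub>lower_central_quotient G k\<^esub> = lower_central G (Suc k)"
  by (simp add: lower_central_quotient_def FactGroup_def)

lemma comm_group_lower_central_quotient: "comm_group (lower_central_quotient G (Suc k))"
proof -
  let ?Q = "lower_central_quotient G (Suc k)" and ?N = "lower_central G (Suc (Suc k))"
  have "group ?Q"
    unfolding lower_central_quotient_def by (rule normal.factorgroup_is_group[OF lower_central_restrict(2)])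
  then show ?thesis
  proof (rule group.group_comm_groupI)
    fix A B assume "A \<in> carrier ?Q" "B \<in> carrier ?Q"
    then obtain x y where x: "x \<in> lower_central G (Suc k)" "A = ?N #> x"
      and y: "y \<in> lower_central G (Suc k)" "B = ?N #> y"
      unfolding carrier_lower_central_quotient by auto
    have xy: "x \<in> carrier G" "y \<in> carrier G" using x y by (auto intro: lower_central_carrier)
    have N: "subgroup ?N G" by (rule normal_imp_subgroup[OF lower_central_Suc_normal])
    have c: "commutator x y \<in> ?N" by (rule commutator_in_lower_central[OF x(1) xy(2)])
    then have "?N #> (x \<otimes> y) = ?N #> (commutator x y \<otimes> (y \<otimes> x))"
      using xy by (simp add: group_word_simps)
    also have "\<dots> = ?N #> commutator x y #> (y \<otimes> x)"
      using xy subgroup.subset[OF N] by (intro coset_mult_assoc[symmetric]) auto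
    also have "\<dots> = ?N #> (y \<otimes> x)"
      using c N xy by (simp only: coset_join2 m_closed inv_closed)
    finally show "A \<otimes>\<^bsub>?Q\<^esub> B = B \<otimes>\<^bsub>?Q\<^esub> A"
      unfolding x(2) y(2) mult_lower_central_quotient[OF x(1) y(1)] mult_lower_central_quotient[OF y(1) x(1)] .
  qed
qed

text \<open>Lifts the dual family criterion from cosets to elements of G. The subgroups W in
  \<open>gen\<close> stand for the subgroups of the quotient. Squares are tested on the
  \<open>b p\<close> only: the quotient is abelian, so its elements of trivial square form a
  subgroup.\<close>

lemma dim_lower_central_quotient:
  fixes b :: "'p \<Rightarrow> 'a" and f :: "'p \<Rightarrow> 'a \<Rightarrow> bit"
  assumes fin: "finite P" and b: "b ` P \<subseteq> lower_central G (Suc k)"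
    and gen: "\<And>W. \<lbrakk>subgroup W G; lower_central G (Suc (Suc k)) \<subseteq> W; W \<subseteq> lower_central G (Suc k); b ` P \<subseteq> W\<rbrakk>
      \<Longrightarrow> lower_central G (Suc k) \<subseteq> W"
    and sq: "\<And>p. p \<in> P \<Longrightarrow> b p \<otimes> b p \<in> lower_central G (Suc (Suc k))"
    and f_mult: "\<And>p x y. \<lbrakk>p \<in> P; x \<in> lower_central G (Suc k); y \<in> lower_central G (Suc k)\<rbrakk>
      \<Longrightarrow> f p (x \<otimes> y) = f p x + f p y"
    and f_zero: "\<And>p x. \<lbrakk>p \<in> P; x \<in> lower_central G (Suc (Suc k))\<rbrakk> \<Longrightarrow> f p x = 0"
    and dual: "\<And>p q. \<lbrakk>p \<in> P; q \<in> P\<rbrakk> \<Longrightarrow> f p (b q) = (if p = q then 1 else 0)"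
  shows "vectorspace.dim Z2 (Z2_space (lower_central_quotient G (Suc k))) = card P"
proof -
  let ?Q = "lower_central_quotient G (Suc k)" and ?L = "lower_central G (Suc k)"
    and ?N = "lower_central G (Suc (Suc k))"
  interpret Q: comm_group ?Q by (rule comm_group_lower_central_quotient)
  have L: "subgroup ?L G" and N: "subgroup ?N G"
    by (simp_all only: normal_imp_subgroup[OF lower_central_Suc_normal])
  have NL: "?N \<subseteq> ?L" by (rule lower_central_Suc_subset)
  let ?pi = "\<lambda>x. ?N #> x"
  have pi_mult: "?pi x \<otimes>\<^bsub>?Q\<^esub> ?pi y = ?pi (x \<otimes> y)" if "x \<in> ?L" "y \<in> ?L" for x y
    by (rule mult_lower_central_quotient[OF that])
  have pi_one: "?pi x = \<one>\<^bsub>?Q\<^esub>" if "x \<in> ?N" for x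
    unfolding one_lower_central_quotient using coset_join2[OF subgroup.mem_carrier[OF N that] N that] .
  have pi_closed: "?pi x \<in> carrier ?Q" if "x \<in> ?L" for x
    unfolding carrier_lower_central_quotient using that by (rule imageI)
  have pi_hom: "?pi \<in> hom (G\<lparr>carrier := ?L\<rparr>) ?Q"
    by (rule homI) (use pi_closed pi_mult in simp_all)
  interpret pi: group_hom "G\<lparr>carrier := ?L\<rparr>" ?Q ?pi
    using pi_hom lower_central_restrict(1) by (simp add: group_hom_def group_hom_axioms_def)
  have pi_inv: "?pi (inv x) = inv\<^bsub>?Q\<^esub> ?pi x" if "x \<in> ?L" for x
    using pi.hom_inv[of x] that m_inv_consistent[OF L that] by simp
  \<comment> \<open>Prepares two uses of \<open>gen\<close>: with R saying that the square is
    trivial, and with R saying membership in a given additively closed set S.\<close>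
  have sub: "subgroup {x \<in> ?L. ?pi x \<in> carrier ?Q \<and> R (?pi x)} G"
    if "R \<one>\<^bsub>?Q\<^esub>" "\<And>A B. \<lbrakk>A \<in> carrier ?Q; B \<in> carrier ?Q; R A; R B\<rbrakk> \<Longrightarrow> R (A \<otimes>\<^bsub>?Q\<^esub> B)"
      "\<And>A. \<lbrakk>A \<in> carrier ?Q; R A\<rbrakk> \<Longrightarrow> R (inv\<^bsub>?Q\<^esub> A)" for R
  proof (rule subgroupI)
    show "{x \<in> ?L. ?pi x \<in> carrier ?Q \<and> R (?pi x)} \<subseteq> carrier G" using lower_central_carrier by auto
    show "{x \<in> ?L. ?pi x \<in> carrier ?Q \<and> R (?pi x)} \<noteq> {}"
      using that(1) subgroup.one_closed[OF L] pi_one[OF subgroup.one_closed[OF N]] Q.one_closed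
      by (auto intro!: exI[of _ \<one>] simp del: lower_central.simps)
  next
    fix x assume "x \<in> {x \<in> ?L. ?pi x \<in> carrier ?Q \<and> R (?pi x)}"
    then have x: "x \<in> ?L" "?pi x \<in> carrier ?Q" "R (?pi x)" by auto
    then show "inv x \<in> {x \<in> ?L. ?pi x \<in> carrier ?Q \<and> R (?pi x)}"
      unfolding mem_Collect_eq pi_inv[OF x(1)] using that(3) subgroup.m_inv_closed[OF L] by simp
  next
    fix x y assume "x \<in> {x \<in> ?L. ?pi x \<in> carrier ?Q \<and> R (?pi x)}"
      "y \<in> {x \<in> ?L. ?pi x \<in> carrier ?Q \<and> R (?pi x)}"
    then have xy: "x \<in> ?L" "?pi x \<in> carrier ?Q" "R (?pi x)" "y \<in> ?L" "?pi y \<in> carrier ?Q" "R (?pi y)" by auto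
    then show "x \<otimes> y \<in> {x \<in> ?L. ?pi x \<in> carrier ?Q \<and> R (?pi x)}"
      unfolding mem_Collect_eq pi_mult[OF xy(1,4), symmetric]
      using that(2) subgroup.m_closed[OF L] by simp
  qed
  have Q_sq: "A \<otimes>\<^bsub>?Q\<^esub> A = \<one>\<^bsub>?Q\<^esub>" if "A \<in> carrier ?Q" for A
  proof -
    let ?W = "{x \<in> ?L. ?pi x \<in> carrier ?Q \<and> ?pi x \<otimes>\<^bsub>?Q\<^esub> ?pi x = \<one>\<^bsub>?Q\<^esub>}"
    have "?L \<subseteq> ?W"
    proof (rule gen)
      show "subgroup ?W G"
        by (rule sub) (simp_all add: Q.m_ac Q.inv_mult[symmetric])
      show "?N \<subseteq> ?W" using NL pi_one by auto
      show "b ` P \<subseteq> ?W" using b sq pi_one pi_mult pi_closed by auto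
    qed auto
    then show ?thesis using that unfolding carrier_lower_central_quotient by auto
  qed
  \<comment> \<open>The chosen representative does not matter: two of them differ by an element of
    the next term, where \<open>f p\<close> vanishes.\<close>
  define F where "F p A = f p (SOME x. x \<in> A)" for p A
  have F: "F p (?pi x) = f p x" if "p \<in> P" "x \<in> ?L" for p x
  proof -
    have "x \<in> ?pi x" using rcos_self[OF lower_central_carrier[OF that(2)] N] .
    then have "(SOME y. y \<in> ?pi x) \<in> ?pi x" by (rule someI)
    then obtain n where n: "n \<in> ?N" "(SOME y. y \<in> ?pi x) = n \<otimes> x" by (auto simp: r_coset_def)
    show ?thesis unfolding F_def n(2)
      using f_mult[OF that(1) subsetD[OF NL n(1)] that(2)] f_zero[OF that(1) n(1)] by simp
  qed
  show ?thesis
  proof (rule dim_eq_card_of_dual_family[where b = "\<lambda>p. ?pi (b p)" and f = F])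
    show "vectorspace Z2 (Z2_space ?Q)"
      by (rule vectorspace_Z2_space[OF comm_group_lower_central_quotient Q_sq])
    show "?pi (b p) \<in> carrier (Z2_space ?Q)" if "p \<in> P" for p
      using that b pi_closed by (auto simp: Z2_space_def)
    show "F p (A \<oplus>\<^bsub>Z2_space ?Q\<^esub> B) = F p A + F p B"
      if p: "p \<in> P" and "A \<in> carrier (Z2_space ?Q)" "B \<in> carrier (Z2_space ?Q)" for p A B
    proof -
      from that obtain x y where x: "x \<in> ?L" "A = ?pi x" and y: "y \<in> ?L" "B = ?pi y"
        by (auto simp: Z2_space_def carrier_lower_central_quotient)
      have xy: "x \<otimes> y \<in> ?L" by (rule subgroup.m_closed[OF L x(1) y(1)])
      show ?thesis
        using F[OF p x(1)] F[OF p y(1)] F[OF p xy] f_mult[OF p x(1) y(1)] pi_mult[OF x(1) y(1)] x y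
        by (simp add: Z2_space_def)
    qed
    show "F p (?pi (b q)) = (if p = q then 1 else 0)" if "p \<in> P" "q \<in> P" for p q
      using F[OF that(1), of "b q"] dual that b by auto
    fix S assume S: "\<zero>\<^bsub>Z2_space ?Q\<^esub> \<in> S" "\<And>A B. \<lbrakk>A \<in> S; B \<in> S\<rbrakk> \<Longrightarrow> A \<oplus>\<^bsub>Z2_space ?Q\<^esub> B \<in> S"
      "(\<lambda>p. ?pi (b p)) ` P \<subseteq> S"
    let ?W = "{x \<in> ?L. ?pi x \<in> carrier ?Q \<and> ?pi x \<in> S}"
    have "?L \<subseteq> ?W"
    proof (rule gen)
      show "subgroup ?W G"
      proof (rule sub)
        fix A assume A: "A \<in> carrier ?Q" "A \<in> S"
        then have "inv\<^bsub>?Q\<^esub> A = A" using Q_sq by (intro Q.inv_equality) auto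
        then show "inv\<^bsub>?Q\<^esub> A \<in> S" using A by simp
      qed (use S in \<open>simp_all add: Z2_space_def\<close>)
      show "?N \<subseteq> ?W" using NL pi_one S(1) by (auto simp: Z2_space_def)
      show "b ` P \<subseteq> ?W" using b S(3) pi_closed by auto
    qed auto
    then show "carrier (Z2_space ?Q) \<subseteq> S"
      by (auto simp: Z2_space_def carrier_lower_central_quotient)
  qed (rule fin)
qed

end

section \<open>Right-angled Coxeter groups\<close>

definition non_edges :: "nat \<Rightarrow> nat set set \<Rightarrow> (nat \<times> nat) set" where
  "non_edges m K = {(z, y). z \<in> {1..m} \<and> y \<in> {1..m} \<and> z < y \<and> {z, y} \<notin> K}"

text \<open>The triple \<open>(x, y, z)\<close> stands for the pair \<open>(J, j) = ({x, y, z}, z)\<close> with \<open>|J| = 3\<close>,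
  \<open>max J = y\<close> and \<open>j \<in> \<Theta>\<^sub>K(J)\<close>; its generator of \<open>N\<^sub>K\<close> is \<open>[\<mu>\<^sub>x, [\<mu>\<^sub>y, \<mu>\<^sub>z]]\<close>.\<close>

definition theta_triples :: "nat \<Rightarrow> nat set set \<Rightarrow> (nat \<times> nat \<times> nat) set" where
  "theta_triples m K = {(x, y, z). x \<in> {1..m} \<and> y \<in> {1..m} \<and> z \<in> {1..m} \<and>
     x < y \<and> z < y \<and> x \<noteq> z \<and> {z, y} \<notin> K \<and>
     (z < x \<longrightarrow> \<not> ({x, z} \<in> K \<and> {x, y} \<in> K)) \<and> (x < z \<longrightarrow> {x, z} \<notin> K)}"

lemma edge_or_non_edges:
  assumes "i \<in> {1..m}" "j \<in> {1..m}"
  obtains "i = j \<or> {i, j} \<in> K" | "(i, j) \<in> non_edges m K" | "(j, i) \<in> non_edges m K"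
  using assms by (cases i j rule: linorder_cases) (auto simp: non_edges_def insert_commute)

lemma finite_non_edges: "finite (non_edges m K)"
  by (rule finite_subset[of _ "{1..m} \<times> {1..m}"]) (auto simp: non_edges_def)

lemma finite_theta_triples: "finite (theta_triples m K)"
  by (rule finite_subset[of _ "{1..m} \<times> {1..m} \<times> {1..m}"]) (auto simp: theta_triples_def)

text \<open>A word \<open>pqr\<close> in which \<open>{p, q}\<close> and \<open>{q, r}\<close> are non-edges and which occurs in the expansion of
  \<open>[x, [y, z]]\<close>, but in none of the brackets of the other triples.\<close>

definition theta_word :: "nat set set \<Rightarrow> nat \<times> nat \<times> nat \<Rightarrow> nat \<times> nat \<times> nat" where
  "theta_word K = (\<lambda>(x, y, z). if {x, z} \<in> K then (z, y, x) else (x, z, y))"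

text \<open>The coefficient of the word \<open>pqr\<close> in \<open>[[y, z], x]\<close> modulo 2.\<close>

definition bracket_coeff :: "nat \<times> nat \<times> nat \<Rightarrow> nat \<times> nat \<times> nat \<Rightarrow> bit" where
  "bracket_coeff = (\<lambda>(p, q, r) (x, y, z).
     (of_bool (y = p) * of_bool (z = q) + of_bool (z = p) * of_bool (y = q)) * of_bool (x = r) +
     of_bool (x = p) * (of_bool (y = q) * of_bool (z = r) + of_bool (z = q) * of_bool (y = r)))"

text \<open>If {x, z} is an edge, then z < x, and the condition on triples excludes {x, y}, so z, y,
  x is a path of non-edges. Otherwise x, z, y is such a path, as {z, y} is never an edge.\<close>

lemma theta_wordE:
  assumes "t \<in> theta_triples m K"
  obtains p q r where "theta_word K t = (p, q, r)" "p \<noteq> q" "q \<noteq> r" "p \<noteq> r" "{p, q} \<notin> K" "{q, r} \<notin> K"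
proof -
  obtain x y z where t: "t = (x, y, z)" by (cases t)
  show ?thesis
  proof (cases "{x, z} \<in> K")
    case True
    then show ?thesis
      using assms that[of z y x] by (auto simp: t theta_word_def theta_triples_def insert_commute)
  next
    case False
    then show ?thesis
      using assms that[of x z y] by (auto simp: t theta_word_def theta_triples_def insert_commute)
  qed
qed

text \<open>The expansion of [[y, z], x] has a single word ending in the maximum y, namely xzy; so
  in the case of a non-edge {x, z} the word determines its triple. The word zyx also occurs for the
  triple with x and z exchanged, but it is used only if {x, z} is an edge; then z < x, and the
  exchanged triple violates the last condition of \<open>theta_triples\<close>.\<close>

lemma bracket_coeff_theta_word:
  assumes "t \<in> theta_triples m K" "t' \<in> theta_triples m K"
  shows "bracket_coeff (theta_word K t) t' = (if t = t' then 1 else 0)"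
proof -
  obtain x y z where t: "t = (x, y, z)" by (cases t)
  obtain x' y' z' where t': "t' = (x', y', z')" by (cases t')
  have lt: "x < y" "z < y" "x \<noteq> z" "x' < y'" "z' < y'" "x' \<noteq> z'"
    using assms by (simp_all add: t t' theta_triples_def)
  show ?thesis
  proof (cases "{x, z} \<in> K")
    case True
    have "\<not> (x' = z \<and> z' = x)"
      using True assms lt by (auto simp: t t' theta_triples_def insert_commute)
    then show ?thesis
      using lt True unfolding t t' theta_word_def bracket_coeff_def of_bool_def by simp
  next
    case False
    then show ?thesis
      using lt unfolding t t' theta_word_def bracket_coeff_def of_bool_def by simp
  qed
qed

text \<open>Every word in [[y, z], z] repeats z. Hence the matrix functionals vanish on the triple
  commutators that come from non-edges.\<close>

lemma bracket_coeff_repeated: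
  assumes "p \<noteq> q" "q \<noteq> r" "p \<noteq> r"
  shows "bracket_coeff (p, q, r) (z, y, z) = 0"
  using assms by (auto simp: bracket_coeff_def)

text \<open>The relations are required to hold, not to be complete. This gives the upper bounds;
  completeness enters the dimension lemmas as the existence of homomorphisms to the detecting
  groups.\<close>

locale right_angled = group G for G (structure) +
  fixes g :: "nat \<Rightarrow> 'a" and m :: nat and K :: "nat set set"
  assumes gen_closed: "i \<in> {1..m} \<Longrightarrow> g i \<in> carrier G"
    and gen_generate: "carrier G = generate G (g ` {1..m})"
    and gen_square: "i \<in> {1..m} \<Longrightarrow> g i \<otimes> g i = \<one>"
    and gen_commute: "\<lbrakk>i \<in> {1..m}; j \<in> {1..m}; {i, j} \<in> K\<rbrakk> \<Longrightarrow> g i \<otimes> g j = g j \<otimes> g i"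
begin

lemma commutator_gen_trivial:
  assumes "i \<in> {1..m}" "j \<in> {1..m}" "i = j \<or> {i, j} \<in> K"
  shows "commutator (g i) (g j) = \<one>"
proof -
  have "g i \<otimes> g j = g j \<otimes> g i" using assms gen_commute by auto
  then show ?thesis using gen_closed assms by (simp add: group_word_simps)
qed

abbreviation triple_commutator :: "nat \<Rightarrow> nat \<Rightarrow> nat \<Rightarrow> 'a" where
  "triple_commutator i j k \<equiv> commutator (commutator (g i) (g j)) (g k)"

lemma lower_central_2_generated:
  assumes "subgroup W G" "lower_central G 3 \<subseteq> W" "W \<subseteq> lower_central G 2"
    and W: "\<And>z y. (z, y) \<in> non_edges m K \<Longrightarrow> commutator (g z) (g y) \<in> W"
  shows "lower_central G 2 \<subseteq> W"
proof (rule lower_central_2_least[OF _ gen_generate])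
  show "W \<lhd> G"
    using normal_between_lower_central[of W "Suc 0"] assms(1-3)
    by (simp only: numeral_2_eq_2 numeral_3_eq_3)
  fix s t assume "s \<in> g ` {1..m}" "t \<in> g ` {1..m}"
  then obtain i j where ij: "i \<in> {1..m}" "j \<in> {1..m}" "s = g i" "t = g j" by auto
  from ij(1,2) show "commutator s t \<in> W"
  proof (cases rule: edge_or_non_edges[where K = K])
    case 1
    then show ?thesis using ij commutator_gen_trivial subgroup.one_closed[OF assms(1)] by simp
  next
    case 2
    then show ?thesis using ij W by simp
  next
    case 3
    then show ?thesis using ij W commutator_swap_mem[OF assms(1)] gen_closed by simp
  qed
qed

text \<open>For a < b < c, exchanging the first two entries reduces the six orders to three, and
  Hall-Witt derives the third from two of them. The two treated directly are (c, a, b) and (c, b,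
  a), the shapes of the triples over {a, b, c}.\<close>

lemma lower_central_3_generated:
  assumes sub: "subgroup W G" and "lower_central G 4 \<subseteq> W" "W \<subseteq> lower_central G 3"
    and Wpair: "\<And>z y. (z, y) \<in> non_edges m K \<Longrightarrow> triple_commutator y z z \<in> W"
    and Wtriple: "\<And>x y z. (x, y, z) \<in> theta_triples m K \<Longrightarrow> triple_commutator y z x \<in> W"
  shows "lower_central G 3 \<subseteq> W"
proof -
  let ?T = triple_commutator
  have W: "W \<lhd> G"
    using normal_between_lower_central[of W "Suc (Suc 0)"] assms(1-3)
    by (simp add: numeral_3_eq_3 eval_nat_numeral del: lower_central.simps)
  \<comment> \<open>With c = (g_i, g_j), the commutator (g_j, g_i) is c^-1, and (c^-1, g_k) = c^-1
    (g_k, c) c.\<close>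
  have swap: "?T j i k \<in> W" if ijk: "i \<in> {1..m}" "j \<in> {1..m}" "k \<in> {1..m}" and T: "?T i j k \<in> W" for i j k
  proof -
    have "commutator (g k) (commutator (g i) (g j)) \<in> W"
      using commutator_swap_mem[OF sub _ _ T] gen_closed ijk by simp
    moreover have "inv (commutator (g i) (g j)) \<otimes> commutator (g k) (commutator (g i) (g j))
        \<otimes> commutator (g i) (g j) = ?T j i k"
      using gen_closed ijk by (simp add: group_word_simps)
    ultimately show ?thesis
      using normal.inv_op_closed1[OF W, of "commutator (g i) (g j)"] gen_closed ijk by (metis inv_closed m_closed)
  qed
  have edge: "?T i j k \<in> W" if "i \<in> {1..m}" "j \<in> {1..m}" "k \<in> {1..m}" "i = j \<or> {i, j} \<in> K" for i j k
    using commutator_gen_trivial[OF that(1,2,4)] gen_closed[OF that(3)] subgroup.one_closed[OF sub] by simp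
  have hw: "?T k i j \<in> W" if "i \<in> {1..m}" "j \<in> {1..m}" "k \<in> {1..m}" "?T i j k \<in> W" "?T j k i \<in> W" for i j k
    using hall_witt_involutions[OF W _ _ _ _ _ _ that(4,5)] that(1-3) gen_closed gen_square by blast
  have same: "?T i j i = ?T i j j" if ij: "i \<in> {1..m}" "j \<in> {1..m}" for i j
  proof -
    have i: "inv (g i) = g i" "inv (g j) = g j"
      using ij gen_closed gen_square by (auto intro: inv_equality)
    have "g i \<otimes> (g i \<otimes> w) = w" "g j \<otimes> (g j \<otimes> w) = w" if "w \<in> carrier G" for w
      using ij that gen_closed gen_square by (simp_all add: m_assoc[symmetric])
    then show ?thesis using ij gen_closed gen_square i by (simp add: group_word_simps)
  qed
  have pair: "?T i j j \<in> W" if "i \<in> {1..m}" "j \<in> {1..m}" for i j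
  proof -
    from that show ?thesis
    proof (cases rule: edge_or_non_edges[where K = K])
      case 1
      then show ?thesis using edge that by simp
    next
      case 3
      then show ?thesis by (rule Wpair)
    next
      case 2
      then have "?T j i j \<in> W" using Wpair[OF 2] same[OF that(2,1)] by simp
      then show ?thesis by (rule swap[OF that(2,1,2)])
    qed
  qed
  have sorted: "?T c a b \<in> W \<and> ?T c b a \<in> W \<and> ?T a b c \<in> W"
    if abc: "a \<in> {1..m}" "b \<in> {1..m}" "c \<in> {1..m}" "a < b" "b < c" for a b c
  proof -
    have 1: "?T c a b \<in> W"
    proof (cases "{a, c} \<in> K")
      case True
      then show ?thesis using edge[of c a b] abc by (simp add: insert_commute)
    next
      case ac: False
      show ?thesis
      proof (cases "{a, b} \<in> K \<and> {b, c} \<in> K")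
        case True
        \<comment> \<open>The path a, b, c joins a to c in K, so no generator is available here;
          instead both other triple commutators in Hall-Witt are trivial.\<close>
        then show ?thesis using hw[of a b c] edge[of a b c] edge[of b c a] abc by simp
      next
        case False
        then have "(b, c, a) \<in> theta_triples m K"
          using abc ac by (auto simp: theta_triples_def insert_commute)
        then show ?thesis by (rule Wtriple)
      qed
    qed
    have 2: "?T c b a \<in> W"
    proof (cases "{b, c} \<in> K")
      case True
      then show ?thesis using edge[of c b a] abc by (simp add: insert_commute)
    next
      case bc: False
      show ?thesis
      proof (cases "{a, b} \<in> K")
        case True
        \<comment> \<open>The edge {a, b} makes (a, b, c) trivial, so Hall-Witt carries the result
          for (c, a, b) over to (b, c, a).\<close>
        then have "?T b c a \<in> W" using hw[of c a b] 1 edge[of a b c] abc by simp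
        then show ?thesis using swap[of b c a] abc by simp
      next
        case False
        then have "(a, c, b) \<in> theta_triples m K"
          using abc bc by (auto simp: theta_triples_def insert_commute)
        then show ?thesis by (rule Wtriple)
      qed
    qed
    have "?T a b c \<in> W" using hw[of b c a] swap[of c b a] 1 2 abc by simp
    with 1 2 show ?thesis by simp
  qed
  show ?thesis
  proof (rule lower_central_3_least[OF W gen_generate])
    fix s t u assume "s \<in> g ` {1..m}" "t \<in> g ` {1..m}" "u \<in> g ` {1..m}"
    then obtain i j k where ijk: "i \<in> {1..m}" "j \<in> {1..m}" "k \<in> {1..m}" "s = g i" "t = g j" "u = g k" by auto
    consider "i = j" | "k = j" | "k = i" | "i < j \<and> j < k" | "j < i \<and> i < k" | "i < k \<and> k < j"
      | "j < k \<and> k < i" | "k < i \<and> i < j" | "k < j \<and> j < i" by linarith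
    then have "?T i j k \<in> W"
    proof cases
      case 1
      then show ?thesis using edge ijk by simp
    next
      case 2
      then show ?thesis using pair ijk by simp
    next
      case 3
      then show ?thesis using pair[OF ijk(1,2)] same[OF ijk(1,2)] by simp
    next
      case 4
      then show ?thesis using sorted[of i j k] ijk by simp
    next
      case 5
      then show ?thesis using sorted[of j i k] swap[of j i k] ijk by simp
    next
      case 6
      then show ?thesis using sorted[of i k j] swap[of j i k] ijk by simp
    next
      case 7
      then show ?thesis using sorted[of j k i] ijk by simp
    next
      case 8
      then show ?thesis using sorted[of k i j] swap[of j i k] ijk by simp
    next
      case 9
      then show ?thesis using sorted[of k j i] ijk by simp
    qed
    then show "commutator (commutator s t) u \<in> W" using ijk by simp
  qed
qed

end

section \<open>The detecting groups\<close>

text \<open>The infinite dihedral group; \<open>(s, k)\<close> acts on the right, \<open>x \<mapsto> \<plusminus>x + k\<close>.\<close>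

definition dihedral :: "(bool \<times> int) monoid" where
  "dihedral = \<lparr>carrier = UNIV,
     mult = (\<lambda>(s, k) (t, l). (s \<noteq> t, (if t then - k else k) + l)), one = (False, 0)\<rparr>"

lemma dihedral_simps [simp]:
  "carrier dihedral = UNIV"
  "(s, k) \<otimes>\<^bsub>dihedral\<^esub> (t, l) = (s \<noteq> t, (if t then - k else k) + l)"
  "\<one>\<^bsub>dihedral\<^esub> = (False, 0)"
  by (simp_all add: dihedral_def)

lemma group_dihedral: "group dihedral"
proof (rule groupI)
  fix x :: "bool \<times> int"
  obtain s k where x: "x = (s, k)" by (cases x)
  show "\<exists>y\<in>carrier dihedral. y \<otimes>\<^bsub>dihedral\<^esub> x = \<one>\<^bsub>dihedral\<^esub>"
    by (rule bexI[of _ "(s, if s then k else - k)"]) (simp_all add: x)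
qed (auto split: if_splits)

interpretation dihedral: group dihedral by (rule group_dihedral)

lemma inv_dihedral [simp]: "inv\<^bsub>dihedral\<^esub> (s, k) = (s, if s then k else - k)"
  by (rule dihedral.inv_equality) simp_all

text \<open>A commutator of a translation with a reflection doubles the translation up to sign,
  hence one more factor 2 at each step.\<close>

fun dihedral_chain :: "nat \<Rightarrow> (bool \<times> int) set" where
  "dihedral_chain 0 = UNIV"
| "dihedral_chain (Suc 0) = UNIV"
| "dihedral_chain (Suc (Suc k)) = {(False, n) | n. 2 ^ Suc k dvd n}"

lemma subgroup_dihedral_chain: "subgroup (dihedral_chain (Suc k)) dihedral"
proof (cases k)
  case 0
  then show ?thesis using dihedral.subgroup_self by simp
next
  case (Suc l)
  then show ?thesis by (intro dihedral.subgroupI) auto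
qed

lemma commutator_dihedral_chain:
  assumes "x \<in> dihedral_chain (Suc k)"
  shows "x \<otimes>\<^bsub>dihedral\<^esub> y \<otimes>\<^bsub>dihedral\<^esub> inv\<^bsub>dihedral\<^esub> x \<otimes>\<^bsub>dihedral\<^esub> inv\<^bsub>dihedral\<^esub> y \<in> dihedral_chain (Suc (Suc k))"
proof -
  obtain s n where x: "x = (s, n)" by (cases x)
  obtain t l where y: "y = (t, l)" by (cases y)
  show ?thesis
  proof (cases k)
    case 0
    then show ?thesis by (auto simp: x y)
  next
    case (Suc j)
    then have "\<not> s" "2 ^ Suc j dvd n" using assms x by auto
    moreover from this(2) have "2 * 2 ^ Suc j dvd 2 * n" by (rule mult_dvd_mono[OF dvd_refl])
    ultimately show ?thesis by (simp add: x y Suc)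
  qed
qed

lemma (in group) hom_dihedral_chain:
  assumes "h \<in> hom G dihedral" "x \<in> lower_central G (Suc k)"
  shows "h x \<in> dihedral_chain (Suc k)"
proof (rule hom_lower_central[where S = dihedral_chain,
      OF group_dihedral assms(1) _ subgroup_dihedral_chain _ assms(2)])
  show "carrier dihedral \<subseteq> dihedral_chain (Suc 0)" by simp
qed (rule commutator_dihedral_chain)

text \<open>The binary digit of the translation length at place k; for k \<ge> 1 it is the
  coordinate on \<open>dihedral_chain (Suc k)\<close> modulo the next term.\<close>

definition dihedral_coeff :: "nat \<Rightarrow> bool \<times> int \<Rightarrow> bit" where
  "dihedral_coeff k x = of_int (snd x div 2 ^ k)"

lemma dihedral_coeff_mult:
  assumes "x \<in> dihedral_chain (Suc (Suc k))" "y \<in> dihedral_chain (Suc (Suc k))"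
  shows "dihedral_coeff (Suc k) (x \<otimes>\<^bsub>dihedral\<^esub> y) = dihedral_coeff (Suc k) x + dihedral_coeff (Suc k) y"
  using assms by (auto simp: dihedral_coeff_def div_plus_div_distrib_dvd_left simp del: power_Suc)

lemma dihedral_coeff_zero:
  assumes "x \<in> dihedral_chain (Suc (Suc (Suc k)))"
  shows "dihedral_coeff (Suc k) x = 0"
proof -
  from assms obtain n where "x = (False, 2 ^ Suc (Suc k) * n)" by (auto elim: dvdE)
  then show ?thesis by (simp add: dihedral_coeff_def)
qed

text \<open>Two reflections whose product is a translation by 1 up to sign. Their commutator
  translates by 2 and their triple commutators by 4 up to sign, so the digits read in degrees 2 and
  3 are both 1.\<close>

definition dihedral_gen :: "nat \<times> nat \<Rightarrow> nat \<Rightarrow> bool \<times> int" where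
  "dihedral_gen = (\<lambda>(p, q) i. if i = p then (True, 0) else if i = q then (True, 1) else (False, 0))"

section \<open>Unitriangular matrices over the field with two elements\<close>

type_synonym unitriangular = "bit \<times> bit \<times> bit \<times> bit \<times> bit \<times> bit"

text \<open>The tuple \<open>(a, b, c, d, e, f)\<close> stands for the unitriangular \<open>4 \<times> 4\<close> matrix whose entries at
  \<open>12\<close>, \<open>23\<close>, \<open>34\<close>, \<open>13\<close>, \<open>24\<close>, \<open>14\<close> are \<open>a\<close>, \<open>b\<close>, \<open>c\<close>, \<open>d\<close>, \<open>e\<close>, \<open>f\<close>.\<close>

definition unitriangular_group :: "unitriangular monoid" where
  "unitriangular_group = \<lparr>carrier = UNIV,
     mult = (\<lambda>(a, b, c, d, e, f) (a', b', c', d', e', f').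
       (a + a', b + b', c + c', d + d' + a * b', e + e' + b * c', f + f' + a * e' + d * c')),
     one = (0, 0, 0, 0, 0, 0)\<rparr>"

lemma unitriangular_simps [simp]:
  "carrier unitriangular_group = UNIV"
  "(a, b, c, d, e, f) \<otimes>\<^bsub>unitriangular_group\<^esub> (a', b', c', d', e', f') =
     (a + a', b + b', c + c', d + d' + a * b', e + e' + b * c', f + f' + a * e' + d * c')"
  "\<one>\<^bsub>unitriangular_group\<^esub> = (0, 0, 0, 0, 0, 0)"
  by (simp_all add: unitriangular_group_def)

lemma bit_add_self [simp]: "x + x = 0" "x + (x + y) = y" for x y :: bit
  by (cases x; cases y; simp)+

lemma group_unitriangular: "group unitriangular_group"
proof (rule groupI)
  fix x :: unitriangular
  obtain a b c d e f where x: "x = (a, b, c, d, e, f)" by (cases x)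
  show "\<exists>y\<in>carrier unitriangular_group. y \<otimes>\<^bsub>unitriangular_group\<^esub> x = \<one>\<^bsub>unitriangular_group\<^esub>"
    by (rule bexI[of _ "(a, b, c, d + a * b, e + b * c, f + a * e + d * c + a * b * c)"])
      (simp_all add: x algebra_simps)
qed (auto simp: algebra_simps)

interpretation unitriangular: group unitriangular_group by (rule group_unitriangular)

lemma inv_unitriangular [simp]:
  "inv\<^bsub>unitriangular_group\<^esub> (a, b, c, d, e, f) =
     (a, b, c, d + a * b, e + b * c, f + a * e + d * c + a * b * c)"
  by (rule unitriangular.inv_equality) (simp_all add: algebra_simps)

fun unitriangular_chain :: "nat \<Rightarrow> unitriangular set" where
  "unitriangular_chain 0 = UNIV"
| "unitriangular_chain (Suc 0) = UNIV"
| "unitriangular_chain (Suc (Suc 0)) = {(0, 0, 0, d, e, f) | d e f. True}"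
| "unitriangular_chain (Suc (Suc (Suc 0))) = {(0, 0, 0, 0, 0, f) | f. True}"
| "unitriangular_chain (Suc (Suc (Suc (Suc k)))) = {(0, 0, 0, 0, 0, 0)}"

lemma subgroup_unitriangular_chain: "subgroup (unitriangular_chain k) unitriangular_group"
  by (cases k rule: unitriangular_chain.cases) (auto intro!: unitriangular.subgroupI)

lemma commutator_unitriangular_chain:
  assumes "x \<in> unitriangular_chain (Suc k)"
  shows "x \<otimes>\<^bsub>unitriangular_group\<^esub> y \<otimes>\<^bsub>unitriangular_group\<^esub> inv\<^bsub>unitriangular_group\<^esub> x
     \<otimes>\<^bsub>unitriangular_group\<^esub> inv\<^bsub>unitriangular_group\<^esub> y \<in> unitriangular_chain (Suc (Suc k))"
  using assms
  by (cases "Suc k" rule: unitriangular_chain.cases; cases x; cases y) (auto simp: algebra_simps)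

lemma (in group) hom_unitriangular_chain:
  assumes "h \<in> hom G unitriangular_group" "x \<in> lower_central G (Suc k)"
  shows "h x \<in> unitriangular_chain (Suc k)"
proof (rule hom_lower_central[where S = unitriangular_chain,
      OF group_unitriangular assms(1) _ subgroup_unitriangular_chain _ assms(2)])
  show "carrier unitriangular_group \<subseteq> unitriangular_chain (Suc 0)" by simp
qed (rule commutator_unitriangular_chain)

definition unitriangular_coeff :: "unitriangular \<Rightarrow> bit" where
  "unitriangular_coeff = (\<lambda>(a, b, c, d, e, f). f)"

text \<open>The matrices 1 + E_12, 1 + E_23, 1 + E_34 at p, q, r: only the word pqr multiplies E_12,
  E_23, E_34 to the corner E_14, as in a truncated Magnus expansion. Read in
  \<open>triangular_lie\<close>, the same tuples are the matrix units themselves.\<close>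

definition unitriangular_gen :: "nat \<times> nat \<times> nat \<Rightarrow> nat \<Rightarrow> unitriangular" where
  "unitriangular_gen = (\<lambda>(p, q, r) i. (of_bool (i = p), of_bool (i = q), of_bool (i = r), 0, 0, 0))"

lemma unitriangular_coeff_mult:
  assumes "x \<in> unitriangular_chain 3" "y \<in> unitriangular_chain 3"
  shows "unitriangular_coeff (x \<otimes>\<^bsub>unitriangular_group\<^esub> y) = unitriangular_coeff x + unitriangular_coeff y"
  using assms by (auto simp: unitriangular_coeff_def numeral_3_eq_3)

section \<open>The quotients of the lower central series\<close>

lemma (in group) hom_commutator:
  assumes "group H" "h \<in> hom G H" "a \<in> carrier G" "b \<in> carrier G"
  shows "h (commutator a b) = h a \<otimes>\<^bsub>H\<^esub> h b \<otimes>\<^bsub>H\<^esub> inv\<^bsub>H\<^esub> h a \<otimes>\<^bsub>H\<^esub> inv\<^bsub>H\<^esub> h b"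
proof -
  interpret gh: group_hom G H h
    using assms by (simp add: group_hom_def group_hom_axioms_def is_group)
  show ?thesis using assms by simp
qed

context right_angled
begin

lemma dihedral_coeff_commutator:
  assumes h: "h \<in> hom G dihedral" "\<And>i. i \<in> {1..m} \<Longrightarrow> h (g i) = dihedral_gen (p, q) i"
    and pq: "(p, q) \<in> non_edges m K" and zy: "(z, y) \<in> non_edges m K"
  shows "dihedral_coeff 1 (h (commutator (g z) (g y))) = (if (p, q) = (z, y) then 1 else 0)"
proof -
  have "z \<in> {1..m}" "y \<in> {1..m}" "z < y" "p < q" using zy pq by (auto simp: non_edges_def)
  then show ?thesis
    by (auto simp: hom_commutator[OF group_dihedral h(1)] h(2) gen_closed dihedral_gen_def dihedral_coeff_def)
qed

lemma dihedral_coeff_triple_commutator: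
  assumes h: "h \<in> hom G dihedral" "\<And>i. i \<in> {1..m} \<Longrightarrow> h (g i) = dihedral_gen (p, q) i"
    and pq: "(p, q) \<in> non_edges m K" and zy: "(z, y) \<in> non_edges m K"
  shows "dihedral_coeff 2 (h (triple_commutator y z z)) = (if (p, q) = (z, y) then 1 else 0)"
proof -
  have "z \<in> {1..m}" "y \<in> {1..m}" "z < y" "p < q" using zy pq by (auto simp: non_edges_def)
  then show ?thesis
    by (auto simp: hom_commutator[OF group_dihedral h(1)] h(2) gen_closed dihedral_gen_def dihedral_coeff_def)
qed

text \<open>Of three distinct generators at least one has trivial image, and a triple commutator
  with a trivial entry is trivial.\<close>

lemma dihedral_coeff_theta:
  assumes h: "h \<in> hom G dihedral" "\<And>i. i \<in> {1..m} \<Longrightarrow> h (g i) = dihedral_gen (p, q) i"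
    and t: "(x, y, z) \<in> theta_triples m K"
  shows "dihedral_coeff 2 (h (triple_commutator y z x)) = 0"
proof -
  have "x \<in> {1..m}" "z \<in> {1..m}" "y \<in> {1..m}" "z < y" "x < y" "x \<noteq> z"
    using t by (auto simp: theta_triples_def)
  then show ?thesis
    by (auto simp: hom_commutator[OF group_dihedral h(1)] h(2) gen_closed dihedral_gen_def dihedral_coeff_def)
qed

text \<open>The leading term of a group commutator is the Lie bracket, so the corner entry is the
  coefficient of a word in an iterated bracket. The group and the Lie algebra therefore share the
  table \<open>bracket_coeff\<close>.\<close>

lemma unitriangular_coeff_triple_commutator:
  assumes h: "h \<in> hom G unitriangular_group" "\<And>i. i \<in> {1..m} \<Longrightarrow> h (g i) = unitriangular_gen w i"
    and "x \<in> {1..m}" "y \<in> {1..m}" "z \<in> {1..m}"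
  shows "unitriangular_coeff (h (triple_commutator y z x)) = bracket_coeff w (x, y, z)"
proof -
  obtain p q r where w: "w = (p, q, r)" by (cases w)
  show ?thesis
    using assms(3-5)
    by (simp add: hom_commutator[OF group_unitriangular h(1)] h(2) gen_closed unitriangular_gen_def
        unitriangular_coeff_def bracket_coeff_def w algebra_simps)
qed

lemma dim_lower_central_quotient_2:
  assumes h: "\<And>e. e \<in> non_edges m K \<Longrightarrow>
      \<exists>h \<in> hom G dihedral. \<forall>i \<in> {1..m}. h (g i) = dihedral_gen e i"
  shows "vectorspace.dim Z2 (Z2_space (lower_central_quotient G 2)) = card (non_edges m K)"
proof -
  from h obtain h where h: "\<And>e. e \<in> non_edges m K \<Longrightarrow> h e \<in> hom G dihedral"
    "\<And>e i. \<lbrakk>e \<in> non_edges m K; i \<in> {1..m}\<rbrakk> \<Longrightarrow> h e (g i) = dihedral_gen e i"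
    by metis
  let ?b = "\<lambda>(z, y). commutator (g z) (g y)"
  have "vectorspace.dim Z2 (Z2_space (lower_central_quotient G (Suc 1))) = card (non_edges m K)"
  proof (rule dim_lower_central_quotient[where b = ?b and f = "\<lambda>e x. dihedral_coeff 1 (h e x)"])
    show "?b ` non_edges m K \<subseteq> lower_central G (Suc 1)"
      using commutator_in_lower_central[of _ 0] gen_closed
      by (auto simp: non_edges_def simp del: lower_central.simps(3))
  next
    fix W assume "subgroup W G" "lower_central G (Suc (Suc 1)) \<subseteq> W" "W \<subseteq> lower_central G (Suc 1)"
      "?b ` non_edges m K \<subseteq> W"
    then show "lower_central G (Suc 1) \<subseteq> W"
      using lower_central_2_generated[of W]
      by (auto simp: numeral_2_eq_2 numeral_3_eq_3 simp del: lower_central.simps)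
  next
    fix e assume "e \<in> non_edges m K"
    then show "?b e \<otimes> ?b e \<in> lower_central G (Suc (Suc 1))"
      using square_commutator_involution[of _ 0] gen_closed gen_square
      by (auto simp: non_edges_def simp del: lower_central.simps(3))
  next
    fix e x assume e: "e \<in> non_edges m K" and x: "x \<in> lower_central G (Suc (Suc 1))"
    show "dihedral_coeff 1 (h e x) = 0"
      using dihedral_coeff_zero[OF hom_dihedral_chain[OF h(1)[OF e] x, simplified One_nat_def]] by simp
  next
    fix e x y assume e: "e \<in> non_edges m K" and x: "x \<in> lower_central G (Suc 1)"
      and y: "y \<in> lower_central G (Suc 1)"
    have "h e (x \<otimes> y) = h e x \<otimes>\<^bsub>dihedral\<^esub> h e y"
      using h(1)[OF e] lower_central_carrier[OF x] lower_central_carrier[OF y] by (simp add: hom_mult)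
    then show "dihedral_coeff 1 (h e (x \<otimes> y)) = dihedral_coeff 1 (h e x) + dihedral_coeff 1 (h e y)"
      using dihedral_coeff_mult[of _ 0] hom_dihedral_chain[OF h(1)[OF e]] x y
      by (simp del: dihedral_chain.simps lower_central.simps)
  next
    fix e e' assume "e \<in> non_edges m K" "e' \<in> non_edges m K"
    then show "dihedral_coeff 1 (h e (?b e')) = (if e = e' then 1 else 0)"
      using dihedral_coeff_commutator[OF h] by (cases e; cases e') auto
  qed (rule finite_non_edges)
  then show ?thesis by (simp add: numeral_2_eq_2)
qed

text \<open>The pairing matrix over the disjoint sum is the identity: the diagonal blocks are the
  two detection results, and the mixed blocks vanish by \<open>dihedral_coeff_theta\<close> and
  \<open>bracket_coeff_repeated\<close>.\<close>

lemma dim_lower_central_quotient_3: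
  assumes h: "\<And>e. e \<in> non_edges m K \<Longrightarrow>
      \<exists>h \<in> hom G dihedral. \<forall>i \<in> {1..m}. h (g i) = dihedral_gen e i"
    and h': "\<And>t. t \<in> theta_triples m K \<Longrightarrow>
      \<exists>h \<in> hom G unitriangular_group. \<forall>i \<in> {1..m}. h (g i) = unitriangular_gen (theta_word K t) i"
  shows "vectorspace.dim Z2 (Z2_space (lower_central_quotient G 3)) =
      card (non_edges m K) + card (theta_triples m K)"
proof -
  from h obtain h where h: "\<And>e. e \<in> non_edges m K \<Longrightarrow> h e \<in> hom G dihedral"
    "\<And>e i. \<lbrakk>e \<in> non_edges m K; i \<in> {1..m}\<rbrakk> \<Longrightarrow> h e (g i) = dihedral_gen e i"
    by metis
  from h' obtain h' where h': "\<And>t. t \<in> theta_triples m K \<Longrightarrow> h' t \<in> hom G unitriangular_group"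
    "\<And>t i. \<lbrakk>t \<in> theta_triples m K; i \<in> {1..m}\<rbrakk> \<Longrightarrow> h' t (g i) = unitriangular_gen (theta_word K t) i"
    by metis
  let ?P = "Sum_Type.Plus (non_edges m K) (theta_triples m K)"
  let ?b = "case_sum (\<lambda>(z, y). triple_commutator y z z) (\<lambda>(x, y, z). triple_commutator y z x)"
  let ?f = "case_sum (\<lambda>e x. dihedral_coeff 2 (h e x)) (\<lambda>t x. unitriangular_coeff (h' t x))"
  have comm: "commutator (g y) (g z) \<in> lower_central G (Suc 1)" if "y \<in> {1..m}" "z \<in> {1..m}" for y z
    using commutator_in_lower_central[of _ 0] gen_closed that by simp
  have "vectorspace.dim Z2 (Z2_space (lower_central_quotient G (Suc 2))) = card ?P"
  proof (rule dim_lower_central_quotient[where b = ?b and f = ?f])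
    show "?b ` ?P \<subseteq> lower_central G (Suc 2)"
      using commutator_in_lower_central[OF comm] gen_closed
      by (auto simp: non_edges_def theta_triples_def numeral_2_eq_2 simp del: lower_central.simps(3))
  next
    fix W assume "subgroup W G" "lower_central G (Suc (Suc 2)) \<subseteq> W" "W \<subseteq> lower_central G (Suc 2)"
      "?b ` ?P \<subseteq> W"
    then show "lower_central G (Suc 2) \<subseteq> W"
      using lower_central_3_generated[of W]
      by (force simp: eval_nat_numeral simp del: lower_central.simps)
  next
    fix p assume "p \<in> ?P"
    then show "?b p \<otimes> ?b p \<in> lower_central G (Suc (Suc 2))"
      using square_commutator_involution[OF comm] gen_closed gen_square
      by (auto simp: non_edges_def theta_triples_def numeral_2_eq_2 simp del: lower_central.simps(3))
  next
    fix p x assume p: "p \<in> ?P" and x: "x \<in> lower_central G (Suc (Suc 2))"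
    from p show "?f p x = 0"
    proof (rule PlusE)
      fix e assume 1: "e \<in> non_edges m K" "p = Inl e"
      then show ?thesis
        using dihedral_coeff_zero[of _ 1] hom_dihedral_chain[OF h(1), of e x] x
        by (simp add: numeral_2_eq_2 del: dihedral_chain.simps lower_central.simps)
    next
      fix t assume 2: "t \<in> theta_triples m K" "p = Inr t"
      then have "h' t x \<in> unitriangular_chain (Suc (Suc 2))"
        using hom_unitriangular_chain[OF h'(1)] x by blast
      then show ?thesis using 2 by (simp add: numeral_2_eq_2 unitriangular_coeff_def)
    qed
  next
    fix p x y assume p: "p \<in> ?P" and x: "x \<in> lower_central G (Suc 2)" and y: "y \<in> lower_central G (Suc 2)"
    have xy: "x \<in> carrier G" "y \<in> carrier G"
      using lower_central_carrier[OF x] lower_central_carrier[OF y] .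
    from p show "?f p (x \<otimes> y) = ?f p x + ?f p y"
    proof (rule PlusE)
      fix e assume 1: "e \<in> non_edges m K" "p = Inl e"
      have "h e (x \<otimes> y) = h e x \<otimes>\<^bsub>dihedral\<^esub> h e y"
        using h(1)[OF 1(1)] xy by (simp add: hom_mult)
      then show ?thesis
        using dihedral_coeff_mult[of _ 1] hom_dihedral_chain[OF h(1)[OF 1(1)]] x y 1
        by (simp add: numeral_2_eq_2 del: dihedral_chain.simps lower_central.simps)
    next
      fix t assume 2: "t \<in> theta_triples m K" "p = Inr t"
      have "h' t (x \<otimes> y) = h' t x \<otimes>\<^bsub>unitriangular_group\<^esub> h' t y"
        using h'(1)[OF 2(1)] xy by (simp add: hom_mult)
      then show ?thesis
        using unitriangular_coeff_mult[of "h' t x" "h' t y"] hom_unitriangular_chain[OF h'(1)[OF 2(1)]] x y 2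
        by (simp add: numeral_2_eq_2 numeral_3_eq_3 del: unitriangular_chain.simps lower_central.simps)
    qed
  next
    fix p p' assume "p \<in> ?P" "p' \<in> ?P"
    then show "?f p (?b p') = (if p = p' then 1 else 0)"
    proof (elim PlusE)
      fix e e' assume "e \<in> non_edges m K" "p = Inl e" "e' \<in> non_edges m K" "p' = Inl e'"
      then show ?thesis using dihedral_coeff_triple_commutator[OF h] by (cases e; cases e') auto
    next
      fix e t assume "e \<in> non_edges m K" "p = Inl e" "t \<in> theta_triples m K" "p' = Inr t"
      then show ?thesis using dihedral_coeff_theta[OF h] by (cases e; cases t) auto
    next
      fix t e assume te: "t \<in> theta_triples m K" "p = Inr t" "e \<in> non_edges m K" "p' = Inl e"
      obtain z y where e: "e = (z, y)" by (cases e)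
      obtain p q r where w: "theta_word K t = (p, q, r)" "p \<noteq> q" "q \<noteq> r" "p \<noteq> r"
        using te(1) by (rule theta_wordE)
      have "z \<in> {1..m}" "y \<in> {1..m}" using te(3) by (auto simp: e non_edges_def)
      \<comment> \<open>The commutator of the non-edge (z, y) has the entries y, z, z, so in the
        table it is the triple (z, y, z).\<close>
      then show ?thesis
        using unitriangular_coeff_triple_commutator[OF h'[OF te(1)], of z y z] bracket_coeff_repeated[OF w(2-4)] te
        by (simp add: e w(1))
    next
      fix t t' assume tt': "t \<in> theta_triples m K" "p = Inr t" "t' \<in> theta_triples m K" "p' = Inr t'"
      obtain x y z where t': "t' = (x, y, z)" by (cases t')
      have "x \<in> {1..m}" "z \<in> {1..m}" "y \<in> {1..m}" using tt'(3) by (auto simp: t' theta_triples_def)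
      then show ?thesis
        using unitriangular_coeff_triple_commutator[OF h'[OF tt'(1)], of x y z]
          bracket_coeff_theta_word[OF tt'(1,3)] tt'
        by (simp add: t')
    qed
  qed (simp add: finite_non_edges finite_theta_triples)
  then show ?thesis
    by (simp add: numeral_3_eq_3 numeral_2_eq_2 card_Plus finite_non_edges finite_theta_triples)
qed

end

section \<open>The right-angled Coxeter group as an instance, and its homomorphisms\<close>

definition RC_relations :: "nat \<Rightarrow> nat set set \<Rightarrow> (nat word \<times> nat word) set" where
  "RC_relations m K = (let g = (\<lambda>i. (i, True)) in
       ({([g i, g i], []) | i. i \<in> {1..m}} \<union>
        {([g i, g j], [g j, g i]) | i j. i \<in> {1..m} \<and> j \<in> {1..m} \<and> {i, j} \<in> K}))"

lemma RC_eq: "RC m K = presented_group {1..m} (RC_relations m K)"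
  by (simp add: RC_def RC_relations_def)

definition RC_gen :: "nat \<Rightarrow> nat set set \<Rightarrow> nat \<Rightarrow> nat word set" where
  "RC_gen m K = presented_gen {1..m} (RC_relations m K)"

lemma right_angled_RC: "right_angled (RC m K) (RC_gen m K) m K"
proof -
  let ?X = "{1..m}" and ?E = "RC_relations m K"
  interpret group "presented_group ?X ?E" by (rule group_presented_group)
  have rel: "word_cong ?X ?E `` {u} = word_cong ?X ?E `` {v}" if "(u, v) \<in> ?E"
    "u \<in> lists (?X \<times> UNIV)" "v \<in> lists (?X \<times> UNIV)" for u v
    unfolding word_class_eq_iff[OF that(2,3)] by (rule word_cong.relation[OF that])
  have mult: "RC_gen m K i \<otimes>\<^bsub>RC m K\<^esub> RC_gen m K j = word_cong ?X ?E `` {[(i, True), (j, True)]}"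
    if "i \<in> ?X" "j \<in> ?X" for i j
    using mult_presented_group[of "[(i, True)]" ?X "[(j, True)]" ?E] that
    by (simp add: RC_gen_def RC_eq)
  show ?thesis
  proof (intro right_angled.intro right_angled_axioms.intro)
    show "RC_gen m K i \<in> carrier (RC m K)" if "i \<in> ?X" for i
      using presented_gen_closed[OF that] by (simp add: RC_gen_def RC_eq)
    show "carrier (RC m K) = generate (RC m K) (RC_gen m K ` ?X)"
      using presented_group_generate[of ?X ?E] by (simp add: RC_gen_def RC_eq)
    show "RC_gen m K i \<otimes>\<^bsub>RC m K\<^esub> RC_gen m K i = \<one>\<^bsub>RC m K\<^esub>" if i: "i \<in> ?X" for i
    proof -
      have "([(i, True), (i, True)], []) \<in> ?E" using i by (auto simp: RC_relations_def Let_def)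
      from rel[OF this] show ?thesis using i unfolding mult[OF i i] by (simp add: RC_eq presented_group_def)
    qed
    show "RC_gen m K i \<otimes>\<^bsub>RC m K\<^esub> RC_gen m K j = RC_gen m K j \<otimes>\<^bsub>RC m K\<^esub> RC_gen m K i"
      if ij: "i \<in> ?X" "j \<in> ?X" and K: "{i, j} \<in> K" for i j
    proof -
      have "([(i, True), (j, True)], [(j, True), (i, True)]) \<in> ?E"
        using ij K unfolding RC_relations_def Let_def by blast
      from rel[OF this] show ?thesis using ij unfolding mult[OF ij] mult[OF ij(2,1)] by simp
    qed
  qed (simp add: RC_eq group_presented_group)
qed

lemma RC_hom:
  assumes H: "group H" and f: "\<And>i. i \<in> {1..m} \<Longrightarrow> f i \<in> carrier H"
    and sq: "\<And>i. i \<in> {1..m} \<Longrightarrow> f i \<otimes>\<^bsub>H\<^esub> f i = \<one>\<^bsub>H\<^esub>"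
    and comm: "\<And>i j. \<lbrakk>i \<in> {1..m}; j \<in> {1..m}; {i, j} \<in> K\<rbrakk> \<Longrightarrow> f i \<otimes>\<^bsub>H\<^esub> f j = f j \<otimes>\<^bsub>H\<^esub> f i"
  shows "\<exists>h \<in> hom (RC m K) H. \<forall>i \<in> {1..m}. h (RC_gen m K i) = f i"
proof -
  interpret H: group H by (rule H)
  \<comment> \<open>The shape into which simplification brings membership in
    \<open>{1..m}\<close>.\<close>
  have comm': "f i \<otimes>\<^bsub>H\<^esub> f j = f j \<otimes>\<^bsub>H\<^esub> f i"
    if "Suc 0 \<le> i" "i \<le> m" "Suc 0 \<le> j" "j \<le> m" "{i, j} \<in> K" for i j
    using that by (intro comm) auto
  have "word_eval H f u = word_eval H f v" if "(u, v) \<in> RC_relations m K" for u v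
    using that f sq by (auto simp: RC_relations_def Let_def intro: comm')
  then obtain h where "h \<in> hom (presented_group {1..m} (RC_relations m K)) H"
    "\<And>i. i \<in> {1..m} \<Longrightarrow> h (presented_gen {1..m} (RC_relations m K) i) = f i"
    using H.presented_group_hom[of f "{1..m}" "RC_relations m K"] f by blast
  then show ?thesis unfolding RC_eq RC_gen_def by blast
qed

lemma RC_dihedral_hom:
  assumes "e \<in> non_edges m K"
  shows "\<exists>h \<in> hom (RC m K) dihedral. \<forall>i \<in> {1..m}. h (RC_gen m K i) = dihedral_gen e i"
  by (rule RC_hom[OF group_dihedral])
    (use assms in \<open>auto simp: dihedral_gen_def non_edges_def insert_commute split: if_splits\<close>)

text \<open>E_12 and E_34 commute, so only {p, q} and {q, r} must be non-edges; {p, r} is an edge in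
  the first case of \<open>theta_word\<close>. Distinctness of neighbouring letters makes the images
  involutions.\<close>

lemma RC_unitriangular_hom:
  assumes "t \<in> theta_triples m K"
  shows "\<exists>h \<in> hom (RC m K) unitriangular_group.
    \<forall>i \<in> {1..m}. h (RC_gen m K i) = unitriangular_gen (theta_word K t) i"
proof -
  obtain p q r where w: "theta_word K t = (p, q, r)" "p \<noteq> q" "q \<noteq> r" "{p, q} \<notin> K" "{q, r} \<notin> K"
    using assms by (rule theta_wordE)
  show ?thesis
    unfolding w(1)
    by (rule RC_hom[OF group_unitriangular])
      (use w(2-) in \<open>auto simp: unitriangular_gen_def insert_commute\<close>)
qed

theorem dim_RC_lower_central_quotient:
  shows "vectorspace.dim Z2 (Z2_space (lower_central_quotient (RC m K) 2)) = card (non_edges m K)"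
    and "vectorspace.dim Z2 (Z2_space (lower_central_quotient (RC m K) 3)) =
      card (non_edges m K) + card (theta_triples m K)"
  using right_angled.dim_lower_central_quotient_2[OF right_angled_RC RC_dihedral_hom]
    right_angled.dim_lower_central_quotient_3[OF right_angled_RC RC_dihedral_hom RC_unitriangular_hom]
  by blast+

section \<open>Lie algebras\<close>

locale lie_alg = Module.module R L for R (structure) and L :: "('r, 'a, 'd) lie_algebra_scheme" (structure) +
  assumes bracket_closed [simp, intro]: "\<lbrakk>x \<in> carrier L; y \<in> carrier L\<rbrakk> \<Longrightarrow> bracket L x y \<in> carrier L"
    and bracket_add_left: "\<lbrakk>x \<in> carrier L; y \<in> carrier L; z \<in> carrier L\<rbrakk>
      \<Longrightarrow> bracket L (x \<oplus>\<^bsub>L\<^esub> y) z = bracket L x z \<oplus>\<^bsub>L\<^esub> bracket L y z"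
    and bracket_add_right: "\<lbrakk>x \<in> carrier L; y \<in> carrier L; z \<in> carrier L\<rbrakk>
      \<Longrightarrow> bracket L x (y \<oplus>\<^bsub>L\<^esub> z) = bracket L x y \<oplus>\<^bsub>L\<^esub> bracket L x z"
    and bracket_smult_left: "\<lbrakk>a \<in> carrier R; x \<in> carrier L; y \<in> carrier L\<rbrakk>
      \<Longrightarrow> bracket L (a \<odot>\<^bsub>L\<^esub> x) y = a \<odot>\<^bsub>L\<^esub> bracket L x y"
    and bracket_smult_right: "\<lbrakk>a \<in> carrier R; x \<in> carrier L; y \<in> carrier L\<rbrakk>
      \<Longrightarrow> bracket L x (a \<odot>\<^bsub>L\<^esub> y) = a \<odot>\<^bsub>L\<^esub> bracket L x y"
    and bracket_self: "x \<in> carrier L \<Longrightarrow> bracket L x x = \<zero>\<^bsub>L\<^esub>"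
    and jacobi: "\<lbrakk>x \<in> carrier L; y \<in> carrier L; z \<in> carrier L\<rbrakk>
      \<Longrightarrow> bracket L x (bracket L y z) \<oplus>\<^bsub>L\<^esub>
        (bracket L y (bracket L z x) \<oplus>\<^bsub>L\<^esub> bracket L z (bracket L x y)) = \<zero>\<^bsub>L\<^esub>"
begin

lemma bracket_zero_left [simp]: "x \<in> carrier L \<Longrightarrow> bracket L \<zero>\<^bsub>L\<^esub> x = \<zero>\<^bsub>L\<^esub>"
  using bracket_add_left[of "\<zero>\<^bsub>L\<^esub>" "\<zero>\<^bsub>L\<^esub>" x] by simp

lemma bracket_zero_right [simp]: "x \<in> carrier L \<Longrightarrow> bracket L x \<zero>\<^bsub>L\<^esub> = \<zero>\<^bsub>L\<^esub>"
  using bracket_add_right[of x "\<zero>\<^bsub>L\<^esub>" "\<zero>\<^bsub>L\<^esub>"] by simp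

lemma bracket_antisym:
  assumes "x \<in> carrier L" "y \<in> carrier L"
  shows "bracket L x y \<oplus>\<^bsub>L\<^esub> bracket L y x = \<zero>\<^bsub>L\<^esub>"
proof -
  have "\<zero>\<^bsub>L\<^esub> = bracket L (x \<oplus>\<^bsub>L\<^esub> y) (x \<oplus>\<^bsub>L\<^esub> y)" using assms by (simp add: bracket_self)
  also have "\<dots> = bracket L x x \<oplus>\<^bsub>L\<^esub> bracket L x y \<oplus>\<^bsub>L\<^esub> (bracket L y x \<oplus>\<^bsub>L\<^esub> bracket L y y)"
    using assms by (simp only: bracket_add_left bracket_add_right a_ac a_closed bracket_closed)
  also have "\<dots> = bracket L x y \<oplus>\<^bsub>L\<^esub> bracket L y x"
    using assms by (simp add: bracket_self)
  finally show ?thesis by simp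
qed

end

section \<open>Homomorphisms and quotients of Lie algebras\<close>

definition lie_hom :: "('r, 'c) ring_scheme \<Rightarrow> ('r, 'a, 'd) lie_algebra_scheme \<Rightarrow>
    ('r, 'b, 'e) lie_algebra_scheme \<Rightarrow> ('a \<Rightarrow> 'b) set" where
  "lie_hom R L M = {\<phi> \<in> carrier L \<rightarrow> carrier M.
     (\<forall>x\<in>carrier L. \<forall>y\<in>carrier L. \<phi> (x \<oplus>\<^bsub>L\<^esub> y) = \<phi> x \<oplus>\<^bsub>M\<^esub> \<phi> y) \<and>
     (\<forall>a\<in>carrier R. \<forall>x\<in>carrier L. \<phi> (a \<odot>\<^bsub>L\<^esub> x) = a \<odot>\<^bsub>M\<^esub> \<phi> x) \<and>
     (\<forall>x\<in>carrier L. \<forall>y\<in>carrier L. \<phi> (bracket L x y) = bracket M (\<phi> x) (\<phi> y))}"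

lemma lie_homD:
  assumes "\<phi> \<in> lie_hom R L M"
  shows "x \<in> carrier L \<Longrightarrow> \<phi> x \<in> carrier M"
    and "\<lbrakk>x \<in> carrier L; y \<in> carrier L\<rbrakk> \<Longrightarrow> \<phi> (x \<oplus>\<^bsub>L\<^esub> y) = \<phi> x \<oplus>\<^bsub>M\<^esub> \<phi> y"
    and "\<lbrakk>a \<in> carrier R; x \<in> carrier L\<rbrakk> \<Longrightarrow> \<phi> (a \<odot>\<^bsub>L\<^esub> x) = a \<odot>\<^bsub>M\<^esub> \<phi> x"
    and "\<lbrakk>x \<in> carrier L; y \<in> carrier L\<rbrakk> \<Longrightarrow> \<phi> (bracket L x y) = bracket M (\<phi> x) (\<phi> y)"
  using assms by (auto simp: lie_hom_def)

lemma lie_hom_zero: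
  assumes "\<phi> \<in> lie_hom R L M" "lie_alg R L" "lie_alg R M"
  shows "\<phi> \<zero>\<^bsub>L\<^esub> = \<zero>\<^bsub>M\<^esub>"
proof -
  interpret L: lie_alg R L by fact
  interpret M: lie_alg R M by fact
  have "\<phi> \<zero>\<^bsub>L\<^esub> \<oplus>\<^bsub>M\<^esub> \<phi> \<zero>\<^bsub>L\<^esub> = \<phi> \<zero>\<^bsub>L\<^esub>"
    using lie_homD(2)[OF assms(1) L.zero_closed L.zero_closed] by simp
  then show ?thesis using lie_homD(1)[OF assms(1) L.zero_closed] by simp
qed

text \<open>The axioms pass along a surjection that preserves the operations, so a quotient inherits
  them once the coset map is known to be such a surjection.\<close>

lemma lie_alg_hom_image:
  fixes R (structure) and L (structure) and M (structure)
  assumes "lie_alg R L" and \<phi>: "\<phi> \<in> lie_hom R L M" and surj: "carrier M = \<phi> ` carrier L"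
    and zero: "\<phi> \<zero>\<^bsub>L\<^esub> = \<zero>\<^bsub>M\<^esub>"
  shows "lie_alg R M"
proof -
  interpret L: lie_alg R L by fact
  note hom = lie_homD(2-4)[OF \<phi>, symmetric]
  have M: "abelian_group M"
  proof (rule abelian_groupI)
    fix u assume "u \<in> carrier M"
    then obtain x where x: "x \<in> carrier L" "u = \<phi> x" using surj by auto
    have "\<phi> (\<ominus>\<^bsub>L\<^esub> x) \<oplus>\<^bsub>M\<^esub> u = \<zero>\<^bsub>M\<^esub>" using x by (simp add: hom zero L.l_neg)
    then show "\<exists>v\<in>carrier M. v \<oplus>\<^bsub>M\<^esub> u = \<zero>\<^bsub>M\<^esub>" using x surj by auto
  qed (auto simp: surj hom zero[symmetric] L.a_ac)
  have "module R M"
    by (rule moduleI[OF L.R.is_cring M])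
      (auto simp: surj hom L.smult_l_distr L.smult_r_distr L.smult_assoc1)
  then show ?thesis
    by (rule lie_alg.intro, unfold_locales)
      (auto simp: surj hom zero[symmetric] L.bracket_add_left L.bracket_add_right L.bracket_smult_left
        L.bracket_smult_right L.bracket_self L.jacobi)
qed

context lie_alg
begin

lemma lie_ideal_closed:
  assumes "S \<subseteq> carrier L" "x \<in> lie_ideal R L S"
  shows "x \<in> carrier L"
  using assms(2) by (induction rule: lie_ideal.induct) (use assms(1) in auto)

lemma lie_ideal_additive_subgroup:
  assumes S: "S \<subseteq> carrier L"
  shows "abelian_subgroup (lie_ideal R L S) L"
proof (rule abelian_subgroupI3[OF additive_subgroup.intro])
  \<comment> \<open>\<open>lie_ideal\<close> has no rule for negatives; they come from scaling by
    -1.\<close>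
  have neg: "\<ominus>\<^bsub>L\<^esub> x \<in> lie_ideal R L S" if "x \<in> lie_ideal R L S" for x
    using lie_ideal.smult[OF _ that, of "\<ominus>\<^bsub>R\<^esub> \<one>\<^bsub>R\<^esub>"] lie_ideal_closed[OF S that]
    by (simp add: smult_l_minus)
  show "subgroup (lie_ideal R L S) (add_monoid L)"
  proof (rule add.subgroupI)
    show "lie_ideal R L S \<noteq> {}" using lie_ideal.zero[of L R S] by blast
  qed (use lie_ideal_closed[OF S] lie_ideal.add neg in \<open>auto simp: a_inv_def\<close>)
qed unfold_locales

end

lemma lie_quotient_cosets:
  fixes L :: "('r, 'a) lie_algebra"
  assumes "lie_alg R L" and S: "S \<subseteq> carrier L"
  defines "I \<equiv> lie_ideal R L S"
  shows "carrier (lie_quotient L I) = (\<lambda>x. I +>\<^bsub>L\<^esub> x) ` carrier L"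
    and "(\<lambda>x. I +>\<^bsub>L\<^esub> x) \<in> lie_hom R L (lie_quotient L I)"
    and "I +>\<^bsub>L\<^esub> \<zero>\<^bsub>L\<^esub> = \<zero>\<^bsub>lie_quotient L I\<^esub>"
    and "lie_alg R (lie_quotient L I)"
    and "\<lbrakk>x \<in> carrier L; y \<in> carrier L; I +>\<^bsub>L\<^esub> x = I +>\<^bsub>L\<^esub> y\<rbrakk> \<Longrightarrow> \<exists>n\<in>I. x = n \<oplus>\<^bsub>L\<^esub> y"
proof -
  interpret L: lie_alg R L by fact
  interpret I: abelian_subgroup I L unfolding I_def by (rule L.lie_ideal_additive_subgroup[OF S])
  let ?Q = "lie_quotient L I" and ?q = "\<lambda>x. I +>\<^bsub>L\<^esub> x"
  have coset: "y \<in> ?q x \<longleftrightarrow> (\<exists>n\<in>I. y = n \<oplus>\<^bsub>L\<^esub> x)" for x y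
    by (auto simp: a_r_coset_def r_coset_def)
  have eq: "?q (n \<oplus>\<^bsub>L\<^esub> x) = ?q x" if "n \<in> I" "x \<in> carrier L" for n x
    by (rule I.a_repr_independence'[symmetric]) (use that coset in auto)
  have self: "x \<in> ?q x" if "x \<in> carrier L" for x
    using that by (rule I.a_rcos_self)
  show carrier: "carrier ?Q = ?q ` carrier L"
    by (auto simp: lie_quotient_def A_RCOSETS_def RCOSETS_def a_r_coset_def)
  show hom: "?q \<in> lie_hom R L ?Q"
    unfolding lie_hom_def
  proof (intro CollectI conjI ballI)
    show "?q \<in> carrier L \<rightarrow> carrier ?Q" by (auto simp: carrier)
    fix x assume x: "x \<in> carrier L"
    fix a assume a: "a \<in> carrier R"
    have "?q (a \<odot>\<^bsub>L\<^esub> y) = ?q (a \<odot>\<^bsub>L\<^esub> x)" if "y \<in> ?q x" for y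
    proof -
      from that obtain n where n: "n \<in> I" "y = n \<oplus>\<^bsub>L\<^esub> x" by (auto simp: coset)
      have "a \<odot>\<^bsub>L\<^esub> n \<in> I" using n(1) a unfolding I_def by (rule_tac lie_ideal.smult)
      then show ?thesis using n x a by (simp add: L.smult_r_distr eq)
    qed
    then have "(\<Union>y\<in>?q x. ?q (a \<odot>\<^bsub>L\<^esub> y)) = (\<Union>y\<in>?q x. ?q (a \<odot>\<^bsub>L\<^esub> x))"
      by (intro SUP_cong) auto
    then show "?q (a \<odot>\<^bsub>L\<^esub> x) = a \<odot>\<^bsub>?Q\<^esub> ?q x"
      using self[OF x] by (simp add: lie_quotient_def SUP_constant) auto
  next
    fix x y assume xy: "x \<in> carrier L" "y \<in> carrier L"
    show "?q (x \<oplus>\<^bsub>L\<^esub> y) = ?q x \<oplus>\<^bsub>?Q\<^esub> ?q y"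
      using I.a_rcos_sum[OF xy] by (simp add: lie_quotient_def)
    have "?q (bracket L x' y') = ?q (bracket L x y)" if "x' \<in> ?q x" "y' \<in> ?q y" for x' y'
    proof -
      from that obtain n k where n: "n \<in> I" "x' = n \<oplus>\<^bsub>L\<^esub> x" and k: "k \<in> I" "y' = k \<oplus>\<^bsub>L\<^esub> y"
        by (auto simp: coset)
      have nk: "n \<in> carrier L" "k \<in> carrier L" using n k I.a_subset by auto
      have I1: "bracket L x k \<in> I"
        using k(1) xy unfolding I_def by (rule_tac lie_ideal.bracket)
      \<comment> \<open>The ideal rule absorbs the second argument only; the first is handled
        through antisymmetry.\<close>
      have "bracket L (k \<oplus>\<^bsub>L\<^esub> y) n \<in> I"
        using n(1) xy nk unfolding I_def by (rule_tac lie_ideal.bracket) auto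
      then have "\<ominus>\<^bsub>L\<^esub> bracket L (k \<oplus>\<^bsub>L\<^esub> y) n \<in> I" by (rule I.a_inv_closed)
      moreover have "\<ominus>\<^bsub>L\<^esub> bracket L (k \<oplus>\<^bsub>L\<^esub> y) n = bracket L n (k \<oplus>\<^bsub>L\<^esub> y)"
        using nk xy L.bracket_antisym[of n "k \<oplus>\<^bsub>L\<^esub> y"] by (intro L.minus_equality) auto
      ultimately have I2: "bracket L n (k \<oplus>\<^bsub>L\<^esub> y) \<in> I" by simp
      have "bracket L x' y' = bracket L n (k \<oplus>\<^bsub>L\<^esub> y) \<oplus>\<^bsub>L\<^esub> (bracket L x k \<oplus>\<^bsub>L\<^esub> bracket L x y)"
        using n k nk xy by (simp add: L.bracket_add_left L.bracket_add_right L.a_ac)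
      then show ?thesis using eq I1 I2 xy nk by simp
    qed
    then have "(\<Union>x'\<in>?q x. \<Union>y'\<in>?q y. ?q (bracket L x' y')) = (\<Union>x'\<in>?q x. \<Union>y'\<in>?q y. ?q (bracket L x y))"
      by (intro SUP_cong) auto
    then show "?q (bracket L x y) = bracket ?Q (?q x) (?q y)"
      using self[OF xy(1)] self[OF xy(2)] by (simp add: lie_quotient_def SUP_constant) auto
  qed
  show zero: "?q \<zero>\<^bsub>L\<^esub> = \<zero>\<^bsub>?Q\<^esub>"
    using I.a_subset by (simp add: lie_quotient_def)
  show "lie_alg R ?Q"
    by (rule lie_alg_hom_image[OF assms(1) hom carrier zero])
  show "\<exists>n\<in>I. x = n \<oplus>\<^bsub>L\<^esub> y" if "x \<in> carrier L" "y \<in> carrier L" "?q x = ?q y"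
    using self[OF that(1)] that(3) coset by simp
qed

lemma lie_quotient_factor:
  fixes L :: "('r, 'a) lie_algebra"
  assumes L: "lie_alg R L" and M: "lie_alg R M" and S: "S \<subseteq> carrier L"
    and \<phi>: "\<phi> \<in> lie_hom R L M" and zero: "\<And>s. s \<in> S \<Longrightarrow> \<phi> s = \<zero>\<^bsub>M\<^esub>"
  obtains \<psi> where "\<psi> \<in> lie_hom R (lie_quotient L (lie_ideal R L S)) M"
    "\<And>x. x \<in> carrier L \<Longrightarrow> \<psi> (lie_ideal R L S +>\<^bsub>L\<^esub> x) = \<phi> x"
proof
  interpret L: lie_alg R L by fact
  interpret M: lie_alg R M by fact
  let ?I = "lie_ideal R L S"
  let ?Q = "lie_quotient L ?I" and ?q = "\<lambda>x. ?I +>\<^bsub>L\<^esub> x"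
  note Q = lie_quotient_cosets[OF L S]
  have ker: "\<phi> n = \<zero>\<^bsub>M\<^esub>" if "n \<in> ?I" for n
    using that
  proof (induction rule: lie_ideal.induct)
    case (bracket x y)
    then show ?case using lie_homD[OF \<phi>] L.lie_ideal_closed[OF S] by simp
  qed (use lie_homD[OF \<phi>] L.lie_ideal_closed[OF S] lie_hom_zero[OF \<phi> L M] zero in auto)
  define \<psi> where "\<psi> A = \<phi> (SOME x. x \<in> carrier L \<and> ?q x = A)" for A
  show \<psi>: "\<psi> (?q x) = \<phi> x" if x: "x \<in> carrier L" for x
  proof -
    let ?y = "SOME y. y \<in> carrier L \<and> ?q y = ?q x"
    have y: "?y \<in> carrier L \<and> ?q ?y = ?q x" by (rule someI[of _ x]) (use x in simp)
    then obtain n where n: "n \<in> ?I" "?y = n \<oplus>\<^bsub>L\<^esub> x" using Q(5)[of ?y x] x by blast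
    then show ?thesis
      unfolding \<psi>_def n(2)
      using lie_homD(1,2)[OF \<phi>] ker L.lie_ideal_closed[OF S] x by simp
  qed
  note hom = lie_homD(2-4)[OF Q(2), symmetric] lie_homD[OF \<phi>]
  show "\<psi> \<in> lie_hom R ?Q M"
    unfolding lie_hom_def by (auto simp: Q(1) hom \<psi>)
qed

section \<open>The free Lie algebra and its universal property\<close>

context
  fixes R :: "('r, 'c) ring_scheme" (structure) and X :: "'x set"
  assumes R: "cring R"
begin

interpretation R: cring R by (rule R)

lemma lie_cong_terms:
  assumes "(s, t) \<in> lie_cong R X"
  shows "s \<in> lie_terms R X" and "t \<in> lie_terms R X"
  using assms by (induction rule: lie_cong.induct) (auto intro: lie_terms.intros)

lemma equiv_lie_cong: "equiv (lie_terms R X) (lie_cong R X)"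
proof (rule equivI)
  show "lie_cong R X \<subseteq> lie_terms R X \<times> lie_terms R X" using lie_cong_terms by auto
  show "refl_on (lie_terms R X) (lie_cong R X)" by (rule refl_onI) (rule lie_cong.refl)
  show "sym (lie_cong R X)" by (rule symI) (rule lie_cong.sym)
  show "trans (lie_cong R X)" by (rule transI) (rule lie_cong.trans)
qed

abbreviation lie_class :: "('r, 'x) lie_term \<Rightarrow> ('r, 'x) lie_term set" where
  "lie_class t \<equiv> lie_cong R X `` {t}"

lemma lie_class_eqI: "(s, t) \<in> lie_cong R X \<Longrightarrow> lie_class s = lie_class t"
  by (rule equiv_class_eq[OF equiv_lie_cong])

lemma carrier_free_lie: "carrier (free_lie R X) = lie_class ` lie_terms R X"
  by (auto simp: free_lie_def quotient_def)

lemma zero_free_lie: "\<zero>\<^bsub>free_lie R X\<^esub> = lie_class Zero"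
  by (simp add: free_lie_def)

lemma add_free_lie:
  assumes "s \<in> lie_terms R X" "t \<in> lie_terms R X"
  shows "lie_class s \<oplus>\<^bsub>free_lie R X\<^esub> lie_class t = lie_class (Add s t)"
proof -
  have "congruent2 (lie_cong R X) (lie_cong R X) (\<lambda>s t. lie_class (Add s t))"
    by (auto simp: congruent2_def intro!: lie_class_eqI lie_cong.cong_Add)
  from UN_equiv_class2[OF equiv_lie_cong equiv_lie_cong this assms] show ?thesis
    by (simp add: free_lie_def)
qed

lemma bracket_free_lie:
  assumes "s \<in> lie_terms R X" "t \<in> lie_terms R X"
  shows "bracket (free_lie R X) (lie_class s) (lie_class t) = lie_class (Br s t)"
proof -
  have "congruent2 (lie_cong R X) (lie_cong R X) (\<lambda>s t. lie_class (Br s t))"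
    by (auto simp: congruent2_def intro!: lie_class_eqI lie_cong.cong_Br)
  from UN_equiv_class2[OF equiv_lie_cong equiv_lie_cong this assms] show ?thesis
    by (simp add: free_lie_def)
qed

lemma smult_free_lie:
  assumes "a \<in> carrier R" "t \<in> lie_terms R X"
  shows "a \<odot>\<^bsub>free_lie R X\<^esub> lie_class t = lie_class (Scale a t)"
proof -
  have "congruent (lie_cong R X) (\<lambda>t. lie_class (Scale a t))"
    using assms(1) by (auto simp: congruent_def intro!: lie_class_eqI lie_cong.cong_Scale)
  from UN_equiv_class[OF equiv_lie_cong this assms(2)] show ?thesis
    by (simp add: free_lie_def)
qed

lemma lie_alg_free_lie: "lie_alg R (free_lie R X)"
proof -
  note ops = carrier_free_lie zero_free_lie add_free_lie smult_free_lie bracket_free_lie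
  have "abelian_group (free_lie R X)"
  proof (rule abelian_groupI)
    fix A assume "A \<in> carrier (free_lie R X)"
    then obtain t where t: "t \<in> lie_terms R X" "A = lie_class t" by (auto simp: carrier_free_lie)
    \<comment> \<open>Terms have no negation, so the additive inverse is scaling by -1.\<close>
    let ?n = "Scale (\<ominus> \<one>) t"
    have n: "?n \<in> lie_terms R X" using t by (auto intro: lie_terms.intros)
    have one: "Scale \<one> t \<in> lie_terms R X" using t by (auto intro: lie_terms.intros)
    have "lie_class (Add ?n t) = lie_class (Add ?n (Scale \<one> t))"
      by (rule lie_class_eqI) (rule lie_cong.cong_Add[OF lie_cong.refl[OF n] lie_cong.sym[OF lie_cong.scale_one[OF t(1)]]])
    also have "\<dots> = lie_class (Scale (\<ominus> \<one> \<oplus> \<one>) t)"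
      using t by (intro lie_class_eqI lie_cong.sym[OF lie_cong.scale_add_left]) auto
    also have "\<dots> = lie_class Zero"
      using t by (intro lie_class_eqI) (simp add: R.l_neg lie_cong.scale_zero)
    finally show "\<exists>B\<in>carrier (free_lie R X). B \<oplus>\<^bsub>free_lie R X\<^esub> A = \<zero>\<^bsub>free_lie R X\<^esub>"
      using t n by (auto simp: ops intro!: bexI[of _ "?n"])
  next
    fix A B assume "A \<in> carrier (free_lie R X)" "B \<in> carrier (free_lie R X)"
    then obtain s t where "s \<in> lie_terms R X" "A = lie_class s" "t \<in> lie_terms R X" "B = lie_class t"
      by (auto simp: carrier_free_lie)
    then show "A \<oplus>\<^bsub>free_lie R X\<^esub> B = B \<oplus>\<^bsub>free_lie R X\<^esub> A"
      using lie_class_eqI[OF lie_cong.add_comm] by (simp add: add_free_lie)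
  qed (auto simp: ops lie_terms.intros lie_cong.add_assoc[THEN lie_class_eqI]
      lie_cong.add_zero[THEN lie_class_eqI])
  then have "module R (free_lie R X)"
    by (rule moduleI[OF R]) (auto simp: ops lie_terms.intros
        lie_cong.scale_add_left[THEN lie_class_eqI] lie_cong.scale_add_right[THEN lie_class_eqI]
        lie_cong.scale_scale[THEN lie_class_eqI] lie_cong.scale_one[THEN lie_class_eqI])
  then show ?thesis
    by (rule lie_alg.intro, unfold_locales) (auto simp: ops lie_terms.intros
        lie_cong.br_add_left[THEN lie_class_eqI] lie_cong.br_add_right[THEN lie_class_eqI]
        lie_cong.br_scale_left[THEN lie_class_eqI] lie_cong.br_scale_right[THEN lie_class_eqI]
        lie_cong.br_self[THEN lie_class_eqI] lie_cong.jacobi[THEN lie_class_eqI])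
qed

lemma free_gen_closed: "x \<in> X \<Longrightarrow> free_gen R X x \<in> carrier (free_lie R X)"
  by (auto simp: free_gen_def carrier_free_lie lie_terms.Gen)

end

primrec lie_eval :: "('r, 'a, 'd) lie_algebra_scheme \<Rightarrow> ('x \<Rightarrow> 'a) \<Rightarrow> ('r, 'x) lie_term \<Rightarrow> 'a" where
  "lie_eval M f (Gen x) = f x"
| "lie_eval M f Zero = \<zero>\<^bsub>M\<^esub>"
| "lie_eval M f (Add s t) = lie_eval M f s \<oplus>\<^bsub>M\<^esub> lie_eval M f t"
| "lie_eval M f (Scale a t) = a \<odot>\<^bsub>M\<^esub> lie_eval M f t"
| "lie_eval M f (Br s t) = bracket M (lie_eval M f s) (lie_eval M f t)"

context lie_alg
begin

lemma lie_eval_closed: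
  assumes "f \<in> X \<rightarrow> carrier L" "t \<in> lie_terms R X"
  shows "lie_eval L f t \<in> carrier L"
  using assms(2) by (induction rule: lie_terms.induct) (use assms(1) in auto)

lemma lie_eval_cong:
  assumes f: "f \<in> X \<rightarrow> carrier L" and "(s, t) \<in> lie_cong R X"
  shows "lie_eval L f s = lie_eval L f t"
  using assms(2)
  by (induction rule: lie_cong.induct)
    (simp_all add: lie_eval_closed[OF f] M.a_ac smult_l_distr smult_r_distr smult_assoc1 bracket_add_left
      bracket_add_right bracket_smult_left bracket_smult_right bracket_self, simp_all add: lie_eval_closed[OF f] jacobi)

lemma free_lie_hom:
  assumes f: "f \<in> X \<rightarrow> carrier L"
  obtains \<phi> where "\<phi> \<in> lie_hom R (free_lie R X) L" "\<And>x. x \<in> X \<Longrightarrow> \<phi> (free_gen R X x) = f x"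
proof
  let ?c = "\<lambda>t. lie_cong R X `` {t}"
  let ?phi = "\<lambda>A. lie_eval L f (SOME t. t \<in> A)"
  have phi: "?phi (?c t) = lie_eval L f t" if "t \<in> lie_terms R X" for t
  proof -
    have "t \<in> ?c t" using lie_cong.refl[OF that] by simp
    then have "(SOME s. s \<in> ?c t) \<in> ?c t" by (rule someI)
    then show ?thesis using lie_eval_cong[OF f] by (metis Image_singleton_iff)
  qed
  note ops = carrier_free_lie[OF R.is_cring] zero_free_lie[OF R.is_cring] add_free_lie[OF R.is_cring]
    smult_free_lie[OF R.is_cring] bracket_free_lie[OF R.is_cring]
  show "?phi \<in> lie_hom R (free_lie R X) L"
    unfolding lie_hom_def by (auto simp only: ops phi lie_terms.intros lie_eval.simps lie_eval_closed[OF f]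
        Pi_iff mem_Collect_eq image_iff ball_simps)
  show "?phi (free_gen R X x) = f x" if "x \<in> X" for x
    unfolding free_gen_def using phi[OF lie_terms.Gen[OF that]] by simp
qed

end

text \<open>\<open>(x\<^sub>1, x\<^sub>2, x\<^sub>3)\<close> stands for \<open>x\<^sub>1 T + x\<^sub>2 T\<^sup>2 + x\<^sub>3 T\<^sup>3\<close> in \<open>T L[T]\<close> modulo \<open>T\<^sup>4\<close>; the homomorphism
  from a graded Lie algebra that multiplies the generators by \<open>T\<close> reads off homogeneous components.\<close>

definition lie_truncation :: "('r, 'a, 'd) lie_algebra_scheme \<Rightarrow> ('r, 'a \<times> 'a \<times> 'a) lie_algebra" where
  "lie_truncation L =
     \<lparr>carrier = carrier L \<times> carrier L \<times> carrier L, mult = undefined, one = undefined,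
      zero = (\<zero>\<^bsub>L\<^esub>, \<zero>\<^bsub>L\<^esub>, \<zero>\<^bsub>L\<^esub>),
      add = (\<lambda>(x1, x2, x3) (y1, y2, y3). (x1 \<oplus>\<^bsub>L\<^esub> y1, x2 \<oplus>\<^bsub>L\<^esub> y2, x3 \<oplus>\<^bsub>L\<^esub> y3)),
      smult = (\<lambda>a (x1, x2, x3). (a \<odot>\<^bsub>L\<^esub> x1, a \<odot>\<^bsub>L\<^esub> x2, a \<odot>\<^bsub>L\<^esub> x3)),
      bracket = (\<lambda>(x1, x2, x3) (y1, y2, y3).
        (\<zero>\<^bsub>L\<^esub>, bracket L x1 y1, bracket L x1 y2 \<oplus>\<^bsub>L\<^esub> bracket L x2 y1))\<rparr>"

lemma lie_truncation_simps [simp]: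
  "carrier (lie_truncation L) = carrier L \<times> carrier L \<times> carrier L"
  "\<zero>\<^bsub>lie_truncation L\<^esub> = (\<zero>\<^bsub>L\<^esub>, \<zero>\<^bsub>L\<^esub>, \<zero>\<^bsub>L\<^esub>)"
  "(x1, x2, x3) \<oplus>\<^bsub>lie_truncation L\<^esub> (y1, y2, y3) = (x1 \<oplus>\<^bsub>L\<^esub> y1, x2 \<oplus>\<^bsub>L\<^esub> y2, x3 \<oplus>\<^bsub>L\<^esub> y3)"
  "a \<odot>\<^bsub>lie_truncation L\<^esub> (x1, x2, x3) = (a \<odot>\<^bsub>L\<^esub> x1, a \<odot>\<^bsub>L\<^esub> x2, a \<odot>\<^bsub>L\<^esub> x3)"
  "bracket (lie_truncation L) (x1, x2, x3) (y1, y2, y3) =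
     (\<zero>\<^bsub>L\<^esub>, bracket L x1 y1, bracket L x1 y2 \<oplus>\<^bsub>L\<^esub> bracket L x2 y1)"
  by (simp_all add: lie_truncation_def)

context lie_alg
begin

lemma lie_alg_truncation: "lie_alg R (lie_truncation L)"
proof -
  have "abelian_group (lie_truncation L)"
  proof (rule abelian_groupI)
    fix x assume "x \<in> carrier (lie_truncation L)"
    then show "\<exists>y\<in>carrier (lie_truncation L). y \<oplus>\<^bsub>lie_truncation L\<^esub> x = \<zero>\<^bsub>lie_truncation L\<^esub>"
      by (cases x) (auto intro!: bexI[of _ "(\<ominus>\<^bsub>L\<^esub> fst x, \<ominus>\<^bsub>L\<^esub> fst (snd x), \<ominus>\<^bsub>L\<^esub> snd (snd x))"] simp: M.l_neg)
  qed (auto simp: M.a_ac)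
  then have "module R (lie_truncation L)"
    by (rule moduleI[OF R.is_cring]) (auto simp: smult_l_distr smult_r_distr smult_assoc1)
  then show ?thesis
    by (rule lie_alg.intro, unfold_locales)
      (auto simp: bracket_add_left bracket_add_right bracket_smult_left bracket_smult_right
        smult_r_distr bracket_self bracket_antisym jacobi M.a_ac)
qed

end

text \<open>The strictly upper triangular \<open>4 \<times> 4\<close> matrices over the field with two elements, with the
  encoding of \<open>unitriangular_group\<close>.\<close>

definition triangular_lie :: "(bit, unitriangular) lie_algebra" where
  "triangular_lie =
     \<lparr>carrier = UNIV, mult = undefined, one = undefined, zero = (0, 0, 0, 0, 0, 0),
      add = (\<lambda>(a, b, c, d, e, f) (a', b', c', d', e', f').
        (a + a', b + b', c + c', d + d', e + e', f + f')),
      smult = (\<lambda>t (a, b, c, d, e, f). (t * a, t * b, t * c, t * d, t * e, t * f)),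
      bracket = (\<lambda>(a, b, c, d, e, f) (a', b', c', d', e', f').
        (0, 0, 0, a * b' + a' * b, b * c' + b' * c, a * e' + d * c' + a' * e + d' * c))\<rparr>"

lemma triangular_lie_simps [simp]:
  "carrier triangular_lie = UNIV"
  "\<zero>\<^bsub>triangular_lie\<^esub> = (0, 0, 0, 0, 0, 0)"
  "(a, b, c, d, e, f) \<oplus>\<^bsub>triangular_lie\<^esub> (a', b', c', d', e', f') =
     (a + a', b + b', c + c', d + d', e + e', f + f')"
  "t \<odot>\<^bsub>triangular_lie\<^esub> (a, b, c, d, e, f) = (t * a, t * b, t * c, t * d, t * e, t * f)"
  "bracket triangular_lie (a, b, c, d, e, f) (a', b', c', d', e', f') =
     (0, 0, 0, a * b' + a' * b, b * c' + b' * c, a * e' + d * c' + a' * e + d' * c)"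
  by (simp_all add: triangular_lie_def)

lemma lie_alg_triangular: "lie_alg Z2 triangular_lie"
proof -
  have "abelian_group triangular_lie"
  proof (rule abelian_groupI)
    fix x :: unitriangular
    show "\<exists>y\<in>carrier triangular_lie. y \<oplus>\<^bsub>triangular_lie\<^esub> x = \<zero>\<^bsub>triangular_lie\<^esub>"
      by (rule bexI[of _ x], cases x) auto
  qed (auto simp: algebra_simps)
  then have "module Z2 triangular_lie"
    by (rule moduleI[OF class_cring.is_cring]) (auto simp: algebra_simps)
  then show ?thesis
    by (rule lie_alg.intro, unfold_locales) (auto simp: algebra_simps)
qed

lemma cring_Z2: "cring Z2"
  by (rule class_cring.is_cring)

section \<open>The Lie algebra L_K: relations, universal property, degrees\<close>

lemma graph_ideal_generators_closed:
  "{bracket (free_lie Z2 {1..m}) (free_gen Z2 {1..m} i) (free_gen Z2 {1..m} j) | i j.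
     i \<in> {1..m} \<and> j \<in> {1..m} \<and> {i, j} \<in> K} \<subseteq> carrier (free_lie Z2 {1..m})"
proof -
  interpret F: lie_alg Z2 "free_lie Z2 {1..m}" by (rule lie_alg_free_lie[OF cring_Z2])
  show ?thesis using free_gen_closed[OF cring_Z2, of _ "{1..m}"] by auto
qed

lemma lie_alg_graph_lie: "lie_alg Z2 (graph_lie m K)"
  unfolding graph_lie_def graph_ideal_def
  by (rule lie_quotient_cosets(4)[OF lie_alg_free_lie[OF cring_Z2] graph_ideal_generators_closed])

lemma mu_closed: "i \<in> {1..m} \<Longrightarrow> mu m K i \<in> carrier (graph_lie m K)"
  using lie_homD(1)[OF lie_quotient_cosets(2)[OF lie_alg_free_lie[OF cring_Z2]
        graph_ideal_generators_closed] free_gen_closed[OF cring_Z2]]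
  unfolding graph_lie_def mu_def graph_ideal_def .

lemma bracket_mu_edge:
  assumes "i \<in> {1..m}" "j \<in> {1..m}" "{i, j} \<in> K"
  shows "bracket (graph_lie m K) (mu m K i) (mu m K j) = \<zero>\<^bsub>graph_lie m K\<^esub>"
proof -
  let ?F = "free_lie Z2 {1..m}" and ?x = "free_gen Z2 {1..m}"
  interpret F: lie_alg Z2 ?F by (rule lie_alg_free_lie[OF cring_Z2])
  note Q = lie_quotient_cosets[OF F.lie_alg_axioms graph_ideal_generators_closed[of m K],
      folded graph_ideal_def graph_lie_def]
  interpret I: abelian_subgroup "graph_ideal m K" ?F
    unfolding graph_ideal_def by (rule F.lie_ideal_additive_subgroup[OF graph_ideal_generators_closed])
  have x: "?x i \<in> carrier ?F" "?x j \<in> carrier ?F"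
    by (rule free_gen_closed[OF cring_Z2 assms(1)], rule free_gen_closed[OF cring_Z2 assms(2)])
  have "bracket ?F (?x i) (?x j) \<in> graph_ideal m K"
    unfolding graph_ideal_def using assms by (intro lie_ideal.incl) auto
  then have "graph_ideal m K +>\<^bsub>?F\<^esub> bracket ?F (?x i) (?x j) = graph_ideal m K"
    by (rule I.a_rcos_const)
  then show ?thesis
    using lie_homD(4)[OF Q(2) x] by (simp add: mu_def) (simp add: graph_lie_def lie_quotient_def)
qed

lemma graph_lie_hom:
  assumes M: "lie_alg Z2 M" and f: "f \<in> {1..m} \<rightarrow> carrier M"
    and comm: "\<And>i j. \<lbrakk>i \<in> {1..m}; j \<in> {1..m}; {i, j} \<in> K\<rbrakk> \<Longrightarrow> bracket M (f i) (f j) = \<zero>\<^bsub>M\<^esub>"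
  obtains \<phi> where "\<phi> \<in> lie_hom Z2 (graph_lie m K) M" "\<And>i. i \<in> {1..m} \<Longrightarrow> \<phi> (mu m K i) = f i"
proof -
  let ?F = "free_lie Z2 {1..m}" and ?x = "free_gen Z2 {1..m}"
  have F: "lie_alg Z2 ?F" by (rule lie_alg_free_lie[OF cring_Z2])
  obtain \<phi> where \<phi>: "\<phi> \<in> lie_hom Z2 ?F M" "\<And>i. i \<in> {1..m} \<Longrightarrow> \<phi> (?x i) = f i"
    using lie_alg.free_lie_hom[OF M f] by metis
  have x: "?x i \<in> carrier ?F" if "i \<in> {1..m}" for i
    using free_gen_closed[OF cring_Z2 that] .
  have zero: "\<phi> s = \<zero>\<^bsub>M\<^esub>"
    if "s \<in> {bracket ?F (?x i) (?x j) | i j. i \<in> {1..m} \<and> j \<in> {1..m} \<and> {i, j} \<in> K}" for s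
  proof -
    from that obtain i j where "s = bracket ?F (?x i) (?x j)" "i \<in> {1..m}" "j \<in> {1..m}" "{i, j} \<in> K"
      by blast
    then show "\<phi> s = \<zero>\<^bsub>M\<^esub>" using lie_homD(4)[OF \<phi>(1) x x] \<phi>(2) comm by simp
  qed
  have I: "graph_ideal m K = lie_ideal Z2 ?F {bracket ?F (?x i) (?x j) | i j. i \<in> {1..m} \<and> j \<in> {1..m} \<and> {i, j} \<in> K}"
    by (rule graph_ideal_def)
  obtain \<psi> where \<psi>: "\<psi> \<in> lie_hom Z2 (graph_lie m K) M"
    "\<And>y. y \<in> carrier ?F \<Longrightarrow> \<psi> (graph_ideal m K +>\<^bsub>?F\<^esub> y) = \<phi> y"
    by (rule lie_quotient_factor[OF F M graph_ideal_generators_closed[of m K] \<phi>(1) zero, folded I graph_lie_def])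
      ((assumption | (rule that; assumption))+)
  show ?thesis
    by (rule that[OF \<psi>(1)]) (simp only: mu_def \<psi>(2) x \<phi>(2))
qed

text \<open>The substitution of \<mu>_i T for \<mu>_i is compatible with the relations because these
  are homogeneous: the bracket of two images is [\<mu>_i, \<mu>_j] T^2.\<close>

lemma graph_lie_truncation_hom:
  obtains \<pi> where "\<pi> \<in> lie_hom Z2 (graph_lie m K) (lie_truncation (graph_lie m K))"
    "\<And>i. i \<in> {1..m} \<Longrightarrow> \<pi> (mu m K i) = (mu m K i, \<zero>\<^bsub>graph_lie m K\<^esub>, \<zero>\<^bsub>graph_lie m K\<^esub>)"
proof -
  let ?L = "graph_lie m K" and ?f = "\<lambda>i. (mu m K i, \<zero>\<^bsub>graph_lie m K\<^esub>, \<zero>\<^bsub>graph_lie m K\<^esub>)"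
  interpret L: lie_alg Z2 ?L by (rule lie_alg_graph_lie)
  have f: "?f \<in> {1..m} \<rightarrow> carrier (lie_truncation ?L)" using mu_closed by auto
  have comm: "bracket (lie_truncation ?L) (?f i) (?f j) = \<zero>\<^bsub>lie_truncation ?L\<^esub>"
    if "i \<in> {1..m}" "j \<in> {1..m}" "{i, j} \<in> K" for i j
    using mu_closed[OF that(1)] mu_closed[OF that(2)] bracket_mu_edge[OF that] by simp
  show ?thesis
    by (rule graph_lie_hom[where K = K, OF L.lie_alg_truncation f]) ((rule comm that; assumption)+)
qed

lemma graph_lie_triangular_hom:
  assumes "p \<noteq> q" "q \<noteq> r" "{p, q} \<notin> K" "{q, r} \<notin> K"
  obtains \<phi> where "\<phi> \<in> lie_hom Z2 (graph_lie m K) triangular_lie"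
    "\<And>i. i \<in> {1..m} \<Longrightarrow> \<phi> (mu m K i) = unitriangular_gen (p, q, r) i"
proof -
  have f: "unitriangular_gen (p, q, r) \<in> {1..m} \<rightarrow> carrier triangular_lie" by simp
  have comm: "bracket triangular_lie (unitriangular_gen (p, q, r) i) (unitriangular_gen (p, q, r) j) =
      \<zero>\<^bsub>triangular_lie\<^esub>" if "{i, j} \<in> K" for i j
    using assms that by (auto simp: unitriangular_gen_def insert_commute)
  show ?thesis
    by (rule graph_lie_hom[where K = K, OF lie_alg_triangular f]) ((rule comm that; assumption)+)
qed

lemma homogeneous_closed:
  assumes "homogeneous Z2 (graph_lie m K) (mu m K ` {1..m}) d x"
  shows "x \<in> carrier (graph_lie m K)"
proof -
  interpret L: lie_alg Z2 "graph_lie m K" by (rule lie_alg_graph_lie)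
  show ?thesis using assms by (induction rule: homogeneous.induct) (auto simp: mu_closed)
qed

text \<open>A homogeneous x of degree d goes to x T^d modulo T^4. The clause on degree 0 carries the
  bracket case, since \<open>homogeneous\<close> admits the zero element in every degree and a
  degree 0 factor must make the bracket vanish.\<close>

lemma homogeneous_truncation:
  assumes \<pi>: "\<pi> \<in> lie_hom Z2 (graph_lie m K) (lie_truncation (graph_lie m K))"
    "\<And>i. i \<in> {1..m} \<Longrightarrow> \<pi> (mu m K i) = (mu m K i, \<zero>\<^bsub>graph_lie m K\<^esub>, \<zero>\<^bsub>graph_lie m K\<^esub>)"
    and "homogeneous Z2 (graph_lie m K) (mu m K ` {1..m}) d x"
  shows "(d = 0 \<longrightarrow> x = \<zero>\<^bsub>graph_lie m K\<^esub>) \<and>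
    \<pi> x = (if d = 1 then x else \<zero>\<^bsub>graph_lie m K\<^esub>, if d = 2 then x else \<zero>\<^bsub>graph_lie m K\<^esub>,
      if d = 3 then x else \<zero>\<^bsub>graph_lie m K\<^esub>)"
proof -
  let ?L = "graph_lie m K"
  interpret L: lie_alg Z2 ?L by (rule lie_alg_graph_lie)
  note hom = lie_homD[OF \<pi>(1)]
  show ?thesis
    using assms(3)
  proof (induction rule: homogeneous.induct)
    case (gen x)
    then show ?case using \<pi>(2) by auto
  next
    case (zero d)
    then show ?case using lie_hom_zero[OF \<pi>(1) lie_alg_graph_lie L.lie_alg_truncation] by simp
  next
    case (add d x y)
    then show ?case using homogeneous_closed[OF add.hyps(1)] homogeneous_closed[OF add.hyps(2)]
      by (simp add: hom)
  next
    case (smult a d x)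
    then show ?case using homogeneous_closed[OF smult.hyps(2)] by (simp add: hom)
  next
    case (bracket d x e y)
    have xy: "x \<in> carrier ?L" "y \<in> carrier ?L"
      using bracket.hyps homogeneous_closed by blast+
    note IH = bracket.IH[THEN conjunct1] bracket.IH[THEN conjunct2] hom(4)[OF xy] xy
    \<comment> \<open>Positive degrees with sum at most 3 are listed singly; in the last three cases
      the sum is at least 4 and truncation yields zero.\<close>
    consider "d = 0" | "e = 0" | "d = 1 \<and> e = 1" | "d = 1 \<and> e = 2" | "d = 2 \<and> e = 1"
      | "d = 1 \<and> 3 \<le> e" | "3 \<le> d \<and> e = 1" | "2 \<le> d \<and> 2 \<le> e" by linarith
    then show ?case
    proof cases
      case 1
      then show ?thesis using IH by simp
    next
      case 2
      then show ?thesis using IH by simp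
    next
      case 3
      then show ?thesis using IH by simp
    next
      case 4
      then show ?thesis using IH by simp
    next
      case 5
      then show ?thesis using IH by simp
    next
      case 6
      then show ?thesis using IH by simp
    next
      case 7
      then show ?thesis using IH by simp
    next
      case 8
      then show ?thesis using IH by simp
    qed
  qed
qed

section \<open>The sets \<open>\<Theta>\<^sub>K(J)\<close> and the Lie algebra \<open>N\<^sub>K\<close>\<close>

lemma component_full_subcomplex:
  "component (full_subcomplex K J) j = {(u, v). {u, v} \<in> K \<and> u \<in> J \<and> v \<in> J}\<^sup>* `` {j}"
  by (simp add: component_def full_subcomplex_def conj_assoc)

lemma component_refl: "j \<in> component (full_subcomplex K J) j"
  by (simp add: component_def)

lemma component_eq:
  assumes "{i, j} \<in> K" "i \<in> J" "j \<in> J"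
  shows "component (full_subcomplex K J) i = component (full_subcomplex K J) j"
proof -
  let ?E = "{(u, v). {u, v} \<in> K \<and> u \<in> J \<and> v \<in> J}"
  have "(i, j) \<in> ?E" "(j, i) \<in> ?E" using assms by (auto simp: insert_commute)
  then show ?thesis
    unfolding component_full_subcomplex by (auto intro: converse_rtrancl_into_rtrancl)
qed

lemma component_subset:
  assumes "j \<in> T" and "\<And>u v. \<lbrakk>u \<in> T; v \<in> J - T\<rbrakk> \<Longrightarrow> {u, v} \<notin> K"
  shows "component (full_subcomplex K J) j \<subseteq> T"
proof
  fix i assume "i \<in> component (full_subcomplex K J) j"
  then have "(j, i) \<in> {(u, v). {u, v} \<in> K \<and> u \<in> J \<and> v \<in> J}\<^sup>*"
    unfolding component_full_subcomplex by simp
  then show "i \<in> T"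
    by (induction rule: rtrancl_induct) (use assms in auto)
qed

lemma Theta_notin_max: "Max J \<notin> Theta K J"
  by (simp add: Theta_def)

text \<open>T only has to be closed off from the rest of J, so components need not be computed: a
  singleton or an edge serves as T below.\<close>

lemma ThetaI:
  assumes "j \<in> T" "T \<subseteq> J" "Max J \<notin> T" "\<And>i. i \<in> T \<Longrightarrow> j \<le> i"
    and "\<And>u v. \<lbrakk>u \<in> T; v \<in> J - T\<rbrakk> \<Longrightarrow> {u, v} \<notin> K"
  shows "j \<in> Theta K J"
  using assms component_subset[OF assms(1,5)] component_refl[of "Max J" K J]
  unfolding Theta_def by blast

text \<open>Only paths of at most two edges are exploited, which suffices for J with two or three
  vertices. The guards on \<open>Max J\<close> cover infinite J.\<close>

lemma ThetaD:
  assumes "j \<in> Theta K J"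
  shows "j \<in> J" and "{j, Max J} \<notin> K \<or> Max J \<notin> J"
    and "\<lbrakk>i \<in> J; {j, i} \<in> K\<rbrakk> \<Longrightarrow> j \<le> i"
    and "\<lbrakk>i \<in> J; {j, i} \<in> K; Max J \<in> J\<rbrakk> \<Longrightarrow> {i, Max J} \<notin> K"
proof -
  have j: "j \<in> J" "component (full_subcomplex K J) j \<noteq> component (full_subcomplex K J) (Max J)"
    "\<And>i. i \<in> component (full_subcomplex K J) j \<Longrightarrow> j \<le> i"
    using assms by (auto simp: Theta_def)
  then show "j \<in> J" "{j, Max J} \<notin> K \<or> Max J \<notin> J" using component_eq[of j "Max J" K J] by auto
  show "j \<le> i" if "i \<in> J" "{j, i} \<in> K"
    using component_eq[OF that(2) j(1) that(1)] component_refl[of i K J] j(3) by simp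
  show "{i, Max J} \<notin> K" if "i \<in> J" "{j, i} \<in> K" "Max J \<in> J"
    using component_eq[OF that(2) j(1) that(1)] component_eq[of i "Max J" K J] j(2) that by auto
qed

lemma Theta_pair:
  assumes "z < y"
  shows "Theta K {z, y} = (if {z, y} \<in> K then {} else {z})"
proof -
  have M: "Max {z, y} = y" using assms by (simp add: max_def)
  have "z \<in> Theta K {z, y}" if "{z, y} \<notin> K"
    by (rule ThetaI[of z "{z}"]) (use that assms in auto)
  moreover have "z \<notin> Theta K {z, y}" if "{z, y} \<in> K"
    using ThetaD(2)[of z K "{z, y}"] that M by auto
  moreover have "j = z" if "j \<in> Theta K {z, y}" for j
    using that ThetaD(1)[OF that] Theta_notin_max[of "{z, y}" K] M by auto
  ultimately show ?thesis by auto
qed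

text \<open>The vertex a can be cut off from c alone or together with b, whereas b is minimal and
  cut off from c only as an isolated vertex.\<close>

lemma Theta_triple:
  assumes abc: "a < b" "b < c"
  shows "a \<in> Theta K {a, b, c} \<longleftrightarrow> {a, c} \<notin> K \<and> \<not> ({a, b} \<in> K \<and> {b, c} \<in> K)"
    and "b \<in> Theta K {a, b, c} \<longleftrightarrow> {a, b} \<notin> K \<and> {b, c} \<notin> K"
    and "c \<notin> Theta K {a, b, c}"
proof -
  have M: "Max {a, b, c} = c" using abc by (simp add: max_def)
  show "c \<notin> Theta K {a, b, c}" using Theta_notin_max[of "{a, b, c}" K] M by simp
  show "a \<in> Theta K {a, b, c} \<longleftrightarrow> {a, c} \<notin> K \<and> \<not> ({a, b} \<in> K \<and> {b, c} \<in> K)"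
  proof
    assume "a \<in> Theta K {a, b, c}"
    from ThetaD(2)[OF this] ThetaD(4)[OF this, of b] M show "{a, c} \<notin> K \<and> \<not> ({a, b} \<in> K \<and> {b, c} \<in> K)" by auto
  next
    assume K: "{a, c} \<notin> K \<and> \<not> ({a, b} \<in> K \<and> {b, c} \<in> K)"
    show "a \<in> Theta K {a, b, c}"
    proof (cases "{a, b} \<in> K")
      case True
      show ?thesis by (rule ThetaI[of a "{a, b}"]) (use K True abc M in auto)
    next
      case False
      show ?thesis by (rule ThetaI[of a "{a}"]) (use K False abc M in auto)
    qed
  qed
  show "b \<in> Theta K {a, b, c} \<longleftrightarrow> {a, b} \<notin> K \<and> {b, c} \<notin> K"
  proof
    assume b: "b \<in> Theta K {a, b, c}"
    show "{a, b} \<notin> K \<and> {b, c} \<notin> K"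
      using ThetaD(3)[OF b, of a] ThetaD(2)[OF b] M abc by (auto simp: insert_commute)
  next
    assume K: "{a, b} \<notin> K \<and> {b, c} \<notin> K"
    show "b \<in> Theta K {a, b, c}"
      by (rule ThetaI[of b "{b}"]) (use K abc M in \<open>auto simp: insert_commute\<close>)
  qed
qed

lemma Theta_card:
  assumes "finite J" "j \<in> Theta K J"
  shows "2 \<le> card J"
proof -
  have "j \<in> J" "Max J \<in> J" "j \<noteq> Max J"
    using assms(2) ThetaD(1)[OF assms(2)] Theta_notin_max[of J K] Max_in[OF assms(1)] by auto
  then have "card {j, Max J} \<le> card J" using assms(1) by (intro card_mono) auto
  then show ?thesis using \<open>j \<noteq> Max J\<close> by simp
qed

lemma Theta_card_2_iff:
  "(J \<subseteq> {1..m} \<and> j \<in> Theta K J \<and> card J = 2) \<longleftrightarrow> (\<exists>z y. (z, y) \<in> non_edges m K \<and> J = {z, y} \<and> j = z)"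
proof
  assume A: "J \<subseteq> {1..m} \<and> j \<in> Theta K J \<and> card J = 2"
  then obtain u v where uv: "J = {u, v}" "u \<noteq> v" by (auto simp: card_2_iff)
  define z y where "z = min u v" and "y = max u v"
  have "J = {z, y}" "z < y" using uv by (auto simp: z_def y_def min_def max_def)
  then show "\<exists>z y. (z, y) \<in> non_edges m K \<and> J = {z, y} \<and> j = z"
    using A Theta_pair[of z y K]
    by (intro exI[of _ z] exI[of _ y]) (auto simp: non_edges_def split: if_splits)
next
  assume "\<exists>z y. (z, y) \<in> non_edges m K \<and> J = {z, y} \<and> j = z"
  then show "J \<subseteq> {1..m} \<and> j \<in> Theta K J \<and> card J = 2"
    by (auto simp: non_edges_def Theta_pair)
qed

lemma sorted_tripleE:
  fixes J :: "nat set"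
  assumes "card J = 3"
  obtains a b c where "J = {a, b, c}" "a < b" "b < c"
proof -
  obtain x y z where xyz: "J = {x, y, z}" "x \<noteq> y" "x \<noteq> z" "y \<noteq> z"
    using assms by (auto simp: card_3_iff)
  consider "x < y \<and> y < z" | "x < z \<and> z < y" | "y < x \<and> x < z" | "y < z \<and> z < x"
    | "z < x \<and> x < y" | "z < y \<and> y < x" using xyz by linarith
  then show ?thesis
    by cases (use that xyz(1) in \<open>auto simp: insert_commute\<close>)
qed

lemma Theta_card_3_iff:
  "(J \<subseteq> {1..m} \<and> j \<in> Theta K J \<and> card J = 3) \<longleftrightarrow>
     (\<exists>x y z. (x, y, z) \<in> theta_triples m K \<and> J = {x, y, z} \<and> j = z)"
proof
  assume A: "J \<subseteq> {1..m} \<and> j \<in> Theta K J \<and> card J = 3"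
  then obtain a b c where abc: "J = {a, b, c}" "a < b" "b < c" using sorted_tripleE by metis
  have j: "j \<in> Theta K {a, b, c}" and J: "{a, b, c} \<subseteq> {1..m}" using A abc by auto
  consider "j = a" | "j = b" using ThetaD(1)[OF j] Theta_triple(3)[OF abc(2,3), of K] j by auto
  then show "\<exists>x y z. (x, y, z) \<in> theta_triples m K \<and> J = {x, y, z} \<and> j = z"
  proof cases
    case 1
    have "(b, c, a) \<in> theta_triples m K"
      using j J abc 1 Theta_triple(1)[OF abc(2,3), of K] by (auto simp: theta_triples_def insert_commute)
    moreover have "J = {b, c, a}" using abc by auto
    ultimately show ?thesis using 1 by blast
  next
    case 2
    have "(a, c, b) \<in> theta_triples m K"
      using j J abc 2 Theta_triple(2)[OF abc(2,3), of K] by (auto simp: theta_triples_def insert_commute)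
    moreover have "J = {a, c, b}" using abc by auto
    ultimately show ?thesis using 2 by blast
  qed
next
  assume "\<exists>x y z. (x, y, z) \<in> theta_triples m K \<and> J = {x, y, z} \<and> j = z"
  then obtain x y z where t: "(x, y, z) \<in> theta_triples m K" and J: "J = {x, y, z}" "j = z" by blast
  have ne: "x \<noteq> y" "z \<noteq> y" "x \<noteq> z" and m: "J \<subseteq> {1..m}" using t J by (auto simp: theta_triples_def)
  have "z \<in> Theta K J"
  proof (cases "z < x")
    case True
    then have "z \<in> Theta K {z, x, y}"
      using t Theta_triple(1)[of z x y K] by (auto simp: theta_triples_def insert_commute)
    moreover have "J = {z, x, y}" using J by auto
    ultimately show ?thesis by simp
  next
    case False
    then have "z \<in> Theta K {x, z, y}"
      using t Theta_triple(2)[of x z y K] by (auto simp: theta_triples_def insert_commute)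
    moreover have "J = {x, z, y}" using J by auto
    ultimately show ?thesis by simp
  qed
  then show "J \<subseteq> {1..m} \<and> j \<in> Theta K J \<and> card J = 3" using J ne m by simp
qed

section \<open>Generators and homogeneous components of N_K\<close>

lemma homogeneous_c_mu:
  assumes "J \<subseteq> {1..m}" "j \<in> J"
  shows "homogeneous Z2 (graph_lie m K) (mu m K ` {1..m}) (card J) (c_mu m K (J - {j}) (mu m K j))"
proof -
  let ?h = "homogeneous Z2 (graph_lie m K) (mu m K ` {1..m})"
  have fin: "finite J" using assms(1) finite_subset by blast
  have step: "?h (length ts + 1) (foldr (\<lambda>t y. bracket (graph_lie m K) (mu m K t) y) ts (mu m K j))"
    if "set ts \<subseteq> {1..m}" for ts
    using that
  proof (induction ts)
    case Nil
    have "?h 1 (mu m K j)" using assms by (intro homogeneous.gen) auto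
    then show ?case by simp
  next
    case (Cons t ts)
    have "?h (1 + (length ts + 1)) (bracket (graph_lie m K) (mu m K t)
        (foldr (\<lambda>t y. bracket (graph_lie m K) (mu m K t) y) ts (mu m K j)))"
      using Cons by (intro homogeneous.bracket homogeneous.gen) auto
    then show ?case by simp
  qed
  have "length (sorted_list_of_set (J - {j})) + 1 = card J"
    using fin assms(2) card_Suc_Diff1[of J j] by simp
  then show ?thesis using step[of "sorted_list_of_set (J - {j})"] fin assms unfolding c_mu_def by auto
qed

lemma c_mu_pair: "c_mu m K {y} x = bracket (graph_lie m K) (mu m K y) x"
  by (simp add: c_mu_def)

lemma c_mu_triple:
  assumes "x < y"
  shows "c_mu m K {x, y} w = bracket (graph_lie m K) (mu m K x) (bracket (graph_lie m K) (mu m K y) w)"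
proof -
  have "sorted_list_of_set {x, y} = [x, y]"
    using assms by (simp add: sorted_list_of_set_nonempty min_def insert_Diff_if)
  then show ?thesis by (simp add: c_mu_def)
qed

lemma N_carrier_closed: "x \<in> N_carrier m K \<Longrightarrow> x \<in> carrier (graph_lie m K)"
  unfolding N_carrier_def
proof (induction rule: lie_subalgebra.induct)
  interpret L: lie_alg Z2 "graph_lie m K" by (rule lie_alg_graph_lie)
  {
    case (incl x)
    then obtain J j where "J \<subseteq> {1..m}" "j \<in> Theta K J" "x = c_mu m K (J - {j}) (mu m K j)" by blast
    then show ?case using homogeneous_closed[OF homogeneous_c_mu] ThetaD(1) by blast
  next
    case zero
    show ?case by simp
  next
    case (add x y)
    then show ?case by simp
  next
    case (smult a x)
    then show ?case by simp
  next
    case (bracket x y)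
    then show ?case by simp
  }
qed

lemma vectorspace_N_component: "vectorspace Z2 (N_component m K i)"
proof -
  interpret L: lie_alg Z2 "graph_lie m K" by (rule lie_alg_graph_lie)
  let ?C = "{x \<in> N_carrier m K. homogeneous Z2 (graph_lie m K) (mu m K ` {1..m}) i x}"
  have "submodule Z2 ?C (graph_lie m K)"
  proof (rule submodule.intro[OF L.module_axioms])
    show "?C \<subseteq> carrier (graph_lie m K)" using N_carrier_closed by auto
  qed (auto simp: N_carrier_def intro: homogeneous.zero homogeneous.add homogeneous.smult
      lie_subalgebra.zero lie_subalgebra.add lie_subalgebra.smult)
  then have "module Z2 (N_component m K i)"
    unfolding N_component_def by (rule L.submodule_is_module)
  then show ?thesis by (rule vectorspace.intro) (rule class_field)
qed

text \<open>Degree 2 and 3 only see the generators of that degree: all generators have degree at least 2,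
  so brackets of elements of \<open>N\<^sub>K\<close> have degree at least 4.\<close>

lemma N_component_generated:
  assumes i: "i \<in> {2, 3}" and zero: "\<zero>\<^bsub>graph_lie m K\<^esub> \<in> S"
    and add: "\<And>x y. \<lbrakk>x \<in> S; y \<in> S\<rbrakk> \<Longrightarrow> x \<oplus>\<^bsub>graph_lie m K\<^esub> y \<in> S"
    and gens: "\<And>J j. \<lbrakk>J \<subseteq> {1..m}; j \<in> Theta K J; card J = i\<rbrakk> \<Longrightarrow> c_mu m K (J - {j}) (mu m K j) \<in> S"
  shows "carrier (N_component m K i) \<subseteq> S"
proof -
  let ?L = "graph_lie m K"
  interpret L: lie_alg Z2 ?L by (rule lie_alg_graph_lie)
  obtain \<pi> where \<pi>: "\<pi> \<in> lie_hom Z2 ?L (lie_truncation ?L)"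
    "\<And>i. i \<in> {1..m} \<Longrightarrow> \<pi> (mu m K i) = (mu m K i, \<zero>\<^bsub>?L\<^esub>, \<zero>\<^bsub>?L\<^esub>)"
    by (rule graph_lie_truncation_hom[where m = m and K = K]) (rule that; assumption)
  note hom = lie_homD[OF \<pi>(1)]
  define part where "part x = (if i = 2 then fst (snd (\<pi> x)) else snd (snd (\<pi> x)))" for x
  \<comment> \<open>The invariant on the coefficient of T drives the induction: the T^2 and T^3
    coefficients of a bracket are sums of brackets that each involve a T coefficient of one
    argument, so they vanish on N_K.\<close>
  have "fst (\<pi> x) = \<zero>\<^bsub>?L\<^esub> \<and> part x \<in> S" if "x \<in> N_carrier m K" for x
    using that unfolding N_carrier_def
  proof (induction rule: lie_subalgebra.induct)
    case (incl x)
    then obtain J j where J: "J \<subseteq> {1..m}" "j \<in> Theta K J" and x: "x = c_mu m K (J - {j}) (mu m K j)"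
      by blast
    have "2 \<le> card J" using Theta_card[OF _ J(2)] J(1) finite_subset by blast
    then show ?case
      using homogeneous_truncation[OF \<pi> homogeneous_c_mu[OF J(1) ThetaD(1)[OF J(2)]]]
        gens[OF J] i zero by (auto simp: part_def x)
  next
    case zero
    then show ?case
      using lie_hom_zero[OF \<pi>(1) lie_alg_graph_lie L.lie_alg_truncation] \<open>\<zero>\<^bsub>?L\<^esub> \<in> S\<close>
      by (simp add: part_def)
  next
    case (add x y)
    then have xy: "x \<in> carrier ?L" "y \<in> carrier ?L" by (auto intro: N_carrier_closed simp: N_carrier_def)
    show ?case
      using add.IH assms(3)[of "part x" "part y"] hom(1)[OF xy(1)] hom(1)[OF xy(2)] hom(2)[OF xy]
      by (cases "\<pi> x"; cases "\<pi> y") (auto simp: part_def)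
  next
    case (smult a x)
    then have x: "x \<in> carrier ?L" by (auto intro: N_carrier_closed simp: N_carrier_def)
    show ?case
    proof (cases a)
      case one
      then show ?thesis using smult.IH L.smult_one[OF x] by simp
    next
      case zero
      then show ?thesis
        using L.smult_l_null[OF x] lie_hom_zero[OF \<pi>(1) lie_alg_graph_lie L.lie_alg_truncation]
          \<open>\<zero>\<^bsub>?L\<^esub> \<in> S\<close>
        by (simp add: part_def)
    qed
  next
    case (bracket x y)
    then have xy: "x \<in> carrier ?L" "y \<in> carrier ?L" by (auto intro: N_carrier_closed simp: N_carrier_def)
    show ?case
      using bracket.IH \<open>\<zero>\<^bsub>?L\<^esub> \<in> S\<close> hom(1)[OF xy(1)] hom(1)[OF xy(2)] hom(4)[OF xy]
      by (cases "\<pi> x"; cases "\<pi> y") (auto simp: part_def)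
  qed
  moreover have "part x = x" if "homogeneous Z2 ?L (mu m K ` {1..m}) i x" for x
    using homogeneous_truncation[OF \<pi> that] i by (auto simp: part_def)
  ultimately show ?thesis by (force simp: N_component_def)
qed

lemma generator_in_N_component:
  assumes "J \<subseteq> {1..m}" "j \<in> Theta K J" "card J = i"
  shows "c_mu m K (J - {j}) (mu m K j) \<in> carrier (N_component m K i)"
proof -
  have "c_mu m K (J - {j}) (mu m K j) \<in> N_carrier m K"
    unfolding N_carrier_def using assms by (intro lie_subalgebra.incl) blast
  then show ?thesis
    using homogeneous_c_mu[OF assms(1) ThetaD(1)[OF assms(2)]] assms(3) by (simp add: N_component_def)
qed

lemma N_component_simps:
  "\<zero>\<^bsub>N_component m K i\<^esub> = \<zero>\<^bsub>graph_lie m K\<^esub>"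
  "x \<oplus>\<^bsub>N_component m K i\<^esub> y = x \<oplus>\<^bsub>graph_lie m K\<^esub> y"
  by (simp_all add: N_component_def)

lemma N_component_closed: "x \<in> carrier (N_component m K i) \<Longrightarrow> x \<in> carrier (graph_lie m K)"
  using N_carrier_closed by (auto simp: N_component_def)

lemma n_dim_2:
  assumes K: "K \<subseteq> Pow {1..m}"
  shows "n_dim m K 2 = card (non_edges m K)"
proof -
  let ?L = "graph_lie m K"
  have "\<exists>\<phi>. \<phi> \<in> lie_hom Z2 ?L triangular_lie \<and>
      (\<forall>i\<in>{1..m}. \<phi> (mu m K i) = unitriangular_gen (fst e, snd e, 0) i)"
    if e: "e \<in> non_edges m K" for e
  proof -
    \<comment> \<open>0 is not a vertex, so it is a third letter in no simplex with
      \<open>snd e\<close>, and the generator image at E_34 is never taken.\<close>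
    have ne: "fst e \<noteq> snd e" "snd e \<noteq> 0" "{fst e, snd e} \<notin> K" "{snd e, 0} \<notin> K"
      using e K by (auto simp: non_edges_def)
    show ?thesis by (rule graph_lie_triangular_hom[OF ne, of m]) blast
  qed
  then obtain \<phi> where \<phi>: "\<And>e. e \<in> non_edges m K \<Longrightarrow> \<phi> e \<in> lie_hom Z2 ?L triangular_lie"
    "\<And>e i. \<lbrakk>e \<in> non_edges m K; i \<in> {1..m}\<rbrakk> \<Longrightarrow> \<phi> e (mu m K i) = unitriangular_gen (fst e, snd e, 0) i"
    by metis
  define b where "b = (\<lambda>(z, y). bracket ?L (mu m K y) (mu m K z))"
  have b: "b (z, y) = c_mu m K ({z, y} - {z}) (mu m K z)" if "z < y" for z y
  proof -
    have "{z, y} - {z} = {y}" using that by auto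
    then show ?thesis by (simp add: b_def c_mu_pair)
  qed
  \<comment> \<open>The entry at 13 is the coefficient of the word pq, for the non-edge e = (p,
    q).\<close>
  define f where "f e x = (case \<phi> e x of (_, _, _, d, _, _) \<Rightarrow> d)" for e x
  show ?thesis
    unfolding n_dim_def
  proof (rule dim_eq_card_of_dual_family[where b = b and f = f])
    show "vectorspace Z2 (N_component m K 2)" by (rule vectorspace_N_component)
    show "finite (non_edges m K)" by (rule finite_non_edges)
    show "b e \<in> carrier (N_component m K 2)" if "e \<in> non_edges m K" for e
    proof -
      obtain z y where e: "e = (z, y)" by (cases e)
      then have "z < y" using that by (simp add: non_edges_def)
      moreover have "{z, y} \<subseteq> {1..m} \<and> z \<in> Theta K {z, y} \<and> card {z, y} = 2"
        using that e by (subst Theta_card_2_iff) blast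
      ultimately show ?thesis unfolding e b[OF \<open>z < y\<close>] by (intro generator_in_N_component) auto
    qed
    show "f e (x \<oplus>\<^bsub>N_component m K 2\<^esub> y) = f e x + f e y"
      if "e \<in> non_edges m K" "x \<in> carrier (N_component m K 2)" "y \<in> carrier (N_component m K 2)" for e x y
      using lie_homD(2)[OF \<phi>(1)[OF that(1)]] that(2,3)[THEN N_component_closed]
      by (cases "\<phi> e x"; cases "\<phi> e y") (simp add: f_def N_component_simps)
    show "f e (b e') = (if e = e' then 1 else 0)" if e: "e \<in> non_edges m K" "e' \<in> non_edges m K" for e e'
    proof -
      obtain z y where e': "e' = (z, y)" by (cases e')
      have "y \<in> {1..m}" "z \<in> {1..m}" "z < y" using e e' by (auto simp: non_edges_def)
      moreover have "fst e < snd e" using e by (auto simp: non_edges_def)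
      ultimately show ?thesis
        using lie_homD(4)[OF \<phi>(1)[OF e(1)]] \<phi>(2)[OF e(1)] mu_closed
        by (cases e) (auto simp: f_def b_def e' unitriangular_gen_def)
    qed
    fix S assume S: "\<zero>\<^bsub>N_component m K 2\<^esub> \<in> S"
      "\<And>x y. \<lbrakk>x \<in> S; y \<in> S\<rbrakk> \<Longrightarrow> x \<oplus>\<^bsub>N_component m K 2\<^esub> y \<in> S" "b ` non_edges m K \<subseteq> S"
    show "carrier (N_component m K 2) \<subseteq> S"
    proof (rule N_component_generated)
      fix J j assume "J \<subseteq> {1..m}" "j \<in> Theta K J" "card J = 2"
      then obtain z y where zy: "(z, y) \<in> non_edges m K" "J = {z, y}" "j = z"
        using Theta_card_2_iff[of J m j K] by blast
      then have "z < y" by (simp add: non_edges_def)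
      then show "c_mu m K (J - {j}) (mu m K j) \<in> S" using b[of z y] zy S(3) by auto
    qed (use S in \<open>simp_all add: N_component_simps\<close>)
  qed
qed

text \<open>Modulo 2 the brackets [x, [y, z]] and [[y, z], x] agree, so the words and the table of
  the group case apply unchanged.\<close>

lemma n_dim_3: "n_dim m K 3 = card (theta_triples m K)"
proof -
  let ?L = "graph_lie m K"
  have "\<exists>\<phi>. \<phi> \<in> lie_hom Z2 ?L triangular_lie \<and> (\<forall>i\<in>{1..m}. \<phi> (mu m K i) = unitriangular_gen (theta_word K t) i)"
    if t: "t \<in> theta_triples m K" for t
  proof -
    obtain p q r where w: "theta_word K t = (p, q, r)" "p \<noteq> q" "q \<noteq> r" "{p, q} \<notin> K" "{q, r} \<notin> K"
      using t by (rule theta_wordE)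
    show ?thesis unfolding w(1) by (rule graph_lie_triangular_hom[OF w(2-5), of m]) blast
  qed
  then obtain \<phi> where \<phi>: "\<And>t. t \<in> theta_triples m K \<Longrightarrow> \<phi> t \<in> lie_hom Z2 ?L triangular_lie"
    "\<And>t i. \<lbrakk>t \<in> theta_triples m K; i \<in> {1..m}\<rbrakk> \<Longrightarrow> \<phi> t (mu m K i) = unitriangular_gen (theta_word K t) i"
    by metis
  define b where "b = (\<lambda>(x, y, z). bracket ?L (mu m K x) (bracket ?L (mu m K y) (mu m K z)))"
  have b: "b (x, y, z) = c_mu m K ({x, y, z} - {z}) (mu m K z)" if "(x, y, z) \<in> theta_triples m K" for x y z
  proof -
    have "{x, y, z} - {z} = {x, y}" "x < y" using that by (auto simp: theta_triples_def)
    then show ?thesis by (simp add: b_def c_mu_triple)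
  qed
  define f where "f t x = unitriangular_coeff (\<phi> t x)" for t x
  show ?thesis
    unfolding n_dim_def
  proof (rule dim_eq_card_of_dual_family[where b = b and f = f])
    show "vectorspace Z2 (N_component m K 3)" by (rule vectorspace_N_component)
    show "finite (theta_triples m K)" by (rule finite_theta_triples)
    show "b t \<in> carrier (N_component m K 3)" if "t \<in> theta_triples m K" for t
    proof -
      obtain x y z where t: "t = (x, y, z)" by (cases t)
      have "{x, y, z} \<subseteq> {1..m} \<and> z \<in> Theta K {x, y, z} \<and> card {x, y, z} = 3"
        using that t by (subst Theta_card_3_iff) blast
      then show ?thesis unfolding t b[OF that[unfolded t]] by (intro generator_in_N_component) auto
    qed
    show "f t (x \<oplus>\<^bsub>N_component m K 3\<^esub> y) = f t x + f t y"
      if "t \<in> theta_triples m K" "x \<in> carrier (N_component m K 3)" "y \<in> carrier (N_component m K 3)" for t x y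
      using lie_homD(2)[OF \<phi>(1)[OF that(1)]] that(2,3)[THEN N_component_closed]
      by (cases "\<phi> t x"; cases "\<phi> t y") (simp add: f_def N_component_simps unitriangular_coeff_def)
    show "f t (b t') = (if t = t' then 1 else 0)" if t: "t \<in> theta_triples m K" "t' \<in> theta_triples m K" for t t'
    proof -
      obtain x y z where t': "t' = (x, y, z)" by (cases t')
      obtain p q r where w: "theta_word K t = (p, q, r)" by (cases "theta_word K t")
      interpret L: lie_alg Z2 ?L by (rule lie_alg_graph_lie)
      have xyz: "x \<in> {1..m}" "y \<in> {1..m}" "z \<in> {1..m}" using t t' by (auto simp: theta_triples_def)
      have "f t (b t') = bracket_coeff (theta_word K t) t'"
        using xyz
        by (simp add: f_def b_def t' w lie_homD(4)[OF \<phi>(1)[OF t(1)]] \<phi>(2)[OF t(1)] mu_closed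
            unitriangular_gen_def unitriangular_coeff_def bracket_coeff_def algebra_simps)
      then show ?thesis using bracket_coeff_theta_word[OF t] by simp
    qed
    fix S assume S: "\<zero>\<^bsub>N_component m K 3\<^esub> \<in> S"
      "\<And>x y. \<lbrakk>x \<in> S; y \<in> S\<rbrakk> \<Longrightarrow> x \<oplus>\<^bsub>N_component m K 3\<^esub> y \<in> S" "b ` theta_triples m K \<subseteq> S"
    show "carrier (N_component m K 3) \<subseteq> S"
    proof (rule N_component_generated)
      fix J j assume "J \<subseteq> {1..m}" "j \<in> Theta K J" "card J = 3"
      then obtain x y z where "(x, y, z) \<in> theta_triples m K" "J = {x, y, z}" "j = z"
        using Theta_card_3_iff[of J m j K] by blast
      then show "c_mu m K (J - {j}) (mu m K j) \<in> S" using b[of x y z] S(3) by auto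
    qed (use S in \<open>simp_all add: N_component_simps\<close>)
  qed
qed

theorem proposition6p9:
  fixes m i :: nat and K :: "nat set set"
  assumes "flag_complex m K"
    and "i \<in> {2, 3}"
  shows "vectorspace.dim Z2 (Z2_space (lower_central_quotient (RC m K) i)) =
         (\<Sum>k = 2..i. n_dim m K k)"
proof -
  have K: "K \<subseteq> Pow {1..m}"
    using assms(1) by (simp add: flag_complex_def simplicial_complex_def)
  have "{2..3} = {2, 3::nat}" by auto
  then show ?thesis
    using assms(2) dim_RC_lower_central_quotient[of m K] n_dim_2[OF K] n_dim_3[of m K] by auto
qed

end
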